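(* Let $p\ge2$ and let $\eta$ be a finite real signed measure of mass one on $\mathbb{RP}^{p-1}$ with Jordan decomposition $\eta=\eta^+-\eta^-$, such that $$\int_{\mathbb{RP}^{p-1}}\frac1{|a^\top u|}\,|\eta|(\mathrm d[a])<\infty\quad\text{for Haar-almost every }u\in\mathbb S^{p-1},$$ and such that $$\mathcal L\{T_\eta(U)^\top V\mid P\}=\mathrm{Cauchy}(0,1)\quad\text{for Haar-almost every oriented plane }P .$$ Then the negative Jordan part $\eta^-$ is atomless. Consequently, $\eta$ is a positive (probability) measure whenever $\eta^-$ is purely atomic.
   Context: $T_\eta(u):=\int\frac{a}{a^\top u}\,\eta(\mathrm d[a])-u$, where either unit representative $a$ of $[a]$ may be used. $(U,V)$ is a Haar-distributed orthonormal two-frame in $\mathbb R^p$ (the first two columns of a Haar matrix in $O(p)$) and $P=\operatorname{span}\{U,V\}$ with the induced orientation; $\mathcal L\{\cdot\mid P\}$ is the conditional law given $P$. *)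

theory Defs
  imports "HOL-Probability.Probability"
begin

definition quotient_topology :: "'a topology \<Rightarrow> ('a \<Rightarrow> 'b) \<Rightarrow> 'b topology" where
  "quotient_topology X q =
     topology (\<lambda>U. U \<subseteq> q ` topspace X \<and> openin X {x \<in> topspace X. q x \<in> U})"

definition borel_of :: "'a topology \<Rightarrow> 'a measure" where
  "borel_of X = sigma (topspace X) {U. openin X U}"

lemma openin_quotient_topology:
  "openin (quotient_topology X q) U \<longleftrightarrow>
     U \<subseteq> q ` topspace X \<and> openin X {x \<in> topspace X. q x \<in> U}"
proof -
  have "istopology (\<lambda>U. U \<subseteq> q ` topspace X \<and> openin X {x \<in> topspace X. q x \<in> U})"
    unfolding istopology_def
  proof (intro conjI allI impI)
    fix S T
    assume S: "S \<subseteq> q ` topspace X \<and> openin X {x \<in> topspace X. q x \<in> S}"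
      and T: "T \<subseteq> q ` topspace X \<and> openin X {x \<in> topspace X. q x \<in> T}"
    show "S \<inter> T \<subseteq> q ` topspace X" using S by blast
    have "{x \<in> topspace X. q x \<in> S \<inter> T} =
        {x \<in> topspace X. q x \<in> S} \<inter> {x \<in> topspace X. q x \<in> T}" by blast
    moreover have "openin X ({x \<in> topspace X. q x \<in> S} \<inter> {x \<in> topspace X. q x \<in> T})"
      by (rule openin_Int[OF S[THEN conjunct2] T[THEN conjunct2]])
    ultimately show "openin X {x \<in> topspace X. q x \<in> S \<inter> T}" by (rule ssubst)
  next
    fix K
    assume K: "\<forall>S\<in>K. S \<subseteq> q ` topspace X \<and> openin X {x \<in> topspace X. q x \<in> S}"
    then show "\<Union>K \<subseteq> q ` topspace X" by blast
    have "{x \<in> topspace X. q x \<in> \<Union>K} = (\<Union>S\<in>K. {x \<in> topspace X. q x \<in> S})" by blast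
    then show "openin X {x \<in> topspace X. q x \<in> \<Union>K}" using K by auto
  qed
  then show ?thesis by (simp add: quotient_topology_def topology_inverse')
qed

lemma topspace_quotient_topology: "topspace (quotient_topology X q) = q ` topspace X"
proof -
  have "{x \<in> topspace X. q x \<in> q ` topspace X} = topspace X" by blast
  then have "openin (quotient_topology X q) (q ` topspace X)"
    by (simp add: openin_quotient_topology)
  then have "q ` topspace X \<subseteq> topspace (quotient_topology X q)"
    by (rule openin_subset)
  moreover have "topspace (quotient_topology X q) \<subseteq> q ` topspace X"
    using openin_topspace[of "quotient_topology X q"] unfolding openin_quotient_topology by (rule conjunct1)
  ultimately show ?thesis by (rule subset_antisym[rotated])
qed

lemma quotient_map_quotient_topology: "quotient_map X (quotient_topology X q) q"
  by (auto simp: quotient_map_def topspace_quotient_topology openin_quotient_topology)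

text \<open>The point \<open>[a]\<close> of real projective space is the pair \<open>{a, -a}\<close> of its unit representatives.\<close>

definition proj_class :: "real ^ 'n \<Rightarrow> (real ^ 'n) set" where
  "proj_class a = {a, - a}"

definition projective_space :: "(real ^ 'n) set topology" where
  "projective_space = quotient_topology (top_of_set (sphere 0 1)) proj_class"

definition signed_measure :: "'a measure \<Rightarrow> ('a set \<Rightarrow> real) \<Rightarrow> bool"
  \<comment> \<open>Only the \<sigma>-algebra of \<open>M\<close> matters; real values make the signed measure finite.\<close>
  where
  "signed_measure M \<eta> \<longleftrightarrow> \<eta> {} = 0 \<and>
     (\<forall>A :: nat \<Rightarrow> 'a set. range A \<subseteq> sets M \<longrightarrow> disjoint_family A \<longrightarrow>
        (\<lambda>k. \<eta> (A k)) sums \<eta> (\<Union>k. A k))"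

definition jordan_decomposition ::
    "'a measure \<Rightarrow> ('a set \<Rightarrow> real) \<Rightarrow> 'a measure \<Rightarrow> 'a measure \<Rightarrow> bool" where
  "jordan_decomposition M \<eta> \<eta>p \<eta>n \<longleftrightarrow>
     finite_measure \<eta>p \<and> finite_measure \<eta>n \<and> sets \<eta>p = sets M \<and> sets \<eta>n = sets M \<and>
     (\<forall>A \<in> sets M. \<eta> A = measure \<eta>p A - measure \<eta>n A) \<and>
     (\<exists>D \<in> sets M. emeasure \<eta>p (space M - D) = 0 \<and> emeasure \<eta>n D = 0)"

definition total_variation :: "'a measure \<Rightarrow> 'a measure \<Rightarrow> 'a measure" where
  "total_variation \<eta>p \<eta>n =
     measure_of (space \<eta>p) (sets \<eta>p) (\<lambda>A. emeasure \<eta>p A + emeasure \<eta>n A)"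

lemma sets_total_variation [simp]: "sets (total_variation \<eta>p \<eta>n) = sets \<eta>p"
  and space_total_variation [simp]: "space (total_variation \<eta>p \<eta>n) = space \<eta>p"
  by (simp_all add: total_variation_def)

lemma emeasure_total_variation:
  assumes "sets \<eta>n = sets \<eta>p" "A \<in> sets \<eta>p"
  shows "emeasure (total_variation \<eta>p \<eta>n) A = emeasure \<eta>p A + emeasure \<eta>n A"
proof (rule emeasure_measure_of[OF total_variation_def])
  show "countably_additive (sets (total_variation \<eta>p \<eta>n)) (\<lambda>A. emeasure \<eta>p A + emeasure \<eta>n A)"
  proof (rule countably_additiveI)
    fix F :: "nat \<Rightarrow> 'a set"
    assume F: "range F \<subseteq> sets (total_variation \<eta>p \<eta>n)" "disjoint_family F"
    have "(\<Sum>k. emeasure \<eta>p (F k) + emeasure \<eta>n (F k)) =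
        (\<Sum>k. emeasure \<eta>p (F k)) + (\<Sum>k. emeasure \<eta>n (F k))"
      by (simp add: suminf_add)
    also have "\<dots> = emeasure \<eta>p (\<Union>k. F k) + emeasure \<eta>n (\<Union>k. F k)"
      using F assms(1) by (simp add: suminf_emeasure)
    finally show "(\<Sum>k. emeasure \<eta>p (F k) + emeasure \<eta>n (F k)) =
        emeasure \<eta>p (\<Union>k. F k) + emeasure \<eta>n (\<Union>k. F k)" .
  qed
qed (use assms in \<open>auto simp: positive_def dest: sets.sets_into_space\<close>)

definition signed_integral ::
    "'a measure \<Rightarrow> 'a measure \<Rightarrow> ('a \<Rightarrow> 'b :: {banach, second_countable_topology}) \<Rightarrow> 'b" where
  "signed_integral \<eta>p \<eta>n f = integral\<^sup>L \<eta>p f - integral\<^sup>L \<eta>n f"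

definition measure_atom :: "'a measure \<Rightarrow> 'a set \<Rightarrow> bool" where
  "measure_atom M A \<longleftrightarrow> A \<in> sets M \<and> emeasure M A > 0 \<and>
     (\<forall>B \<in> sets M. B \<subseteq> A \<longrightarrow> emeasure M B = 0 \<or> emeasure M (A - B) = 0)"

definition atomless :: "'a measure \<Rightarrow> bool" where
  "atomless M \<longleftrightarrow> (\<forall>A. \<not> measure_atom M A)"

definition purely_atomic :: "'a measure \<Rightarrow> bool" where
  "purely_atomic M \<longleftrightarrow>
     (\<forall>A \<in> sets M. emeasure M A > 0 \<longrightarrow> (\<exists>B \<subseteq> A. measure_atom M B))"

definition unit_rep :: "(real ^ 'n) set \<Rightarrow> real ^ 'n" where
  "unit_rep l = (SOME a. a \<in> l)"

lemma unit_rep_indep: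
  assumes "a \<in> l" "l \<in> topspace projective_space"
  shows "(1 / (unit_rep l \<bullet> u)) *\<^sub>R unit_rep l = (1 / (a \<bullet> u)) *\<^sub>R a"
    and "\<bar>unit_rep l \<bullet> u\<bar> = \<bar>a \<bullet> u\<bar>"
proof -
  have "unit_rep l \<in> l" unfolding unit_rep_def using assms(1) by (rule someI)
  moreover obtain b where b: "l = {b, - b}"
    using assms(2) by (auto simp: projective_space_def topspace_quotient_topology proj_class_def)
  ultimately have "unit_rep l = b \<or> unit_rep l = - b" by blast
  moreover have "a = b \<or> a = - b" using assms(1) b by blast
  ultimately have "unit_rep l = a \<or> unit_rep l = - a" by (metis minus_minus)
  then show "(1 / (unit_rep l \<bullet> u)) *\<^sub>R unit_rep l = (1 / (a \<bullet> u)) *\<^sub>R a"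
    and "\<bar>unit_rep l \<bullet> u\<bar> = \<bar>a \<bullet> u\<bar>" by auto
qed

definition T_map :: "(real ^ 'n) set measure \<Rightarrow> (real ^ 'n) set measure \<Rightarrow> real ^ 'n \<Rightarrow> real ^ 'n" where
  "T_map \<eta>p \<eta>n u =
     signed_integral \<eta>p \<eta>n (\<lambda>l. (1 / (unit_rep l \<bullet> u)) *\<^sub>R unit_rep l) - u"

text \<open>Haar probability measure on \<open>O(p)\<close>; left invariance determines it uniquely.\<close>

definition haar_orthogonal :: "(real ^ 'n ^ 'n) measure \<Rightarrow> bool" where
  "haar_orthogonal H \<longleftrightarrow> prob_space H \<and>
     sets H = sets (restrict_space borel {Q. orthogonal_matrix Q}) \<and>
     (\<forall>R. orthogonal_matrix R \<longrightarrow> distr H H (\<lambda>Q. R ** Q) = H)"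

definition orthonormal_frames :: "((real ^ 'n) \<times> (real ^ 'n)) set" where
  "orthonormal_frames = {(u, v). norm u = 1 \<and> norm v = 1 \<and> u \<bullet> v = 0}"

text \<open>An oriented plane is encoded as the set of its positively oriented orthonormal bases. The
  last condition says that the change of basis from \<open>(u, v)\<close> to \<open>(x, y)\<close> has positive determinant.\<close>

definition oriented_plane :: "(real ^ 'n) \<times> (real ^ 'n) \<Rightarrow> ((real ^ 'n) \<times> (real ^ 'n)) set" where
  "oriented_plane = (\<lambda>(u, v). {(x, y). (x, y) \<in> orthonormal_frames \<and> span {x, y} = span {u, v} \<and>
     (x \<bullet> u) * (y \<bullet> v) - (x \<bullet> v) * (y \<bullet> u) > 0})"

definition oriented_grassmannian :: "((real ^ 'n) \<times> (real ^ 'n)) set topology" where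
  "oriented_grassmannian = quotient_topology (top_of_set orthonormal_frames) oriented_plane"

definition std_cauchy :: "real measure" where
  "std_cauchy = density lborel (\<lambda>x. ennreal (1 / (pi * (1 + x\<^sup>2))))"

text \<open>\<open>\<kappa>\<close> is a (version of the) regular conditional law of \<open>X\<close> given \<open>Y\<close> under \<open>M\<close>, where \<open>Y\<close> takes
  values in the measurable space \<open>N\<close>.\<close>

definition conditional_law ::
    "'w measure \<Rightarrow> ('w \<Rightarrow> real) \<Rightarrow> 'b measure \<Rightarrow> ('w \<Rightarrow> 'b) \<Rightarrow> ('b \<Rightarrow> real measure) \<Rightarrow> bool" where
  "conditional_law M X N Y \<kappa> \<longleftrightarrow>
     X \<in> borel_measurable M \<and> Y \<in> measurable M N \<and> \<kappa> \<in> measurable N (prob_algebra borel) \<and>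
     (\<forall>A \<in> sets N. \<forall>B \<in> sets borel.
        emeasure M {\<omega> \<in> space M. Y \<omega> \<in> A \<and> X \<omega> \<in> B} =
        (\<integral>\<^sup>+ y \<in> A. emeasure (\<kappa> y) B \<partial>distr M N Y))"

end

theory Submission
  imports Defs "HOL-Complex_Analysis.Complex_Analysis" "HOL-Real_Asymp.Real_Asymp"
begin

text \<open>
  Restrict everything to one plane with orthonormal basis \<open>(u, v)\<close> and turn the basis by the
  angle \<open>\<theta>\<close>. If \<open>a\<close> projects to a vector of argument \<open>\<phi>\<close> in the plane, then
  \<open>(a \<bullet> v) / (a \<bullet> u)\<close> becomes \<open>tan (\<phi> - \<theta>)\<close>. With \<open>w = exp (2 \<i> \<phi>)\<close> and
  \<open>\<zeta> = exp (2 \<i> \<theta>)\<close> one has \<open>(w - \<zeta>) / (w + \<zeta>) = \<i> tan (\<phi> - \<theta>)\<close>, so the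
  hypothesis speaks about the boundary values of the Herglotz transform of a signed measure on the
  unit circle, namely the image of \<open>\<eta>\<close> under \<open>a \<mapsto> w\<close>.

  For a positive measure \<open>\<mu>\<close> on the circle the Herglotz transform \<open>F\<close> has nonnegative real part
  in the disc. The integrability hypothesis makes \<open>F\<close> converge almost everywhere to its formal,
  purely imaginary boundary value \<open>\<i> g\<close>. Since \<open>exp (- s F)\<close> is bounded and holomorphic, the mean value
  property gives \<open>E (cos (s g)) = exp (- s \<mu>(circle))\<close>: the boundary function is Cauchy with
  scale the total mass (\<open>boundary_law\<close>).

  For a signed measure with Jordan parts of masses \<open>m\<^sub>+\<close>, \<open>m\<^sub>-\<close> and boundary functions
  \<open>p\<close>, \<open>q\<close> suppose that \<open>p - q\<close> is Cauchy of scale \<open>m\<^sub>+ - m\<^sub>-\<close>. For small \<open>s\<close> the quantity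
  \<open>E (1 - cos (s (p - q)))\<close> is about \<open>s (m\<^sub>+ - m\<^sub>-)\<close>, while \<open>E (1 - cos (s p)) + E (1 - cos (s q))\<close>
  is about \<open>s (m\<^sub>+ + m\<^sub>-)\<close>. The two differ by a cross term of size
  \<open>E \<bar>sin (s p / 2) sin (s q / 2)\<bar>\<close>, which is \<open>o(s)\<close>: up to small mass the two parts live on
  disjoint compact sets, and \<open>p\<close> is bounded wherever one stays away from the (reflected) support of its measure,
  so \<open>p\<close> and \<open>q\<close> are never large at the same place. Hence \<open>m\<^sub>- = 0\<close> (\<open>weight_nonneg\<close>,
  \<open>cauchy_law_dominated\<close>): in almost every plane the projected measure is positive.

  Now let \<open>\<eta>\<^sup>-\<close> have an atom. It contains a point mass at some line \<open>[x]\<close>, which is not charged by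
  \<open>\<eta>\<^sup>+\<close>. For almost every plane only a \<open>\<eta>\<^sup>+\<close>-null set of lines has the same projection as \<open>[x]\<close>
  (\<open>plane_form_nonzero\<close>), so the projected measure is negative at that projection: a
  contradiction (\<open>no_negative_point_mass\<close>).

  The passage from the conditional law to almost every single plane needs that the oriented plane
  determines, and is determined by, the bivector of the frame. The bivector is a Borel function of
  the plane (\<open>plane_wedge_measurable\<close>), and from the bivector one recovers in a Borel way a frame of
  that plane (\<open>sec_wedge\<close>). The mean over all rotations of a frame therefore is a function of
  the plane, and by right invariance of Haar measure it is the conditional expectation given the
  plane (\<open>angular_mean_AE\<close>).
\<close>

section \<open>The Herglotz kernel on the unit circle\<close>

text \<open>The circle is parametrised by \<open>x \<mapsto> exp (2 \<pi> \<i> x)\<close> on \<open>[0, 1]\<close>, so that Lebesgue measure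
  on that interval is already normalised and agrees with the parametrisation of contour integrals.\<close>

abbreviation unit_interval :: "real measure" where
  "unit_interval \<equiv> restrict_space lborel {0..1}"

definition circ :: "real \<Rightarrow> complex" where
  "circ x = cis (2 * pi * x)"

text \<open>This is the Herglotz kernel with pole at \<open>- w\<close> instead of \<open>w\<close>. With this sign a plane rotation
  by the angle \<open>\<theta>\<close> corresponds to \<open>z = exp (2 \<i> \<theta>)\<close> and the kernel becomes \<open>\<i> tan (\<phi> - \<theta>)\<close>
  for \<open>w = exp (2 \<i> \<phi>)\<close>.\<close>

definition herglotz :: "complex \<Rightarrow> complex \<Rightarrow> complex" where
  "herglotz w z = (w - z) / (w + z)"

lemma norm_circ [simp]: "norm (circ x) = 1"
  by (simp add: circ_def)

lemma circ_measurable [measurable]: "circ \<in> borel_measurable borel"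
proof -
  have "continuous_on UNIV circ"
    unfolding circ_def by (intro continuous_intros)
  then show ?thesis by (rule borel_measurable_continuous_onI)
qed

lemma herglotz_measurable' [measurable (raw)]:
  assumes "f \<in> borel_measurable M" "g \<in> borel_measurable M"
  shows "(\<lambda>x. herglotz (f x) (g x)) \<in> borel_measurable M"
  using assms unfolding herglotz_def by measurable

lemma Re_herglotz: "Re (herglotz w z) = ((norm w)\<^sup>2 - (norm z)\<^sup>2) / (norm (w + z))\<^sup>2"
  unfolding herglotz_def Re_divide cmod_power2 by (simp add: power2_eq_square algebra_simps)

lemma herglotz_boundary:
  assumes "norm w = 1" "norm z = 1"
  shows "herglotz w z = \<i> * Im (herglotz w z)"
  by (rule complex_eqI) (simp_all add: Re_herglotz assms)

lemma norm_herglotz_le: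
  assumes "norm w = 1" "norm z \<le> 1"
  shows "norm (herglotz w z) \<le> 2 / norm (w + z)"
proof -
  have "norm (w - z) \<le> 2"
    using norm_triangle_ineq4[of w z] assms by simp
  then show ?thesis
    by (simp add: herglotz_def norm_divide divide_right_mono)
qed

lemma prob_space_unit_interval: "prob_space unit_interval"
  by (rule prob_spaceI) (simp add: emeasure_restrict_space space_restrict_space)

interpretation unit_interval: prob_space unit_interval
  by (rule prob_space_unit_interval)

lemma measurable_unit_interval [measurable (raw)]:
  "f \<in> measurable borel N \<Longrightarrow> f \<in> measurable unit_interval N"
  by (intro measurable_restrict_space1) simp

lemma mean_value_circle:
  fixes f :: "complex \<Rightarrow> complex"
  assumes hol: "f holomorphic_on ball 0 1" and r: "0 < r" "r < 1"
  shows "integral\<^sup>L unit_interval (\<lambda>x. f (of_real r * circ x)) = f 0"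
proof -
  have sub: "cball 0 r \<subseteq> ball (0::complex) 1" using r by auto
  have "((\<lambda>u. f u / (u - 0)) has_contour_integral (2 * of_real pi * \<i> * f 0)) (circlepath 0 r)"
    using r by (intro Cauchy_integral_circlepath_simple holomorphic_on_subset[OF hol sub]) auto
  then have "((\<lambda>x. f (circlepath 0 r x) / circlepath 0 r x *
      vector_derivative (circlepath 0 r) (at x within {0..1})) has_integral 2 * of_real pi * \<i> * f 0) {0..1}"
    by (simp add: has_contour_integral_def)
  then have "((\<lambda>x. (2 * of_real pi * \<i>) * f (of_real r * circ x)) has_integral 2 * of_real pi * \<i> * f 0) {0..1}"
    by (rule has_integral_eq[rotated])
       (use r in \<open>simp add: vector_derivative_circlepath01, simp add: circlepath circ_def cis_conv_exp algebra_simps\<close>)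
  then have "((\<lambda>x. (1 / (2 * of_real pi * \<i>)) * ((2 * of_real pi * \<i>) * f (of_real r * circ x)))
      has_integral (1 / (2 * of_real pi * \<i>)) * (2 * of_real pi * \<i> * f 0)) {0..1}"
    by (rule has_integral_mult_right)
  then have hi: "((\<lambda>x. f (of_real r * circ x)) has_integral f 0) {0..1}" by simp
  have "continuous_on {0..1} (\<lambda>x. f (of_real r * circ x))"
  proof (rule continuous_on_compose2[OF holomorphic_on_imp_continuous_on[OF hol]])
    show "continuous_on {0..1} (\<lambda>x. of_real r * circ x)"
      unfolding circ_def by (intro continuous_intros)
  qed (use r in \<open>auto simp: norm_mult\<close>)
  then have "set_integrable lborel {0..1} (\<lambda>x. f (of_real r * circ x))"
    by (intro borel_integrable_atLeastAtMost') auto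
  from set_borel_integral_eq_integral(2)[OF this] integral_unique[OF hi]
  show ?thesis
    by (simp add: integral_restrict_space set_lebesgue_integral_def)
qed

text \<open>Moving \<open>z\<close> radially inwards at most halves its distance to \<open>- w\<close>; this dominates the kernel
  at interior points by the kernel on the boundary.\<close>

lemma norm_add_interior:
  assumes "norm (w::complex) = 1" "norm z = 1" "0 \<le> r" "r \<le> 1"
  shows "norm (w + z) \<le> 2 * norm (w + of_real r * z)"
proof -
  have "norm (w + z) \<le> norm (w + of_real r * z) + norm (of_real (1 - r) * z)"
    using norm_triangle_ineq[of "w + of_real r * z" "of_real (1 - r) * z"] by (simp add: algebra_simps)
  also have "norm (of_real (1 - r) * z) = 1 - r"
    using assms by (simp add: norm_mult del: of_real_diff)
  also have "1 - r \<le> norm (w + of_real r * z)"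
    using norm_triangle_ineq2[of w "- (of_real r * z)"] assms by (simp add: norm_mult)
  finally show ?thesis by simp
qed

text \<open>All signed measures that occur are written as weights against one positive measure \<open>\<rho>\<close>; Jordan
  parts and restrictions to compact sets are then just products of weights. By the last assumption
  the pole of the kernel is \<open>\<rho>\<close>-negligible for almost every boundary point.\<close>

locale circle_measure = finite_measure \<rho> for \<rho> :: "complex measure" +
  assumes sets_rho [measurable_cong, simp]: "sets \<rho> = sets borel"
    and on_circle: "AE w in \<rho>. norm w = 1"
    and no_antipode: "AE x in unit_interval. AE w in \<rho>. w + circ x \<noteq> 0"
begin

definition admissible :: "(complex \<Rightarrow> real) \<Rightarrow> bool" where
  "admissible k \<longleftrightarrow> k \<in> borel_measurable borel \<and> integrable \<rho> k \<and>
     (AE x in unit_interval. integrable \<rho> (\<lambda>w. k w / norm (w + circ x)))"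

definition herglotz_int :: "(complex \<Rightarrow> real) \<Rightarrow> complex \<Rightarrow> complex" where
  "herglotz_int k z = (\<integral>w. of_real (k w) * herglotz w z \<partial>\<rho>)"

definition boundary_fun :: "(complex \<Rightarrow> real) \<Rightarrow> real \<Rightarrow> real" where
  "boundary_fun k x = (\<integral>w. k w * Im (herglotz w (circ x)) \<partial>\<rho>)"

lemma boundary_fun_measurable [measurable]:
  assumes [measurable]: "k \<in> borel_measurable borel"
  shows "boundary_fun k \<in> borel_measurable borel"
  unfolding boundary_fun_def by measurable

lemma admissible_mono:
  assumes "admissible k" "h \<in> borel_measurable borel" "\<And>w. \<bar>h w\<bar> \<le> \<bar>k w\<bar>"
  shows "admissible h"
proof -
  note [measurable] = assms(2)
  have "integrable \<rho> h"
    by (rule Bochner_Integration.integrable_bound[of _ k]) (use assms in \<open>auto simp: admissible_def\<close>)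
  moreover have "AE x in unit_interval. integrable \<rho> (\<lambda>w. h w / norm (w + circ x))"
  proof -
    have "AE x in unit_interval. integrable \<rho> (\<lambda>w. k w / norm (w + circ x))"
      using assms by (auto simp: admissible_def)
    then show ?thesis
    proof eventually_elim
      case (elim x)
      then show ?case
        by (rule Bochner_Integration.integrable_bound)
           (use assms in \<open>auto intro!: divide_right_mono\<close>)
    qed
  qed
  ultimately show ?thesis using assms by (auto simp: admissible_def)
qed

lemma admissibleD:
  assumes "admissible k"
  shows "k \<in> borel_measurable borel" "integrable \<rho> k"
    "AE x in unit_interval. integrable \<rho> (\<lambda>w. k w / norm (w + circ x))"
  using assms by (auto simp: admissible_def)

lemma integrable_boundary:
  assumes k: "k \<in> borel_measurable borel" "integrable \<rho> (\<lambda>w. k w / norm (w + circ x))"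
  shows "integrable \<rho> (\<lambda>w. k w * Im (herglotz w (circ x)))"
proof (rule Bochner_Integration.integrable_bound)
  note [measurable] = k(1)
  show "integrable \<rho> (\<lambda>w. 2 * (k w / norm (w + circ x)))" by (rule integrable_mult_right[OF k(2)])
  show "(\<lambda>w. k w * Im (herglotz w (circ x))) \<in> borel_measurable \<rho>" by measurable
  show "AE w in \<rho>. norm (k w * Im (herglotz w (circ x))) \<le> norm (2 * (k w / norm (w + circ x)))"
    using on_circle
  proof eventually_elim
    case (elim w)
    have "\<bar>Im (herglotz w (circ x))\<bar> \<le> 2 / norm (w + circ x)"
      using norm_herglotz_le[OF elim, of "circ x"] abs_Im_le_cmod[of "herglotz w (circ x)"] by simp
    then have "\<bar>k w\<bar> * \<bar>Im (herglotz w (circ x))\<bar> \<le> \<bar>k w\<bar> * (2 / norm (w + circ x))"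
      by (rule mult_left_mono) simp
    then show ?case by (simp add: abs_mult field_simps)
  qed
qed

lemma boundary_fun_add:
  assumes "admissible k" "admissible h"
  shows "AE x in unit_interval. boundary_fun (\<lambda>w. k w + h w) x = boundary_fun k x + boundary_fun h x"
  using admissibleD(3)[OF assms(1)] admissibleD(3)[OF assms(2)]
proof eventually_elim
  case (elim x)
  have "integrable \<rho> (\<lambda>w. k w * Im (herglotz w (circ x)))" "integrable \<rho> (\<lambda>w. h w * Im (herglotz w (circ x)))"
    using elim assms by (auto intro!: integrable_boundary admissibleD(1))
  then show ?case
    by (simp add: boundary_fun_def distrib_right)
qed

lemma boundary_fun_diff:
  assumes "admissible k" "admissible h"
  shows "AE x in unit_interval. boundary_fun (\<lambda>w. k w - h w) x = boundary_fun k x - boundary_fun h x"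
  using admissibleD(3)[OF assms(1)] admissibleD(3)[OF assms(2)]
proof eventually_elim
  case (elim x)
  have "integrable \<rho> (\<lambda>w. k w * Im (herglotz w (circ x)))" "integrable \<rho> (\<lambda>w. h w * Im (herglotz w (circ x)))"
    using elim assms by (auto intro!: integrable_boundary admissibleD(1))
  then show ?case
    by (simp add: boundary_fun_def left_diff_distrib)
qed

lemma integrable_herglotz:
  assumes k: "k \<in> borel_measurable borel" "integrable \<rho> k" and z: "norm z < 1"
  shows "integrable \<rho> (\<lambda>w. of_real (k w) * herglotz w z)"
proof (rule Bochner_Integration.integrable_bound)
  note [measurable] = k(1)
  show "integrable \<rho> (\<lambda>w. 2 / (1 - norm z) * k w)" using k by simp
  show "(\<lambda>w. of_real (k w) * herglotz w z) \<in> borel_measurable \<rho>" by measurable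
  show "AE w in \<rho>. norm (of_real (k w) * herglotz w z) \<le> norm (2 / (1 - norm z) * k w)"
    using on_circle
  proof eventually_elim
    case (elim w)
    have "1 - norm z \<le> norm (w + z)"
      using norm_triangle_ineq2[of w "- z"] elim by simp
    then have "2 / norm (w + z) \<le> 2 / (1 - norm z)"
      using z by (intro divide_left_mono) (auto intro!: mult_pos_pos simp del: zero_less_norm_iff)
    then have "norm (herglotz w z) \<le> 2 / (1 - norm z)"
      using norm_herglotz_le[OF elim, of z] z by linarith
    then have "\<bar>k w\<bar> * norm (herglotz w z) \<le> \<bar>k w\<bar> * (2 / (1 - norm z))"
      by (rule mult_left_mono) simp
    then show ?case using z by (simp add: norm_mult abs_mult field_simps)
  qed
qed

text \<open>The kernel is \<open>2 w / (w + z) - 1\<close>, and \<open>w / (w + z)\<close> is a geometric series in \<open>- z / w\<close> that may be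
  integrated term by term.\<close>

lemma herglotz_int_holomorphic:
  assumes k: "k \<in> borel_measurable borel" "integrable \<rho> k"
  shows "herglotz_int k holomorphic_on ball 0 1"
proof -
  note [measurable] = k(1)
  define c where "c n = (\<integral>w. of_real (k w) * (- 1 / w) ^ n \<partial>\<rho>)" for n :: nat
  have series: "((\<lambda>n. c n * z ^ n) sums (\<integral>w. of_real (k w) * (w / (w + z)) \<partial>\<rho>))"
    if z: "norm z < 1" for z
  proof -
    let ?f = "\<lambda>n w. of_real (k w) * (- 1 / w) ^ n * z ^ n"
    have nrm: "AE w in \<rho>. norm (?f n w) = \<bar>k w\<bar> * norm z ^ n" for n
      using on_circle by eventually_elim (simp add: norm_mult norm_power norm_divide)
    have int: "integrable \<rho> (?f n)" for n
    proof (rule Bochner_Integration.integrable_bound)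
      show "integrable \<rho> (\<lambda>w. k w * norm z ^ n)" using k by simp
      show "?f n \<in> borel_measurable \<rho>" by measurable
      show "AE w in \<rho>. norm (?f n w) \<le> norm (k w * norm z ^ n)"
        using nrm[of n] by eventually_elim (simp add: abs_mult)
    qed
    have intn: "(\<integral>w. norm (?f n w) \<partial>\<rho>) = (\<integral>w. \<bar>k w\<bar> \<partial>\<rho>) * norm z ^ n" for n
    proof -
      have "(\<integral>w. norm (?f n w) \<partial>\<rho>) = (\<integral>w. \<bar>k w\<bar> * norm z ^ n \<partial>\<rho>)"
        by (rule integral_cong_AE) (use nrm in auto)
      then show ?thesis by simp
    qed
    have "(\<lambda>n. \<integral>w. ?f n w \<partial>\<rho>) sums (\<integral>w. (\<Sum>n. ?f n w) \<partial>\<rho>)"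
    proof (rule sums_integral[OF int])
      show "AE w in \<rho>. summable (\<lambda>n. norm (?f n w))"
        using on_circle
        by eventually_elim (use z in \<open>auto simp: norm_mult norm_power norm_divide intro!: summable_mult summable_geometric\<close>)
      show "summable (\<lambda>n. \<integral>w. norm (?f n w) \<partial>\<rho>)"
        unfolding intn using z by (intro summable_mult summable_geometric) auto
    qed
    moreover have "(\<integral>w. (\<Sum>n. ?f n w) \<partial>\<rho>) = (\<integral>w. of_real (k w) * (w / (w + z)) \<partial>\<rho>)"
    proof (rule integral_cong_AE)
      show "AE w in \<rho>. (\<Sum>n. ?f n w) = of_real (k w) * (w / (w + z))"
        using on_circle
      proof eventually_elim
        case (elim w)
        then have w0: "w \<noteq> 0" by auto
        have "norm (- z / w) < 1" using elim z by (simp add: norm_divide)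
        from geometric_sums[OF this] have "(\<lambda>n. of_real (k w) * (- z / w) ^ n) sums (of_real (k w) * (1 / (1 - - z / w)))"
          by (rule sums_mult)
        also have "1 / (1 - - z / w) = w / (w + z)"
          using w0 by (simp add: field_simps)
        also have "(\<lambda>n. of_real (k w) * (- z / w) ^ n) = (\<lambda>n. ?f n w)"
          by (simp add: fun_eq_iff power_divide power_minus[of "z / w"] power_minus[of "1 / w"])
        finally show ?case by (rule sums_unique[symmetric])
      qed
      show "(\<lambda>w. \<Sum>n. ?f n w) \<in> borel_measurable \<rho>" by measurable
    qed measurable
    moreover have "(\<integral>w. ?f n w \<partial>\<rho>) = c n * z ^ n" for n
      by (simp add: c_def)
    ultimately show ?thesis by (simp only:)
  qed
  have eq: "herglotz_int k z = 2 * (\<integral>w. of_real (k w) * (w / (w + z)) \<partial>\<rho>) - of_real (\<integral>w. k w \<partial>\<rho>)"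
    if z: "norm z < 1" for z
  proof -
    have "AE w in \<rho>. of_real (k w) * (w / (w + z)) = (1/2) * (of_real (k w) * herglotz w z + of_real (k w))"
      using on_circle
    proof eventually_elim
      case (elim w)
      have "w + z \<noteq> 0" using elim z by (auto simp: add_eq_0_iff)
      then have *: "w / (w + z) = (1/2) * (herglotz w z + 1)"
        by (simp add: herglotz_def field_simps)
      show ?case unfolding * by (simp add: algebra_simps)
    qed
    then have "(\<integral>w. of_real (k w) * (w / (w + z)) \<partial>\<rho>) = (\<integral>w. (1/2) * (of_real (k w) * herglotz w z + of_real (k w)) \<partial>\<rho>)"
      by (intro integral_cong_AE) measurable
    also have "\<dots> = (1/2) * (herglotz_int k z + of_real (\<integral>w. k w \<partial>\<rho>))"
      using integrable_herglotz[OF k z] k by (simp add: herglotz_int_def)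
    finally have *: "(\<integral>w. of_real (k w) * (w / (w + z)) \<partial>\<rho>) = (1/2) * (herglotz_int k z + of_real (\<integral>w. k w \<partial>\<rho>))" .
    show ?thesis unfolding * by (simp add: add_divide_distrib)
  qed
  have "(\<lambda>z. 2 * (\<integral>w. of_real (k w) * (w / (w + z)) \<partial>\<rho>) - of_real (\<integral>w. k w \<partial>\<rho>)) holomorphic_on ball 0 1"
    by (intro holomorphic_intros power_series_holomorphic[where a = c]) (use series in auto)
  then show ?thesis
    by (rule holomorphic_transform) (simp add: eq)
qed

text \<open>The function \<open>exp (- s F)\<close> is bounded by \<open>1\<close> because the kernel has nonnegative real part. The
  mean value property holds on every circle of radius \<open>r < 1\<close> with the same value
  \<open>exp (- s F(0))\<close>, and bounded convergence carries it to \<open>r = 1\<close>, where \<open>F\<close> is \<open>\<i>\<close> times the boundary function.\<close>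

theorem boundary_law:
  assumes k: "admissible k" "\<And>w. 0 \<le> k w" and s: "0 \<le> s"
  shows "(\<integral>x. cos (s * boundary_fun k x) \<partial>unit_interval) = exp (- s * (\<integral>w. k w \<partial>\<rho>))"
proof -
  note km [measurable] = admissibleD(1)[OF k(1)] and ki = admissibleD(2)[OF k(1)]
  define E where "E z = exp (- of_real s * herglotz_int k z)" for z
  define r where "r n = 1 - 1 / (real n + 2)" for n :: nat
  have r: "0 < r n" "r n < 1" for n by (auto simp: r_def field_simps)
  have rlim: "r \<longlonglongrightarrow> 1"
    unfolding r_def by real_asymp
  have holE: "E holomorphic_on ball 0 1"
    unfolding E_def by (intro holomorphic_intros herglotz_int_holomorphic km ki)
  have "AE w in \<rho>. herglotz w 0 = 1"
    using on_circle by eventually_elim (auto simp: herglotz_def)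
  then have h0: "herglotz_int k 0 = of_real (\<integral>w. k w \<partial>\<rho>)"
    unfolding herglotz_int_def by (subst integral_cong_AE[where g = "\<lambda>w. of_real (k w)"]) auto
  have mv: "(\<integral>x. E (of_real (r n) * circ x) \<partial>unit_interval) = exp (- of_real (s * (\<integral>w. k w \<partial>\<rho>)))" for n
    by (subst mean_value_circle[OF holE r]) (simp add: E_def h0)
  have bound: "norm (E z) \<le> 1" if z: "norm z < 1" for z
  proof -
    have "0 \<le> (\<integral>w. Re (of_real (k w) * herglotz w z) \<partial>\<rho>)"
    proof (rule integral_nonneg_AE)
      show "AE w in \<rho>. 0 \<le> Re (of_real (k w) * herglotz w z)"
        using on_circle
      proof eventually_elim
        case (elim w)
        have "(norm z)\<^sup>2 \<le> 1" using z by (simp add: power_le_one)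
        then show ?case using k(2)[of w] elim by (simp add: Re_herglotz)
      qed
    qed
    also have "\<dots> = Re (herglotz_int k z)"
      unfolding herglotz_int_def by (rule integral_Re[OF integrable_herglotz[OF km ki z]])
    finally show ?thesis using s by (simp add: E_def norm_exp_eq_Re)
  qed
  have Emeas: "(\<lambda>x. E (of_real (r n) * circ x)) \<in> borel_measurable unit_interval" for n
  proof -
    have "continuous_on UNIV (\<lambda>x. E (of_real (r n) * circ x))"
    proof (rule continuous_on_compose2[OF holomorphic_on_imp_continuous_on[OF holE]])
      show "continuous_on UNIV (\<lambda>x. of_real (r n) * circ x)"
        unfolding circ_def by (intro continuous_intros)
    qed (use r in \<open>auto simp: norm_mult abs_of_pos\<close>)
    then show ?thesis by (intro measurable_unit_interval borel_measurable_continuous_onI)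
  qed
  have lim: "AE x in unit_interval. (\<lambda>n. E (of_real (r n) * circ x)) \<longlonglongrightarrow> exp (- \<i> * of_real (s * boundary_fun k x))"
    using admissibleD(3)[OF k(1)] no_antipode
  proof eventually_elim
    case (elim x)
    have "(\<lambda>n. herglotz_int k (of_real (r n) * circ x)) \<longlonglongrightarrow> (\<integral>w. of_real (k w) * herglotz w (circ x) \<partial>\<rho>)"
      unfolding herglotz_int_def
    proof (rule integral_dominated_convergence)
      show "integrable \<rho> (\<lambda>w. 4 * \<bar>k w / norm (w + circ x)\<bar>)"
        using elim(1) by (intro integrable_mult_right integrable_abs)
      show "AE w in \<rho>. (\<lambda>n. of_real (k w) * herglotz w (of_real (r n) * circ x)) \<longlonglongrightarrow> of_real (k w) * herglotz w (circ x)"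
        using elim(2)
      proof eventually_elim
        case (elim w)
        have "(\<lambda>n. of_real (r n) * circ x) \<longlonglongrightarrow> of_real 1 * circ x"
          by (intro tendsto_intros rlim)
        then show ?case
          unfolding herglotz_def using elim by (intro tendsto_intros) auto
      qed
      show "AE w in \<rho>. norm (of_real (k w) * herglotz w (of_real (r n) * circ x)) \<le> 4 * \<bar>k w / norm (w + circ x)\<bar>" for n
        using elim(2) on_circle
      proof eventually_elim
        case (elim w)
        have pos: "0 < norm (w + circ x)" using elim by simp
        have le: "norm (w + circ x) \<le> 2 * norm (w + of_real (r n) * circ x)"
          using elim r[of n] by (intro norm_add_interior) auto
        have "norm (herglotz w (of_real (r n) * circ x)) \<le> 2 / norm (w + of_real (r n) * circ x)"
          using elim r[of n] by (intro norm_herglotz_le) (auto simp: norm_mult)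
        also have "\<dots> \<le> 4 / norm (w + circ x)"
          using frac_le[of 4 4 "norm (w + circ x)" "2 * norm (w + of_real (r n) * circ x)"] le pos by simp
        finally have "\<bar>k w\<bar> * norm (herglotz w (of_real (r n) * circ x)) \<le> \<bar>k w\<bar> * (4 / norm (w + circ x))"
          by (rule mult_left_mono) simp
        then show ?case by (simp add: norm_mult field_simps)
      qed
    qed measurable
    also have "(\<integral>w. of_real (k w) * herglotz w (circ x) \<partial>\<rho>) = (\<integral>w. \<i> * of_real (k w * Im (herglotz w (circ x))) \<partial>\<rho>)"
    proof (rule integral_cong_AE)
      show "AE w in \<rho>. of_real (k w) * herglotz w (circ x) = \<i> * of_real (k w * Im (herglotz w (circ x)))"
        using on_circle
        by eventually_elim (subst herglotz_boundary, auto)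
    qed measurable
    also have "\<dots> = \<i> * of_real (boundary_fun k x)"
      using integrable_boundary[OF km elim(1)] by (simp add: boundary_fun_def del: of_real_mult)
    finally have "(\<lambda>n. exp (- of_real s * herglotz_int k (of_real (r n) * circ x))) \<longlonglongrightarrow> exp (- of_real s * (\<i> * of_real (boundary_fun k x)))"
      by (intro tendsto_intros)
    then show ?case by (simp add: E_def mult_ac)
  qed
  have lm: "(\<lambda>x. exp (- \<i> * of_real (s * boundary_fun k x))) \<in> borel_measurable unit_interval"
    by measurable
  have "(\<lambda>n. \<integral>x. E (of_real (r n) * circ x) \<partial>unit_interval) \<longlonglongrightarrow> (\<integral>x. exp (- \<i> * of_real (s * boundary_fun k x)) \<partial>unit_interval)"
  proof (rule integral_dominated_convergence[OF lm Emeas, where w = "\<lambda>_. 1"])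
    show "AE x in unit_interval. norm (E (of_real (r n) * circ x)) \<le> 1" for n
      using r[of n] by (intro AE_I2 bound) (simp add: norm_mult)
  qed (use lim in auto)
  then have "(\<integral>x. exp (- \<i> * of_real (s * boundary_fun k x)) \<partial>unit_interval) = exp (- of_real (s * (\<integral>w. k w \<partial>\<rho>)))"
    unfolding mv by (simp only: LIMSEQ_const_iff)
  then have "Re (\<integral>x. exp (- \<i> * of_real (s * boundary_fun k x)) \<partial>unit_interval) = exp (- s * (\<integral>w. k w \<partial>\<rho>))"
    by (simp add: Re_exp)
  also have "Re (\<integral>x. exp (- \<i> * of_real (s * boundary_fun k x)) \<partial>unit_interval) =
     (\<integral>x. Re (exp (- \<i> * of_real (s * boundary_fun k x))) \<partial>unit_interval)"
    by (rule integral_Re[symmetric], rule unit_interval.integrable_const_bound[where B = 1])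
       (use lm in \<open>auto simp: norm_exp_eq_Re\<close>)
  also have "\<dots> = (\<integral>x. cos (s * boundary_fun k x) \<partial>unit_interval)"
    by (simp add: Re_exp)
  finally show ?thesis .
qed

end

section \<open>A Cauchy boundary law forces positivity\<close>

lemma one_minus_cos: "1 - cos y = 2 * (sin (y / 2))\<^sup>2" for y :: real
  using cos_double_sin[of "y / 2"] by simp

lemma abs_sin_half_le: "\<bar>sin (y / 2)\<bar> \<le> \<bar>y\<bar> / 2" for y :: real
  using abs_sin_x_le_abs_x[of "y / 2"] by simp

lemma abs_sin_half_add: "\<bar>sin ((a + b) / 2)\<bar> \<le> \<bar>sin (a / 2)\<bar> + \<bar>sin (b / 2)\<bar>" for a b :: real
proof -
  have "\<bar>sin ((a + b) / 2)\<bar> \<le> \<bar>sin (a / 2)\<bar> * \<bar>cos (b / 2)\<bar> + \<bar>cos (a / 2)\<bar> * \<bar>sin (b / 2)\<bar>"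
    unfolding add_divide_distrib sin_add by (metis abs_mult abs_triangle_ineq)
  also have "\<dots> \<le> \<bar>sin (a / 2)\<bar> * 1 + 1 * \<bar>sin (b / 2)\<bar>"
    by (intro add_mono mult_mono) auto
  finally show ?thesis by simp
qed

text \<open>The left hand side equals \<open>(1 - cos a) (1 - cos b) + sin a sin b\<close>, the defect of additivity of
  \<open>1 - cos\<close>.\<close>

lemma cross_term:
  fixes a b :: real
  shows "(1 - cos a) + (1 - cos b) - (1 - cos (a - b)) \<le> 8 * (\<bar>sin (a / 2)\<bar> * \<bar>sin (b / 2)\<bar>)"
proof -
  let ?x = "\<bar>sin (a / 2)\<bar>" and ?y = "\<bar>sin (b / 2)\<bar>"
  have dbl: "\<bar>sin c\<bar> \<le> 2 * \<bar>sin (c / 2)\<bar>" for c :: real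
  proof -
    have "sin c = 2 * sin (c / 2) * cos (c / 2)" using sin_double[of "c / 2"] by simp
    moreover have "2 * \<bar>sin (c / 2)\<bar> * \<bar>cos (c / 2)\<bar> \<le> 2 * \<bar>sin (c / 2)\<bar> * 1"
      by (intro mult_left_mono) auto
    ultimately show ?thesis by (simp add: abs_mult)
  qed
  have "(1 - cos a) + (1 - cos b) - (1 - cos (a - b)) = (1 - cos a) * (1 - cos b) + sin a * sin b"
    by (simp add: cos_diff algebra_simps)
  also have "(1 - cos a) * (1 - cos b) = 4 * (?x * ?y) * (?x * ?y)"
    unfolding one_minus_cos by (simp add: power2_eq_square algebra_simps abs_mult_self_eq flip: abs_mult)
  also have "\<dots> \<le> 4 * (?x * ?y) * 1"
    by (intro mult_left_mono mult_le_one) auto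
  also have "sin a * sin b \<le> (2 * ?x) * (2 * ?y)"
    using mult_mono[OF dbl[of a] dbl[of b]] abs_ge_self[of "sin a * sin b"] by (simp add: abs_mult)
  finally show ?thesis by simp
qed

lemma measure_unit_interval [simp]: "measure unit_interval {0..1} = 1"
  using unit_interval.prob_space by (simp add: space_restrict_space)

context circle_measure
begin

lemma sin_half_sq_integral:
  assumes k: "admissible k" "\<And>w. 0 \<le> k w" and s: "0 \<le> s"
  shows "(\<integral>x. (sin (s * boundary_fun k x / 2))\<^sup>2 \<partial>unit_interval) \<le> s * (\<integral>w. k w \<partial>\<rho>) / 2"
proof -
  note [measurable] = admissibleD(1)[OF k(1)]
  have "(\<integral>x. 2 * (sin (s * boundary_fun k x / 2))\<^sup>2 \<partial>unit_interval) =
      (\<integral>x. 1 - cos (s * boundary_fun k x) \<partial>unit_interval)"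
    by (simp only: one_minus_cos)
  also have "\<dots> = 1 - exp (- s * (\<integral>w. k w \<partial>\<rho>))"
    by (subst Bochner_Integration.integral_diff)
       (auto simp: boundary_law[OF k s]
         intro!: unit_interval.integrable_const_bound[where B = 1])
  also have "\<dots> \<le> s * (\<integral>w. k w \<partial>\<rho>)"
    using exp_ge_add_one_self[of "- s * (\<integral>w. k w \<partial>\<rho>)"] by simp
  finally show ?thesis by simp
qed

text \<open>Inner regularity of the finite measure with density \<open>k\<close>.\<close>

lemma compact_approximation:
  fixes k :: "complex \<Rightarrow> real"
  assumes k: "k \<in> borel_measurable borel" "integrable \<rho> k" "\<And>w. 0 \<le> k w" and e: "0 < e"
  obtains K where "compact K" "K \<subseteq> {w. 0 < k w}" "(\<integral>w. k w * indicator (- K) w \<partial>\<rho>) \<le> e"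
proof -
  note [measurable] = k(1)
  define \<tau> where "\<tau> = density \<rho> (\<lambda>w. ennreal (k w))"
  have st [simp]: "sets \<tau> = sets borel" by (simp add: \<tau>_def)
  have tau: "emeasure \<tau> A = ennreal (\<integral>w. k w * indicator A w \<partial>\<rho>)" if [measurable]: "A \<in> sets borel" for A
  proof -
    have "emeasure \<tau> A = (\<integral>\<^sup>+ w. ennreal (k w * indicator A w) \<partial>\<rho>)"
      unfolding \<tau>_def using k(3) by (subst emeasure_density) (auto intro!: nn_integral_cong split: split_indicator)
    also have "\<dots> = ennreal (\<integral>w. k w * indicator A w \<partial>\<rho>)"
      using k by (intro nn_integral_eq_integral integrable_mult_indicator[where f = k, simplified mult.commute, simplified]) 
         (auto intro!: integrable_real_mult_indicator)
    finally show ?thesis .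
  qed
  let ?B = "{w. 0 < k w}"
  have [measurable]: "?B \<in> sets borel" by measurable
  have fin: "emeasure \<tau> A \<noteq> \<infinity>" if "A \<in> sets borel" for A using tau[OF that] by simp
  have "emeasure \<tau> ?B = (SUP K\<in>{K. K \<subseteq> ?B \<and> compact K}. emeasure \<tau> K)"
    by (rule inner_regular) (use fin[of UNIV] sets_eq_imp_space_eq[OF st] in auto)
  then have "\<exists>K. K \<subseteq> ?B \<and> compact K \<and> emeasure \<tau> ?B \<le> emeasure \<tau> K + ennreal e"
  proof (cases "emeasure \<tau> ?B = 0")
    case True
    then show ?thesis by (intro exI[of _ "{}"]) auto
  next
    case False
    then have "emeasure \<tau> ?B - ennreal e < emeasure \<tau> ?B"
      using fin[of ?B] e by (intro ennreal_between) (auto simp: zero_less_iff_neq_zero less_top)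
    then have "emeasure \<tau> ?B - ennreal e < (SUP K\<in>{K. K \<subseteq> ?B \<and> compact K}. emeasure \<tau> K)"
      using \<open>emeasure \<tau> ?B = _\<close> by simp
    then obtain K where "K \<subseteq> ?B" "compact K" "emeasure \<tau> ?B - ennreal e < emeasure \<tau> K"
      by (auto simp: less_SUP_iff)
    moreover from less_imp_le[OF this(3)] have "emeasure \<tau> ?B \<le> emeasure \<tau> K + ennreal e"
      by (simp add: ennreal_minus_le_iff add.commute)
    ultimately show ?thesis by blast
  qed
  then obtain K where K: "K \<subseteq> ?B" "compact K" "emeasure \<tau> ?B \<le> emeasure \<tau> K + ennreal e" by blast
  have [measurable]: "K \<in> sets borel" using K(2) by (simp add: borel_compact)
  have nn: "0 \<le> (\<integral>w. k w * indicator A w \<partial>\<rho>)" for A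
    using k(3) by (intro integral_nonneg_AE) auto
  have ind: "integrable \<rho> (\<lambda>w. k w * indicator A w)" if [measurable]: "A \<in> sets borel" for A
    using k by (intro integrable_real_mult_indicator) auto
  have "(\<integral>w. k w * indicator ?B w \<partial>\<rho>) \<le> (\<integral>w. k w * indicator K w \<partial>\<rho>) + e"
    using K(3) nn e by (simp add: tau ennreal_plus[symmetric] del: ennreal_plus)
  moreover have "(\<integral>w. k w * indicator ?B w \<partial>\<rho>) - (\<integral>w. k w * indicator K w \<partial>\<rho>) = (\<integral>w. k w * indicator (- K) w \<partial>\<rho>)"
  proof (subst Bochner_Integration.integral_diff[symmetric])
    have "k w * indicator ?B w - k w * indicator K w = k w * indicator (- K) w" for w
      using K(1) k(3)[of w] by (auto split: split_indicator)
    then show "(\<integral>w. k w * indicator ?B w - k w * indicator K w \<partial>\<rho>) = (\<integral>w. k w * indicator (- K) w \<partial>\<rho>)"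
      by simp
  qed (auto intro!: ind)
  ultimately show ?thesis using that[of K] K by auto
qed

lemma boundary_fun_bound:
  assumes k: "k \<in> borel_measurable borel" "integrable \<rho> k" and d: "0 < d"
    and sep: "\<And>w. k w \<noteq> 0 \<Longrightarrow> d \<le> norm (w + circ x)"
  shows "\<bar>boundary_fun k x\<bar> \<le> 2 / d * (\<integral>w. \<bar>k w\<bar> \<partial>\<rho>)"
proof -
  note [measurable] = k(1)
  let ?f = "\<lambda>w. k w * Im (herglotz w (circ x))"
  have le: "AE w in \<rho>. \<bar>?f w\<bar> \<le> 2 / d * \<bar>k w\<bar>"
    using on_circle
  proof eventually_elim
    case (elim w)
    show ?case
    proof (cases "k w = 0")
      case False
      have "\<bar>Im (herglotz w (circ x))\<bar> \<le> 2 / norm (w + circ x)"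
        using norm_herglotz_le[OF elim, of "circ x"] abs_Im_le_cmod[of "herglotz w (circ x)"] by simp
      also have "\<dots> \<le> 2 / d" using sep[OF False] d by (intro frac_le) auto
      finally have "\<bar>k w\<bar> * \<bar>Im (herglotz w (circ x))\<bar> \<le> \<bar>k w\<bar> * (2 / d)"
        by (rule mult_left_mono) simp
      then show ?thesis by (simp add: abs_mult mult.commute)
    qed simp
  qed
  have int: "integrable \<rho> (\<lambda>w. 2 / d * \<bar>k w\<bar>)" using k by simp
  have "integrable \<rho> ?f"
    by (rule Bochner_Integration.integrable_bound[OF int]) (use le d in auto)
  then have "(\<integral>w. \<bar>?f w\<bar> \<partial>\<rho>) \<le> (\<integral>w. 2 / d * \<bar>k w\<bar> \<partial>\<rho>)"
    by (intro integral_mono_AE int le integrable_abs)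
  moreover have "\<bar>boundary_fun k x\<bar> \<le> (\<integral>w. \<bar>?f w\<bar> \<partial>\<rho>)"
    unfolding boundary_fun_def by (rule integral_abs_bound)
  ultimately show ?thesis by simp
qed

text \<open>Let \<open>mp\<close> and \<open>mm\<close> be the integrals of the positive and negative part of \<open>k\<close>. The plan is to prove
  \<open>2 mm \<le> 8 cr(s) / s + O(s)\<close>, where the cross term \<open>cr(s)\<close> is \<open>o(s)\<close>. Only the values
  \<open>s = 1 / (n + 1)\<close> are assumed, because in the application the law is known almost surely for each
  \<open>s\<close> and only countably many null sets can be discarded.\<close>

theorem weight_nonneg:
  assumes k: "admissible k"
    and law: "\<And>n. (\<integral>x. cos (1 / real (Suc n) * boundary_fun k x) \<partial>unit_interval) =
                exp (- (1 / real (Suc n)) * (\<integral>w. k w \<partial>\<rho>))"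
  shows "AE w in \<rho>. 0 \<le> k w"
proof -
  note [measurable] = admissibleD(1)[OF k]
  define kp where "kp w = max (k w) 0" for w
  define km where "km w = max (- k w) 0" for w
  have [measurable]: "kp \<in> borel_measurable borel" "km \<in> borel_measurable borel"
    unfolding kp_def km_def by measurable
  have nn: "0 \<le> kp w" "0 \<le> km w" for w by (auto simp: kp_def km_def)
  have keq: "k = (\<lambda>w. kp w - km w)" by (auto simp: kp_def km_def fun_eq_iff)
  have adm: "admissible kp" "admissible km"
    by (auto intro!: admissible_mono[OF k] simp: kp_def km_def)
  note int = admissibleD(2)[OF adm(1)] admissibleD(2)[OF adm(2)]
  define mp where "mp = (\<integral>w. kp w \<partial>\<rho>)"
  define mm where "mm = (\<integral>w. km w \<partial>\<rho>)"
  have m0: "0 \<le> mp" "0 \<le> mm"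
    unfolding mp_def mm_def using nn by (auto intro!: integral_nonneg_AE)
  have mk: "(\<integral>w. k w \<partial>\<rho>) = mp - mm" unfolding mp_def mm_def keq using int by simp
  have bi: "integrable unit_interval f" if [measurable]: "f \<in> borel_measurable borel" and "\<And>x. \<bar>f x\<bar> \<le> 4" for f :: "real \<Rightarrow> real"
    by (rule unit_interval.integrable_const_bound[where B = 4]) (use that in auto)
  define cr where "cr s = (\<integral>x. \<bar>sin (s * boundary_fun kp x / 2)\<bar> * \<bar>sin (s * boundary_fun km x / 2)\<bar> \<partial>unit_interval)" for s
  have prod4: "a * b \<le> 4" if "a \<le> 1" "b \<le> 1" "0 \<le> a" "0 \<le> b" for a b :: real
    using mult_le_one[of a b] that by linarith
  \<comment> \<open>The three laws turn the additivity defect into \<open>2 mm s\<close> up to second order in \<open>s\<close>.\<close>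
  have lower: "2 * mm * s - s\<^sup>2 * (mp\<^sup>2 + mm\<^sup>2) / 2 \<le> 8 * cr s" if sn: "s = 1 / real (Suc n)" for s n
  proof -
    have s: "0 \<le> s" using sn by simp
    have law': "(\<integral>x. cos (s * boundary_fun k x) \<partial>unit_interval) = exp (- s * (mp - mm))"
      unfolding sn mk[symmetric] by (rule law)
    have "(1 - exp (- s * mp)) + (1 - exp (- s * mm)) - (1 - exp (- s * (mp - mm))) =
      (\<integral>x. 1 - cos (s * boundary_fun kp x) \<partial>unit_interval) + (\<integral>x. 1 - cos (s * boundary_fun km x) \<partial>unit_interval)
       - (\<integral>x. 1 - cos (s * boundary_fun k x) \<partial>unit_interval)"
      using boundary_law[OF adm(1) nn(1) s] boundary_law[OF adm(2) nn(2) s] law'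
      by (subst (1 2 3) Bochner_Integration.integral_diff)
         (auto simp: mp_def[symmetric] mm_def[symmetric] intro!: bi order_trans[OF abs_cos_le_one])
    also have "\<dots> = (\<integral>x. (1 - cos (s * boundary_fun kp x)) + (1 - cos (s * boundary_fun km x)) - (1 - cos (s * boundary_fun k x)) \<partial>unit_interval)"
      by (subst Bochner_Integration.integral_diff, (intro bi Bochner_Integration.integrable_add Bochner_Integration.integrable_diff; (auto intro!: order_trans[OF abs_cos_le_one] ; fail))+,
          subst Bochner_Integration.integral_add)
         (auto intro!: bi Bochner_Integration.integrable_diff order_trans[OF abs_cos_le_one])
    also have "\<dots> \<le> (\<integral>x. 8 * (\<bar>sin (s * boundary_fun kp x / 2)\<bar> * \<bar>sin (s * boundary_fun km x / 2)\<bar>) \<partial>unit_interval)"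
    proof (rule integral_mono_AE)
      show "AE x in unit_interval. (1 - cos (s * boundary_fun kp x)) + (1 - cos (s * boundary_fun km x)) - (1 - cos (s * boundary_fun k x))
          \<le> 8 * (\<bar>sin (s * boundary_fun kp x / 2)\<bar> * \<bar>sin (s * boundary_fun km x / 2)\<bar>)"
        using boundary_fun_diff[OF adm]
      proof eventually_elim
        case (elim x)
        then have "boundary_fun k x = boundary_fun kp x - boundary_fun km x" by (simp add: keq)
        then show ?case using cross_term[of "s * boundary_fun kp x" "s * boundary_fun km x"] by (simp add: right_diff_distrib)
      qed
    qed (auto intro!: bi Bochner_Integration.integrable_diff Bochner_Integration.integrable_add order_trans[OF abs_cos_le_one] prod4 simp: abs_mult)
    also have "\<dots> = 8 * cr s" by (simp add: cr_def)
    finally have 1: "(1 - exp (- s * mp)) + (1 - exp (- s * mm)) - (1 - exp (- s * (mp - mm))) \<le> 8 * cr s" .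
    have 2: "1 - exp (- s * m) \<ge> s * m - (s * m)\<^sup>2 / 2" if "0 \<le> m" for m
    proof -
      have "exp (- (s * m)) \<le> 1 - s * m + (s * m)\<^sup>2 / 2" if "0 \<le> s * m"
      proof -
        define y where "y = s * m"
        have y: "0 \<le> y" using that y_def by simp
        define f where "f y = 1 - y + y\<^sup>2 / 2 - exp (- y)" for y :: real
        have "f 0 \<le> f y"
        proof (rule DERIV_nonneg_imp_nondecreasing[OF y])
          fix x :: real assume "0 \<le> x" "x \<le> y"
          have "(f has_real_derivative (- 1 + x + exp (- x))) (at x)"
            unfolding f_def by (auto intro!: derivative_eq_intros)
          moreover have "0 \<le> - 1 + x + exp (- x)" using exp_ge_add_one_self[of "- x"] by simp
          ultimately show "\<exists>z. (f has_real_derivative z) (at x) \<and> 0 \<le> z" by blast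
        qed
        then show ?thesis by (simp add: f_def y_def)
      qed
      then show ?thesis using s that by simp
    qed
    have 3: "1 - exp (- s * (mp - mm)) \<le> s * (mp - mm)"
      using exp_ge_add_one_self[of "- s * (mp - mm)"] by simp
    show ?thesis using 1 2[OF m0(1)] 2[OF m0(2)] 3
      by (simp add: algebra_simps power_mult_distrib add_divide_distrib)
  qed
  \<comment> \<open>The first summand comes from the parts of mass at most \<open>\<delta>\<^sup>2\<close> outside the compact sets, the second
    from the two compact parts.\<close>
  have upper: "\<exists>L\<ge>0. \<forall>n. let s = 1 / real (Suc n) in cr s \<le> s * (\<delta> * (2 + mp + mm) / 4) + s * sqrt s * L"
    if \<delta>: "0 < \<delta>" for \<delta>
  proof -
    obtain Kp where Kp: "compact Kp" "Kp \<subseteq> {w. 0 < kp w}" "(\<integral>w. kp w * indicator (- Kp) w \<partial>\<rho>) \<le> \<delta>\<^sup>2"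
      using compact_approximation[of kp "\<delta>\<^sup>2"] int nn \<delta> by auto
    obtain Km where Km: "compact Km" "Km \<subseteq> {w. 0 < km w}" "(\<integral>w. km w * indicator (- Km) w \<partial>\<rho>) \<le> \<delta>\<^sup>2"
      using compact_approximation[of km "\<delta>\<^sup>2"] int nn \<delta> by auto
    have [measurable]: "Kp \<in> sets borel" "Km \<in> sets borel" using Kp(1) Km(1) by (simp_all add: borel_compact)
    have "\<not> (0 < kp w \<and> 0 < km w)" for w by (auto simp: kp_def km_def)
    then have "Kp \<inter> Km = {}" using Kp(2) Km(2) by blast
    then obtain d where d: "0 < d" "\<And>x y. x \<in> Kp \<Longrightarrow> y \<in> Km \<Longrightarrow> d \<le> dist x y"
      using separate_compact_closed[OF Kp(1) compact_imp_closed[OF Km(1)]] by blast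
    define p1 where "p1 w = kp w * indicator Kp w" for w
    define p2 where "p2 w = kp w * indicator (- Kp) w" for w
    define q1 where "q1 w = km w * indicator Km w" for w
    define q2 where "q2 w = km w * indicator (- Km) w" for w
    have [measurable]: "p1 \<in> borel_measurable borel" "p2 \<in> borel_measurable borel"
      "q1 \<in> borel_measurable borel" "q2 \<in> borel_measurable borel"
      unfolding p1_def p2_def q1_def q2_def by measurable
    have a: "admissible p1" "admissible p2" "admissible q1" "admissible q2"
      by (rule admissible_mono[OF adm(1)]; simp add: p1_def p2_def abs_mult split: split_indicator)+
         (rule admissible_mono[OF adm(2)]; simp add: q1_def q2_def abs_mult split: split_indicator)+
    have n: "0 \<le> p1 w" "0 \<le> p2 w" "0 \<le> q1 w" "0 \<le> q2 w" for w
      using nn[of w] by (auto simp: p1_def p2_def q1_def q2_def)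
    have le1: "(\<integral>w. p1 w \<partial>\<rho>) \<le> mp"
      unfolding mp_def by (rule integral_mono[OF admissibleD(2)[OF a(1)] int(1)])
        (use nn in \<open>auto simp: p1_def split: split_indicator\<close>)
    have le2: "(\<integral>w. q1 w \<partial>\<rho>) \<le> mm"
      unfolding mm_def by (rule integral_mono[OF admissibleD(2)[OF a(3)] int(2)])
        (use nn in \<open>auto simp: q1_def split: split_indicator\<close>)
    note le = le1 le2
    have small: "(\<integral>w. p2 w \<partial>\<rho>) \<le> \<delta>\<^sup>2" "(\<integral>w. q2 w \<partial>\<rho>) \<le> \<delta>\<^sup>2"
      using Kp(3) Km(3) by (simp_all add: p2_def q2_def)
    have split: "kp = (\<lambda>w. p1 w + p2 w)" "km = (\<lambda>w. q1 w + q2 w)"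
      by (auto simp: fun_eq_iff p1_def p2_def q1_def q2_def split: split_indicator)
    define L where "L = 4 / d * (mp + mm)"
    have L0: "0 \<le> L" using d m0 by (simp add: L_def)
    \<comment> \<open>A point \<open>- circ x\<close> cannot be close to both compact sets.\<close>
    have near: "\<bar>boundary_fun p1 x\<bar> \<le> L \<or> \<bar>boundary_fun q1 x\<bar> \<le> L" for x
    proof (cases "\<exists>w\<in>Kp. dist w (- circ x) < d / 2")
      case True
      then obtain w where w: "w \<in> Kp" "dist w (- circ x) < d / 2" by blast
      have "\<bar>boundary_fun q1 x\<bar> \<le> 2 / (d / 2) * (\<integral>w. \<bar>q1 w\<bar> \<partial>\<rho>)"
      proof (rule boundary_fun_bound)
        fix v assume "q1 v \<noteq> 0"
        then have "v \<in> Km" by (auto simp: q1_def split: split_indicator_asm)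
        then have "d \<le> dist w v" using d(2) w(1) by blast
        then have "d / 2 \<le> dist v (- circ x)"
          using w(2) dist_triangle[of w v "- circ x"] dist_commute[of v "- circ x"] by linarith
        then show "d / 2 \<le> norm (v + circ x)" by (simp add: dist_norm)
      qed (use a d in \<open>auto simp: admissibleD\<close>)
      also have "\<dots> \<le> 2 / (d / 2) * (mp + mm)"
        using le n d m0 by (intro mult_left_mono) auto
      finally show ?thesis by (simp add: L_def)
    next
      case False
      have "\<bar>boundary_fun p1 x\<bar> \<le> 2 / (d / 2) * (\<integral>w. \<bar>p1 w\<bar> \<partial>\<rho>)"
      proof (rule boundary_fun_bound)
        fix v assume "p1 v \<noteq> 0"
        then have "v \<in> Kp" by (auto simp: p1_def split: split_indicator_asm)
        then have "d / 2 \<le> dist v (- circ x)" using False by force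
        then show "d / 2 \<le> norm (v + circ x)" by (simp add: dist_norm)
      qed (use a d in \<open>auto simp: admissibleD\<close>)
      also have "\<dots> \<le> 2 / (d / 2) * (mp + mm)"
        using le n d m0 by (intro mult_left_mono) auto
      finally show ?thesis by (simp add: L_def)
    qed
    show ?thesis
    proof (intro exI[of _ "L / 4 * (2 + (mp + mm) / 2)"] conjI allI)
      show "0 \<le> L / 4 * (2 + (mp + mm) / 2)" using L0 m0 by simp
      fix n
      define s where "s = 1 / real (Suc n)"
      have s: "0 < s" by (simp add: s_def)
      define h where "h f x = \<bar>sin (s * boundary_fun f x / 2)\<bar>" for f x
      have hm [measurable]: "h f \<in> borel_measurable borel" if [measurable]: "f \<in> borel_measurable borel" for f
        unfolding h_def by measurable
      have h01: "0 \<le> h f x" "h f x \<le> 1" for f x by (auto simp: h_def)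
      have h2: "(\<integral>x. (h f x)\<^sup>2 \<partial>unit_interval) \<le> s * (\<integral>w. f w \<partial>\<rho>) / 2" if "admissible f" "\<And>w. 0 \<le> f w" for f
        using sin_half_sq_integral[OF that less_imp_le[OF s]] by (simp add: h_def)
      have amgm: "a * b \<le> (c * a\<^sup>2 + b\<^sup>2 / c) / 2" if "0 < c" for a b c :: real
      proof -
        have "0 \<le> (c * a - b)\<^sup>2 / c" using that by simp
        also have "\<dots> = c * a\<^sup>2 + b\<^sup>2 / c - 2 * (a * b)"
          using that by (simp add: power2_eq_square field_simps)
        finally show ?thesis by simp
      qed
      \<comment> \<open>Cauchy-Schwarz in the form of weighted arithmetic-geometric means: the weight \<open>sqrt s\<close> makes
        the compact part of order \<open>s powr (3 / 2)\<close>, and the weight \<open>\<delta>\<close> balances masses of order \<open>1\<close> and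
        \<open>\<delta>\<^sup>2\<close>.\<close>
      have pt: "AE x in unit_interval. h kp x * h km x \<le>
         s * L / 2 * (sqrt s + ((h p1 x)\<^sup>2 + (h q1 x)\<^sup>2) / (2 * sqrt s))
         + (\<delta> * (h km x)\<^sup>2 + (h p2 x)\<^sup>2 / \<delta>) / 2 + (\<delta> * (h p1 x)\<^sup>2 + (h q2 x)\<^sup>2 / \<delta>) / 2"
        using boundary_fun_add[OF a(1,2)] boundary_fun_add[OF a(3,4)]
      proof eventually_elim
        case (elim x)
        have hp: "h kp x \<le> h p1 x + h p2 x"
          using abs_sin_half_add[of "s * boundary_fun p1 x" "s * boundary_fun p2 x"] elim(1)
          by (simp add: h_def split(1)[symmetric] distrib_left)
        have hq: "h km x \<le> h q1 x + h q2 x"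
          using abs_sin_half_add[of "s * boundary_fun q1 x" "s * boundary_fun q2 x"] elim(2)
          by (simp add: h_def split(2)[symmetric] distrib_left)
        have "h kp x * h km x \<le> (h p1 x + h p2 x) * h km x" by (rule mult_right_mono[OF hp h01(1)])
        also have "\<dots> \<le> h p1 x * (h q1 x + h q2 x) + h km x * h p2 x"
          using mult_left_mono[OF hq h01(1)[of p1 x]] by (simp add: algebra_simps)
        finally have e: "h kp x * h km x \<le> h p1 x * h q1 x + h p1 x * h q2 x + h km x * h p2 x"
          by (simp add: algebra_simps)
        have hL: "h f x \<le> s * L / 2" if "\<bar>boundary_fun f x\<bar> \<le> L" for f
        proof -
          have "h f x \<le> \<bar>s * boundary_fun f x\<bar> / 2" unfolding h_def by (rule abs_sin_half_le)
          also have "\<dots> \<le> s * L / 2" using s that by (simp add: abs_mult)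
          finally show ?thesis .
        qed
        have "h p1 x * h q1 x \<le> s * L / 2 * (h p1 x + h q1 x)"
          using near[of x]
        proof
          assume "\<bar>boundary_fun p1 x\<bar> \<le> L"
          have "h p1 x * h q1 x \<le> (s * L / 2) * h q1 x" by (rule mult_right_mono[OF hL h01(1)]) fact
          also have "\<dots> \<le> s * L / 2 * (h p1 x + h q1 x)" using s L0 h01(1) by (intro mult_left_mono) auto
          finally show ?thesis .
        next
          assume "\<bar>boundary_fun q1 x\<bar> \<le> L"
          have "h p1 x * h q1 x \<le> h p1 x * (s * L / 2)" by (rule mult_left_mono[OF hL h01(1)]) fact
          also have "\<dots> = (s * L / 2) * h p1 x" by simp
          also have "\<dots> \<le> s * L / 2 * (h p1 x + h q1 x)" using s L0 h01(1) by (intro mult_left_mono) auto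
          finally show ?thesis .
        qed
        also have "\<dots> \<le> s * L / 2 * (sqrt s + ((h p1 x)\<^sup>2 + (h q1 x)\<^sup>2) / (2 * sqrt s))"
        proof (rule mult_left_mono)
          show "h p1 x + h q1 x \<le> sqrt s + ((h p1 x)\<^sup>2 + (h q1 x)\<^sup>2) / (2 * sqrt s)"
            using amgm[of "sqrt s" 1 "h p1 x"] amgm[of "sqrt s" 1 "h q1 x"] s
            by (simp add: add_divide_distrib)
          show "0 \<le> s * L / 2" using s L0 by simp
        qed
        finally show ?case
          using e amgm[OF \<delta>, of "h p1 x" "h q2 x"] amgm[OF \<delta>, of "h km x" "h p2 x"] by linarith
      qed
      have hi: "integrable unit_interval (\<lambda>x. (h f x)\<^sup>2)" if [measurable]: "f \<in> borel_measurable borel" for f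
        by (rule bi) (use h01[of f] power_le_one[of "h f _" 2] in \<open>auto intro: order_trans[OF power_le_one]\<close>)
      have "cr s = (\<integral>x. h kp x * h km x \<partial>unit_interval)" by (simp add: cr_def h_def)
      also have "\<dots> \<le> (\<integral>x. s * L / 2 * (sqrt s + ((h p1 x)\<^sup>2 + (h q1 x)\<^sup>2) / (2 * sqrt s))
         + (\<delta> * (h km x)\<^sup>2 + (h p2 x)\<^sup>2 / \<delta>) / 2 + (\<delta> * (h p1 x)\<^sup>2 + (h q2 x)\<^sup>2 / \<delta>) / 2 \<partial>unit_interval)"
      proof (rule integral_mono_AE[OF _ _ pt])
        show "integrable unit_interval (\<lambda>x. h kp x * h km x)"
          by (rule bi) (auto intro!: prod4 simp: abs_mult h01 abs_of_nonneg)
      qed (simp add: hi)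
      also have "\<dots> = s * L / 2 * (sqrt s + ((\<integral>x. (h p1 x)\<^sup>2 \<partial>unit_interval) + (\<integral>x. (h q1 x)\<^sup>2 \<partial>unit_interval)) / (2 * sqrt s))
         + (\<delta> * (\<integral>x. (h km x)\<^sup>2 \<partial>unit_interval) + (\<integral>x. (h p2 x)\<^sup>2 \<partial>unit_interval) / \<delta>) / 2
         + (\<delta> * (\<integral>x. (h p1 x)\<^sup>2 \<partial>unit_interval) + (\<integral>x. (h q2 x)\<^sup>2 \<partial>unit_interval) / \<delta>) / 2"
        by (simp add: hi)
      also have "\<dots> \<le> s * L / 2 * (sqrt s + (s * mp / 2 + s * mm / 2) / (2 * sqrt s))
         + (\<delta> * (s * mm / 2) + (s * \<delta>\<^sup>2 / 2) / \<delta>) / 2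
         + (\<delta> * (s * mp / 2) + (s * \<delta>\<^sup>2 / 2) / \<delta>) / 2"
      proof -
        have b: "(\<integral>x. (h f x)\<^sup>2 \<partial>unit_interval) \<le> s * c / 2" if "admissible f" "\<And>w. 0 \<le> f w" "(\<integral>w. f w \<partial>\<rho>) \<le> c" for f c
          using h2[OF that(1,2)] mult_left_mono[OF that(3), of s] s by linarith
        show ?thesis
          using s L0 \<delta>
          by (intro add_mono mult_left_mono divide_right_mono b a n adm nn le small) (auto simp: mm_def)
      qed
      also have "\<dots> = s * (\<delta> * (2 + mp + mm) / 4) + s * sqrt s * (L / 4 * (2 + (mp + mm) / 2))"
      proof -
        have "s / sqrt s = sqrt s" using s by (simp add: real_div_sqrt)
        moreover have "(s * mp / 2 + s * mm / 2) / (2 * sqrt s) = (s / sqrt s) * ((mp + mm) / 4)"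
          by (simp add: add_divide_distrib distrib_left)
        ultimately have 1: "(s * mp / 2 + s * mm / 2) / (2 * sqrt s) = sqrt s * ((mp + mm) / 4)"
          by simp
        have 2: "(s * \<delta>\<^sup>2 / 2) / \<delta> = s * \<delta> / 2" using \<delta> by (simp add: power2_eq_square)
        show ?thesis unfolding 1 2 by (simp add: algebra_simps add_divide_distrib)
      qed
      finally show "let s = 1 / real (Suc n) in cr s \<le> s * (\<delta> * (2 + mp + mm) / 4) + s * sqrt s * (L / 4 * (2 + (mp + mm) / 2))"
        by (simp add: s_def Let_def)
    qed
  qed
  have key: "2 * mm \<le> \<delta> * (2 * (2 + mp + mm))" if \<delta>: "0 < \<delta>" for \<delta>
  proof -
    obtain L where L: "\<And>n. let s = 1 / real (Suc n) in cr s \<le> s * (\<delta> * (2 + mp + mm) / 4) + s * sqrt s * L"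
      using upper[OF \<delta>] by blast
    let ?s = "\<lambda>n. 1 / real (Suc n)"
    have "2 * mm \<le> \<delta> * (2 * (2 + mp + mm)) + 8 * sqrt (?s n) * L + ?s n * (mp\<^sup>2 + mm\<^sup>2) / 2" for n
    proof -
      define s where "s = ?s n"
      have s: "0 < s" by (simp add: s_def)
      have "2 * mm * s - s\<^sup>2 * (mp\<^sup>2 + mm\<^sup>2) / 2 \<le> 8 * (s * (\<delta> * (2 + mp + mm) / 4) + s * sqrt s * L)"
        by (rule order_trans[OF lower[OF s_def] mult_left_mono[OF L[of n, folded s_def, unfolded Let_def]]]) simp
      then have "s * (2 * mm) \<le> s * (\<delta> * (2 * (2 + mp + mm)) + 8 * sqrt s * L + s * (mp\<^sup>2 + mm\<^sup>2) / 2)"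
        by (simp add: algebra_simps power2_eq_square[of s] add_divide_distrib)
      then show ?thesis unfolding mult_le_cancel_left_pos[OF s] unfolding s_def .
    qed
    moreover have "(\<lambda>n. \<delta> * (2 * (2 + mp + mm)) + 8 * sqrt (?s n) * L + ?s n * (mp\<^sup>2 + mm\<^sup>2) / 2)
       \<longlonglongrightarrow> \<delta> * (2 * (2 + mp + mm)) + 8 * sqrt 0 * L + 0 * (mp\<^sup>2 + mm\<^sup>2) / 2"
      by (intro tendsto_intros LIMSEQ_Suc[OF lim_1_over_n]) simp_all
    ultimately show ?thesis using LIMSEQ_le_const[of _ _ "2 * mm"] by fastforce
  qed
  have "mm \<le> 0"
  proof (rule ccontr)
    assume "\<not> mm \<le> 0"
    then have mm: "0 < mm" by simp
    have pos: "0 < 2 * (2 + mp + mm)" using m0 by simp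
    have "2 * mm \<le> mm / (2 * (2 + mp + mm)) * (2 * (2 + mp + mm))"
      using mm pos by (intro key divide_pos_pos)
    then show False using mm pos by simp
  qed
  then have "(\<integral>w. km w \<partial>\<rho>) = 0" using m0 by (simp add: mm_def)
  then have "AE w in \<rho>. km w = 0"
    using integral_nonneg_eq_0_iff_AE[OF int(2)] nn by simp
  then show ?thesis by eventually_elim (simp add: km_def max_def split: if_splits)
qed

end

section \<open>Pairs of measures on the circle\<close>

lemma AE_total_variation:
  assumes s: "sets N = sets M" and "AE x in M. P x" "AE x in N. P x"
  shows "AE x in total_variation M N. P x"
proof -
  obtain A where A: "{x \<in> space M. \<not> P x} \<subseteq> A" "A \<in> sets M" "emeasure M A = 0"
    using assms(2) by (auto elim: AE_E)
  obtain B where B: "{x \<in> space N. \<not> P x} \<subseteq> B" "B \<in> sets N" "emeasure N B = 0"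
    using assms(3) by (auto elim: AE_E)
  have B': "B \<in> sets M" using B s by simp
  show ?thesis
  proof (rule AE_I[of _ _ "A \<inter> B"])
    show "{x \<in> space (total_variation M N). \<not> P x} \<subseteq> A \<inter> B"
      using A(1) B(1) sets_eq_imp_space_eq[OF s] by auto
    have "emeasure M (A \<inter> B) = 0" "emeasure N (A \<inter> B) = 0"
      using emeasure_mono[of "A \<inter> B" A M] emeasure_mono[of "A \<inter> B" B N] A B by auto
    then show "emeasure (total_variation M N) (A \<inter> B) = 0"
      using A B' by (simp add: emeasure_total_variation[OF s])
    show "A \<inter> B \<in> sets (total_variation M N)" using A B' by simp
  qed
qed

lemma le_total_variation:
  assumes s: "sets N = sets M"
  shows "M \<le> total_variation M N" "N \<le> total_variation M N"
  by (subst le_measure, use s in \<open>auto simp: emeasure_total_variation[OF s]\<close>)+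

lemma nn_integral_total_variation_ge:
  assumes s: "sets N = sets M"
  shows "(\<integral>\<^sup>+ x. f x \<partial>M) \<le> (\<integral>\<^sup>+ x. f x \<partial>total_variation M N)"
    "(\<integral>\<^sup>+ x. f x \<partial>N) \<le> (\<integral>\<^sup>+ x. f x \<partial>total_variation M N)"
  by (rule nn_integral_mono_measure; use s le_total_variation[OF s] in simp)+

lemma finite_measure_total_variation:
  assumes s: "sets N = sets M" and "finite_measure M" "finite_measure N"
  shows "finite_measure (total_variation M N)"
proof
  interpret M: finite_measure M by fact
  interpret N: finite_measure N by fact
  show "emeasure (total_variation M N) (space (total_variation M N)) \<noteq> \<infinity>"
    using M.emeasure_finite[of "space M"] N.emeasure_finite[of "space M"]
    by (simp add: emeasure_total_variation[OF s])
qed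

lemma density_of_dominated:
  assumes "finite_measure R" "finite_measure M" "sets M = sets R" "M \<le> R"
  obtains f where "f \<in> borel_measurable R" "\<And>x. 0 \<le> f x" "M = density R (\<lambda>x. ennreal (f x))"
proof -
  interpret R: finite_measure R by fact
  have ac: "absolutely_continuous R M"
    using assms(3,4) by (auto simp: absolutely_continuous_def null_sets_def le_measure
      intro: order_antisym[OF order_trans])
  obtain f where f: "f \<in> borel_measurable R" "AE x in R. RN_deriv R M x = ennreal (f x)" "\<And>x. 0 \<le> f x"
    using R.real_RN_deriv[OF assms(2) ac assms(3)] by blast
  have "M = density R (RN_deriv R M)" using R.density_RN_deriv[OF ac assms(3)] by simp
  also have "\<dots> = density R (\<lambda>x. ennreal (f x))"
    by (rule density_cong) (use f in auto)
  finally show ?thesis using f that by blast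
qed

lemma (in circle_measure) admissible_diff:
  assumes "admissible k" "admissible h"
  shows "admissible (\<lambda>w. k w - h w)"
proof -
  note [measurable] = admissibleD(1)[OF assms(1)] admissibleD(1)[OF assms(2)]
  have "AE x in unit_interval. integrable \<rho> (\<lambda>w. (k w - h w) / norm (w + circ x))"
    using admissibleD(3)[OF assms(1)] admissibleD(3)[OF assms(2)]
    by eventually_elim (simp add: diff_divide_distrib)
  then show ?thesis
    using assms by (simp add: admissible_def)
qed

lemma (in circle_measure) admissible_density:
  assumes f: "f \<in> borel_measurable borel" "\<And>w. 0 \<le> f w"
    and fin: "finite_measure (density \<rho> (\<lambda>w. ennreal (f w)))"
    and int: "AE x in unit_interval. (\<integral>\<^sup>+ w. 1 / ennreal (norm (w + circ x)) \<partial>density \<rho> (\<lambda>w. ennreal (f w))) < \<infinity>"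
  shows "admissible f"
    "boundary_fun f x = (\<integral>w. Im (herglotz w (circ x)) \<partial>density \<rho> (\<lambda>w. ennreal (f w)))"
    "(\<integral>w. f w \<partial>\<rho>) = measure (density \<rho> (\<lambda>w. ennreal (f w))) UNIV"
proof -
  note [measurable] = f(1)
  let ?M = "density \<rho> (\<lambda>w. ennreal (f w))"
  interpret M: finite_measure ?M by fact
  have sp: "space \<rho> = UNIV" using sets_eq_imp_space_eq[OF sets_rho] by simp
  have em: "emeasure ?M UNIV = (\<integral>\<^sup>+ w. ennreal (f w) \<partial>\<rho>)"
    by (subst emeasure_density) (auto simp: sp)
  have i1: "integrable \<rho> f"
    by (rule integrableI_nonneg) (use em M.emeasure_finite[of UNIV] f in \<open>auto simp: less_top[symmetric]\<close>)
  have "AE x in unit_interval. integrable \<rho> (\<lambda>w. f w / norm (w + circ x))"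
    using int
  proof eventually_elim
    case (elim x)
    have "(\<integral>\<^sup>+ w. ennreal (f w / norm (w + circ x)) \<partial>\<rho>) \<le> (\<integral>\<^sup>+ w. ennreal (f w) * (1 / ennreal (norm (w + circ x))) \<partial>\<rho>)"
    proof (rule nn_integral_mono)
      fix w
      show "ennreal (f w / norm (w + circ x)) \<le> ennreal (f w) * (1 / ennreal (norm (w + circ x)))"
        by (cases "norm (w + circ x) = 0") (use f(2)[of w] in \<open>auto simp: divide_ennreal ennreal_1[symmetric] ennreal_mult[symmetric] simp del: ennreal_1\<close>)
    qed
    also have "\<dots> = (\<integral>\<^sup>+ w. 1 / ennreal (norm (w + circ x)) \<partial>?M)"
      by (subst nn_integral_density) auto
    also have "\<dots> < \<infinity>" by fact
    finally show ?case
      by (intro integrableI_nonneg) (use f in auto)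
  qed
  then show "admissible f" using i1 f by (simp add: admissible_def)
  show "boundary_fun f x = (\<integral>w. Im (herglotz w (circ x)) \<partial>?M)"
    unfolding boundary_fun_def by (subst integral_density) (use f in auto)
  have "(\<integral>w. f w \<partial>\<rho>) = (\<integral>w. 1 \<partial>?M)"
    by (subst integral_density) (use f in auto)
  then show "(\<integral>w. f w \<partial>\<rho>) = measure ?M UNIV" by (simp add: sp)
qed

text \<open>Both measures have densities \<open>f\<close>, \<open>h\<close> with respect to their sum, and the previous theorem applies
  to the weight \<open>f - h\<close>.\<close>

theorem cauchy_law_dominated:
  fixes M N :: "complex measure"
  assumes M: "finite_measure M" "sets M = sets borel" "AE w in M. norm w = 1"
    and N: "finite_measure N" "sets N = sets borel" "AE w in N. norm w = 1"
    and intM: "AE x in unit_interval. (\<integral>\<^sup>+ w. 1 / ennreal (norm (w + circ x)) \<partial>M) < \<infinity>"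
    and intN: "AE x in unit_interval. (\<integral>\<^sup>+ w. 1 / ennreal (norm (w + circ x)) \<partial>N) < \<infinity>"
    and law: "\<And>n. (\<integral>x. cos (1 / real (Suc n) *
          ((\<integral>w. Im (herglotz w (circ x)) \<partial>M) - (\<integral>w. Im (herglotz w (circ x)) \<partial>N))) \<partial>unit_interval) =
        exp (- (1 / real (Suc n)) * (measure M UNIV - measure N UNIV))"
    and A: "A \<in> sets borel"
  shows "emeasure N A \<le> emeasure M A"
proof -
  define \<rho> where "\<rho> = total_variation M N"
  have sNM: "sets N = sets M" using M N by simp
  have sr: "sets \<rho> = sets borel" by (simp add: \<rho>_def M)
  have finr: "finite_measure \<rho>" unfolding \<rho>_def by (rule finite_measure_total_variation) (use M N in auto)
  have anti: "AE w in R. w + circ x \<noteq> 0"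
    if "(\<integral>\<^sup>+ w. 1 / ennreal (norm (w + circ x)) \<partial>R) < \<infinity>" and [measurable_cong]: "sets R = sets borel"
    for R :: "complex measure" and x
  proof -
    have "AE w in R. 1 / ennreal (norm (w + circ x)) \<noteq> \<infinity>"
      by (rule nn_integral_PInf_AE) (use that in auto)
    then show ?thesis by eventually_elim auto
  qed
  interpret finite_measure \<rho> by fact
  interpret circle_measure \<rho>
  proof
    show "AE w in \<rho>. norm w = 1" unfolding \<rho>_def by (rule AE_total_variation) (use M N in auto)
    show "AE x in unit_interval. AE w in \<rho>. w + circ x \<noteq> 0"
      using intM intN unfolding \<rho>_def
      by eventually_elim (intro AE_total_variation anti sNM M N)
  qed (rule sr)
  obtain f where f: "f \<in> borel_measurable \<rho>" "\<And>w. 0 \<le> f w" "M = density \<rho> (\<lambda>w. ennreal (f w))"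
    using density_of_dominated[OF finr M(1)] le_total_variation(1)[OF sNM] M sr \<rho>_def by metis
  obtain h where h: "h \<in> borel_measurable \<rho>" "\<And>w. 0 \<le> h w" "N = density \<rho> (\<lambda>w. ennreal (h w))"
    using density_of_dominated[OF finr N(1)] le_total_variation(2)[OF sNM] N sr \<rho>_def by metis
  have fm [measurable]: "f \<in> borel_measurable borel" and hm [measurable]: "h \<in> borel_measurable borel"
    using f(1) h(1) by simp_all
  note fd = admissible_density[OF fm f(2) M(1)[unfolded f(3)] intM[unfolded f(3)], folded f(3)]
  note hd = admissible_density[OF hm h(2) N(1)[unfolded h(3)] intN[unfolded h(3)], folded h(3)]
  have "AE w in \<rho>. 0 \<le> f w - h w"
  proof (rule weight_nonneg)
    show "admissible (\<lambda>w. f w - h w)" using fd(1) hd(1) by (rule admissible_diff)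
    fix n
    have "(\<integral>x. cos (1 / real (Suc n) * boundary_fun (\<lambda>w. f w - h w) x) \<partial>unit_interval) =
      (\<integral>x. cos (1 / real (Suc n) * (boundary_fun f x - boundary_fun h x)) \<partial>unit_interval)"
    proof (rule integral_cong_AE)
      show "AE x in unit_interval. cos (1 / real (Suc n) * boundary_fun (\<lambda>w. f w - h w) x) = cos (1 / real (Suc n) * (boundary_fun f x - boundary_fun h x))"
        using boundary_fun_diff[OF fd(1) hd(1)] by eventually_elim simp
    qed measurable
    also have "\<dots> = exp (- (1 / real (Suc n)) * (measure M UNIV - measure N UNIV))"
      unfolding fd(2) hd(2) by (rule law)
    also have "measure M UNIV - measure N UNIV = (\<integral>w. f w - h w \<partial>\<rho>)"
      using fd(3) hd(3) admissibleD(2)[OF fd(1)] admissibleD(2)[OF hd(1)] by simp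
    finally show "(\<integral>x. cos (1 / real (Suc n) * boundary_fun (\<lambda>w. f w - h w) x) \<partial>unit_interval) =
       exp (- (1 / real (Suc n)) * (\<integral>w. f w - h w \<partial>\<rho>))" .
  qed
  then have "(\<integral>\<^sup>+ w. ennreal (h w) * indicator A w \<partial>\<rho>) \<le> (\<integral>\<^sup>+ w. ennreal (f w) * indicator A w \<partial>\<rho>)"
    by (intro nn_integral_mono_AE, eventually_elim) (auto intro!: mult_right_mono ennreal_leI)
  then show ?thesis
    using A by (subst f(3), subst h(3)) (simp add: emeasure_density)
qed

section \<open>The characteristic function of the Cauchy law\<close>

lemma integral_unit_interval: "(\<integral>x. f x \<partial>unit_interval) = (\<integral>x. indicator {0..1} x *\<^sub>R f x \<partial>lborel)"
  for f :: "real \<Rightarrow> real"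
  by (simp add: integral_restrict_space)

lemma integral_periodic_shift:
  fixes f :: "real \<Rightarrow> real"
  assumes [measurable]: "f \<in> borel_measurable borel" and bound: "\<And>x. \<bar>f x\<bar> \<le> B"
    and per: "\<And>x. f (x + 1) = f x"
  shows "(\<integral>x. f (x + t) \<partial>unit_interval) = (\<integral>x. f x \<partial>unit_interval)"
proof -
  have int: "integrable lborel (\<lambda>x. indicator S x * f (x + c))"
    if [measurable]: "S \<in> sets borel" and "S \<subseteq> {a..b}" for S a b c
  proof (rule Bochner_Integration.integrable_bound)
    show "integrable lborel (\<lambda>x. B * indicator {a..b} x :: real)"
      by (intro integrable_mult_right integrable_real_indicator) (auto simp: emeasure_lborel_Icc_eq)
    have "0 \<le> B" using bound[of 0] by linarith
    then show "AE x in lborel. norm (indicator S x * f (x + c)) \<le> norm (B * indicator {a..b} x)"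
      using that bound by (auto intro!: AE_I2 split: split_indicator)
  qed measurable
  have main: "(\<integral>x. f (x + t) \<partial>unit_interval) = (\<integral>x. f x \<partial>unit_interval)" if t: "0 \<le> t" "t \<le> 1" for t
  proof -
    have "(\<integral>x. f (x + t) \<partial>unit_interval) = (\<integral>x. indicator {0..1} x * f (x + t) \<partial>lborel)"
      by (simp add: integral_unit_interval)
    also have "\<dots> = (\<integral>x. indicator {0..1-t} x * f (x + t) + indicator {1-t<..1} x * f (x + t) \<partial>lborel)"
      by (rule Bochner_Integration.integral_cong) (use t in \<open>auto split: split_indicator\<close>)
    also have "\<dots> = (\<integral>x. indicator {0..1-t} x * f (x + t) \<partial>lborel) + (\<integral>x. indicator {1-t<..1} x * f (x + t) \<partial>lborel)"
      by (rule Bochner_Integration.integral_add[OF int[of _ 0 1] int[of _ 0 1]]) (use t in auto)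
    also have "(\<integral>x. indicator {0..1-t} x * f (x + t) \<partial>lborel) = (\<integral>x. indicator {t..1} x * f x \<partial>lborel)"
      by (subst lborel_integral_real_affine[where c = 1 and t = t]) 
         (auto intro!: Bochner_Integration.integral_cong simp: add.commute split: split_indicator)
    also have "(\<integral>x. indicator {1-t<..1} x * f (x + t) \<partial>lborel) = (\<integral>x. indicator {0<..t} x * f x \<partial>lborel)"
    proof (subst lborel_integral_real_affine[where c = 1 and t = "t - 1", of "\<lambda>x. indicator {0<..t} x * f x"])
      show "(\<integral>x. indicator {1-t<..1} x * f (x + t) \<partial>lborel) = \<bar>1\<bar> *\<^sub>R (\<integral>x. indicator {0<..t} (t - 1 + 1 * x) * f (t - 1 + 1 * x) \<partial>lborel)"
        using per[of "x + t - 1" for x]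
        by (auto intro!: Bochner_Integration.integral_cong simp: algebra_simps split: split_indicator)
    qed simp_all
    also have "(\<integral>x. indicator {t..1} x * f x \<partial>lborel) + (\<integral>x. indicator {0<..t} x * f x \<partial>lborel) =
        (\<integral>x. indicator {t..1} x * f x + indicator {0<..t} x * f x \<partial>lborel)"
    proof -
      have "{0<..t} \<subseteq> {0..1}" using t by auto
      then show ?thesis using int[of "{t..1}" 0 1 0] int[of "{0<..t}" 0 1 0] t by simp
    qed
    also have "\<dots> = (\<integral>x. indicator {0..1} x * f x \<partial>lborel)"
    proof (rule integral_cong_AE)
      have "AE x in lborel. x \<noteq> 0 \<and> x \<noteq> t" by (intro AE_conjI AE_lborel_singleton)
      then show "AE x in lborel. indicator {t..1} x * f x + indicator {0<..t} x * f x = indicator {0..1} x * f x"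
        by eventually_elim (use t in \<open>auto split: split_indicator\<close>)
    qed measurable
    finally show ?thesis by (simp add: integral_unit_interval)
  qed
  have pern: "f (x + real n) = f x" for x and n :: nat
    by (induction n) (use per[of "x + real _"] in \<open>auto simp: add_ac\<close>)
  have peri: "f (x + of_int m) = f x" for x and m :: int
  proof (cases "0 \<le> m")
    case True then show ?thesis using pern[of x "nat m"] by simp
  next
    case False then show ?thesis using pern[of "x + of_int m" "nat (- m)"] by simp
  qed
  have "f (x + t) = f (x + frac t)" for x
    using peri[of "x + frac t" "\<lfloor>t\<rfloor>"] by (simp add: frac_def)
  then show ?thesis
    using main[of "frac t"] frac_ge_0[of t] frac_lt_1[of t] by simp
qed

lemma std_cauchy_eq_distr: "std_cauchy = distr unit_interval borel (\<lambda>x. tan (pi * (x - 1 / 2)))"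
proof (rule measure_eqI_lessThan)
  let ?g = "\<lambda>x. tan (pi * (x - 1 / 2))"
  have [measurable]: "?g \<in> borel_measurable borel"
    unfolding tan_def by measurable
  interpret D: prob_space "distr unit_interval borel ?g"
    by (rule unit_interval.prob_space_distr) measurable
  fix y :: real
  have "emeasure (distr unit_interval borel ?g) {y<..} = emeasure unit_interval (?g -` {y<..} \<inter> {0..1})"
    by (subst emeasure_distr) (auto simp: space_restrict_space)
  also have "\<dots> = emeasure lborel (?g -` {y<..} \<inter> {0..1})"
    by (rule emeasure_restrict_space) auto
  also have "\<dots> = emeasure lborel {1 / 2 + arctan y / pi <..< 1}"
  proof (rule emeasure_eq_AE)
    have "AE x in lborel. x \<noteq> 0 \<and> x \<noteq> (1::real)" by (intro AE_conjI AE_lborel_singleton)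
    then show "AE x in lborel. x \<in> ?g -` {y<..} \<inter> {0..1} \<longleftrightarrow> x \<in> {1 / 2 + arctan y / pi <..< 1}"
    proof eventually_elim
      case (elim x)
      have iff: "y < ?g x \<longleftrightarrow> 1 / 2 + arctan y / pi < x" if x: "0 < x" "x < 1"
      proof -
        have b: "- (pi / 2) < pi * (x - 1 / 2)" "pi * (x - 1 / 2) < pi / 2"
          using x by (auto simp: field_simps)
        have "y < ?g x \<longleftrightarrow> arctan y < arctan (?g x)" by (simp add: arctan_less_iff)
        also have "\<dots> \<longleftrightarrow> arctan y < pi * (x - 1 / 2)" using b by (simp add: arctan_tan)
        also have "\<dots> \<longleftrightarrow> 1 / 2 + arctan y / pi < x" by (simp add: field_simps)
        finally show ?thesis .
      qed
      have "0 < 1 / 2 + arctan y / pi"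
        using arctan_lbound[of y] by (simp add: field_simps)
      then show ?case using elim iff by auto
    qed
  qed measurable
  also have "\<dots> = ennreal (1 / 2 - arctan y / pi)"
    using arctan_ubound[of y] by (subst emeasure_lborel_Ioo) (auto simp: field_simps)
  finally have d: "emeasure (distr unit_interval borel ?g) {y<..} = ennreal (1 / 2 - arctan y / pi)" .
  have "emeasure std_cauchy {y<..} = (\<integral>\<^sup>+ x. ennreal (1 / (pi * (1 + x\<^sup>2))) * indicator {y<..} x \<partial>lborel)"
    unfolding std_cauchy_def by (rule emeasure_density) auto
  also have "\<dots> = (\<integral>\<^sup>+ x. ennreal (1 / (pi * (1 + x\<^sup>2))) * indicator {y..} x \<partial>lborel)"
  proof (rule nn_integral_cong_AE)
    show "AE x in lborel. ennreal (1 / (pi * (1 + x\<^sup>2))) * indicator {y<..} x = ennreal (1 / (pi * (1 + x\<^sup>2))) * indicator {y..} x"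
      using AE_lborel_singleton[of y] by eventually_elim (auto split: split_indicator)
  qed
  also have "\<dots> = ennreal ((pi / 2) / pi - arctan y / pi)"
  proof (rule nn_integral_FTC_atLeast)
    show "((\<lambda>x. arctan x / pi) has_real_derivative 1 / (pi * (1 + x\<^sup>2))) (at x)" for x
      by (auto intro!: derivative_eq_intros simp: divide_inverse mult_ac)
    show "((\<lambda>x. arctan x / pi) \<longlongrightarrow> (pi / 2) / pi) at_top"
      by (intro tendsto_intros tendsto_arctan_at_top) simp
    show "0 \<le> 1 / (pi * (1 + x\<^sup>2))" for x :: real
      by (intro divide_nonneg_nonneg mult_nonneg_nonneg add_nonneg_nonneg) auto
  qed measurable
  finally have c: "emeasure std_cauchy {y<..} = ennreal (1 / 2 - arctan y / pi)" by simp
  show "emeasure std_cauchy {y<..} = emeasure (distr unit_interval borel ?g) {y<..}"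
    by (simp add: c d)
  show "emeasure std_cauchy {y<..} < \<infinity>" by (simp add: c)
qed (simp_all add: std_cauchy_def)

text \<open>The point \<open>z / cnj z\<close> is the square of the direction of \<open>z\<close>, so it only depends on the line through
  \<open>z\<close>. Dividing numerator and denominator of the kernel by \<open>cis (\<pi> x)\<close> gives \<open>(y - cnj y) / (y + cnj y)\<close>
  for the rotated vector \<open>y = z cis (- \<pi> x)\<close>.\<close>

lemma rotated_unit_square:
  assumes z: "z \<noteq> 0"
  shows "Im (herglotz (z / cnj z) (circ x)) = Im (z * cis (- (pi * x))) / Re (z * cis (- (pi * x)))"
    and "norm (z / cnj z + circ x) = 2 * \<bar>Re (z * cis (- (pi * x)))\<bar> / norm z"
proof -
  let ?t = "pi * x"
  define y where "y = z * cis (- ?t)"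
  have cy: "cnj y = cnj z * cis ?t" by (simp add: y_def cis_cnj)
  have c: "circ x = cis ?t * cis ?t" by (simp add: circ_def cis_mult mult.assoc)
  have e: "cis ?t * (z * cis (- ?t)) = z" by (simp add: mult.left_commute[of "cis ?t"] cis_mult)
  have p: "z / cnj z + circ x = (cis ?t / cnj z) * (y + cnj y)"
    and m: "z / cnj z - circ x = (cis ?t / cnj z) * (y - cnj y)"
    unfolding cy unfolding y_def c using z e
    by (simp_all add: distrib_left right_diff_distrib)
  have "herglotz (z / cnj z) (circ x) = (y - cnj y) / (y + cnj y)"
    unfolding herglotz_def p m using z by (subst mult_divide_mult_cancel_left) auto
  also have "\<dots> = (2 * \<i> * of_real (Im y)) / of_real (2 * Re y)"
    by (simp add: complex_add_cnj complex_diff_cnj mult_ac)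
  also have "Im \<dots> = Im y / Re y" by (subst Im_divide_of_real) simp
  finally show "Im (herglotz (z / cnj z) (circ x)) = Im (z * cis (- ?t)) / Re (z * cis (- ?t))"
    by (simp add: y_def)
  show "norm (z / cnj z + circ x) = 2 * \<bar>Re (z * cis (- ?t))\<bar> / norm z"
    unfolding p y_def[symmetric] complex_add_cnj using z by (simp add: norm_mult norm_divide)
qed

text \<open>The unit mass at \<open>1\<close> has boundary function \<open>- tan (\<pi> x)\<close>, and \<open>tan\<close> of a uniform angle is Cauchy.\<close>

lemma cauchy_characteristic:
  assumes s: "0 \<le> s"
  shows "(\<integral>x. cos (s * x) \<partial>std_cauchy) = exp (- s)"
proof -
  define \<rho> where "\<rho> = return borel (1::complex)"
  interpret prob_space \<rho> unfolding \<rho>_def by (rule prob_space_return) simp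
  interpret circle_measure \<rho>
  proof
    show "sets \<rho> = sets borel" by (simp add: \<rho>_def)
    show "AE w in \<rho>. norm w = 1" unfolding \<rho>_def by (subst AE_return) auto
    have "AE x in unit_interval. x \<noteq> (1/2::real)"
      by (subst AE_restrict_space_iff) (auto intro: AE_mp[OF AE_lborel_singleton[of "1/2"]])
    moreover have "AE x in unit_interval. x \<in> {0..1}"
      using AE_space[of unit_interval] by (simp add: space_restrict_space)
    ultimately show "AE x in unit_interval. AE w in \<rho>. w + circ x \<noteq> 0"
    proof eventually_elim
      case (elim x)
      have "1 + circ x \<noteq> 0"
      proof
        assume "1 + circ x = 0"
        then have "norm (1 / cnj 1 + circ x) = 0" by simp
        then have "cos (pi * x) = 0" by (subst (asm) rotated_unit_square(2)) auto
        then have "arccos (cos (pi * x)) = pi / 2" by simp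
        moreover have "arccos (cos (pi * x)) = pi * x"
          using elim(2) by (intro arccos_cos) (auto simp: mult_le_cancel_left1)
        ultimately show False using elim(1) by simp
      qed
      then show ?case unfolding \<rho>_def by (subst AE_return) auto
    qed
  qed
  have adm: "admissible (\<lambda>_. 1)"
    unfolding admissible_def unfolding \<rho>_def
    by (auto intro!: AE_I2 integrableI_bounded simp: nn_integral_return)
  have bf: "boundary_fun (\<lambda>_. 1) x = - tan (pi * x)" for x
    unfolding boundary_fun_def unfolding \<rho>_def
    using rotated_unit_square(1)[of 1 x] by (subst integral_return) (auto simp: tan_def)
  have [measurable]: "(\<lambda>x. tan (pi * x)) \<in> borel_measurable borel"
    "(\<lambda>x. tan (pi * (x - 1 / 2))) \<in> borel_measurable borel"
    unfolding tan_def by measurable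
  have "(\<integral>x. cos (s * x) \<partial>std_cauchy) = (\<integral>x. cos (s * tan (pi * (x - 1 / 2))) \<partial>unit_interval)"
    unfolding std_cauchy_eq_distr by (subst integral_distr) auto
  also have "\<dots> = (\<integral>x. cos (s * tan (pi * (x + - 1 / 2))) \<partial>unit_interval)"
    by simp
  also have "\<dots> = (\<integral>x. cos (s * tan (pi * x)) \<partial>unit_interval)"
  proof (rule integral_periodic_shift[of "\<lambda>x. cos (s * tan (pi * x))" 1])
    show "cos (s * tan (pi * (x + 1))) = cos (s * tan (pi * x))" for x
      by (simp add: distrib_left)
  qed auto
  also have "\<dots> = exp (- s)"
    using boundary_law[OF adm _ s] by (simp add: bf prob_space)
  finally show ?thesis .
qed

section \<open>Haar measure on the orthogonal group\<close>

lemma matrix_mult_measurable [measurable]: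
  "(\<lambda>p. fst p ** snd p :: real ^ 'n ^ 'n) \<in> borel_measurable (borel \<Otimes>\<^sub>M borel)"
proof -
  have "continuous_on UNIV (\<lambda>p. fst p ** snd p :: real ^ 'n ^ 'n)"
    unfolding matrix_matrix_mult_def by (intro continuous_intros)
  then have "(\<lambda>p. fst p ** snd p :: real ^ 'n ^ 'n) \<in> borel_measurable borel"
    by (rule borel_measurable_continuous_onI)
  then show ?thesis by (simp add: borel_prod)
qed

lemma matrix_mult_measurable' [measurable (raw)]:
  fixes f g :: "'a \<Rightarrow> real ^ 'n ^ 'n"
  assumes "f \<in> borel_measurable M" "g \<in> borel_measurable M"
  shows "(\<lambda>x. f x ** g x) \<in> borel_measurable M"
  using measurable_compose[OF measurable_Pair[OF assms] matrix_mult_measurable] by simp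

lemma transpose_measurable [measurable]: "(transpose :: real ^ 'n ^ 'n \<Rightarrow> _) \<in> borel_measurable borel"
proof (rule borel_measurable_continuous_onI)
  show "continuous_on UNIV (transpose :: real ^ 'n ^ 'n \<Rightarrow> _)"
    unfolding transpose_def by (intro continuous_intros)
qed

lemma column_measurable_borel [measurable]: "(column i :: real ^ 'n ^ 'n \<Rightarrow> _) \<in> borel_measurable borel"
proof (rule borel_measurable_continuous_onI)
  show "continuous_on UNIV (column i :: real ^ 'n ^ 'n \<Rightarrow> _)"
    unfolding column_def by (intro continuous_intros)
qed

lemma column_matrix_mult: "column i (A ** B) = A *v column i B" for A B :: "real ^ 'n ^ 'n"
  by (simp add: vec_eq_iff column_def matrix_matrix_mult_def matrix_vector_mult_def)

lemma orthogonal_matrix_inner: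
  fixes R :: "real ^ 'n ^ 'n"
  assumes "orthogonal_matrix R"
  shows "(R *v x) \<bullet> (R *v y) = x \<bullet> y"
proof -
  have "(R *v x) \<bullet> (R *v y) = (transpose R *v (R *v x)) \<bullet> y"
    by (simp only: transpose_matrix_vector dot_lmul_matrix)
  also have "transpose R *v (R *v x) = x"
    using assms by (simp add: matrix_vector_mul_assoc orthogonal_matrix_def)
  finally show ?thesis .
qed

lemma orthonormal_columns:
  fixes Q :: "real ^ 'n ^ 'n"
  assumes "orthogonal_matrix Q"
  shows "column i Q \<bullet> column j Q = (if i = j then 1 else 0)"
  using orthogonal_matrix_inner[OF assms, of "axis i 1" "axis j 1"]
  by (auto simp: matrix_vector_mult_basis inner_axis_axis)

text \<open>The reflection in the hyperplane orthogonal to \<open>b - c\<close>. It gives the transitivity of the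
  orthogonal group on spheres, and of the stabiliser of \<open>x\<close> on spheres orthogonal to \<open>x\<close>.\<close>

lemma reflection_matrix:
  fixes b c :: "real ^ 'n"
  assumes "norm b = norm c"
  obtains R where "orthogonal_matrix R" "R *v b = c" "\<And>x. x \<bullet> b = x \<bullet> c \<Longrightarrow> R *v x = x"
proof -
  define d where "d = b - c"
  define f where "f z = z - (2 * (z \<bullet> d) / (d \<bullet> d)) *\<^sub>R d" for z
  have lin: "linear f"
  proof (rule linearI)
    show "f (x + y) = f x + f y" for x y
      unfolding f_def inner_add_left distrib_left add_divide_distrib scaleR_add_left by simp
    show "f (c *\<^sub>R x) = c *\<^sub>R f x" for c x
      unfolding f_def by (simp add: scaleR_diff_right)
  qed
  have "orthogonal_transformation f"
  proof (unfold orthogonal_transformation_def, intro conjI allI lin)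
    fix v w
    show "f v \<bullet> f w = v \<bullet> w"
      by (cases "d = 0") (simp_all add: f_def inner_diff_left inner_diff_right inner_commute[of d w])
  qed
  then have "orthogonal_matrix (matrix f)" by (simp add: orthogonal_transformation_matrix)
  moreover have mf: "matrix f *v x = f x" for x by (rule matrix_works) (simp add: linear_matrix_vector_mul_eq lin)
  moreover have "f b = c"
  proof (cases "d = 0")
    case True then show ?thesis by (simp add: f_def d_def)
  next
    case False
    have "2 * (b \<bullet> d) = d \<bullet> d"
      using assms by (simp add: d_def inner_diff_left inner_diff_right inner_commute[of c b] norm_eq)
    then have "f b = b - d" using False by (simp add: f_def)
    then show ?thesis by (simp add: d_def)
  qed
  moreover have "f x = x" if "x \<bullet> b = x \<bullet> c" for x
    using that by (simp add: f_def d_def inner_diff_right)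
  ultimately show ?thesis using that by simp
qed

locale haar =
  fixes H :: "(real ^ 'n ^ 'n) measure"
  assumes haar: "haar_orthogonal H"
begin

sublocale prob_space H using haar by (simp add: haar_orthogonal_def)

lemma sets_H [measurable_cong]: "sets H = sets (restrict_space borel {Q. orthogonal_matrix Q})"
  using haar by (simp add: haar_orthogonal_def)

lemma space_H: "space H = {Q. orthogonal_matrix Q}"
  using sets_eq_imp_space_eq[OF sets_H] by (simp add: space_restrict_space)

lemma measurable_H [measurable (raw)]: "f \<in> measurable borel N \<Longrightarrow> f \<in> measurable H N"
  unfolding measurable_cong_sets[OF sets_H refl] by (rule measurable_restrict_space1)

lemma measurable_into_H:
  assumes "f \<in> borel_measurable M" "\<And>x. x \<in> space M \<Longrightarrow> orthogonal_matrix (f x)"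
  shows "f \<in> measurable M H"
  unfolding measurable_cong_sets[OF refl sets_H]
  by (rule measurable_restrict_space2) (use assms in auto)

lemma left_invariant: "orthogonal_matrix R \<Longrightarrow> distr H H (\<lambda>Q. R ** Q) = H"
  using haar by (simp add: haar_orthogonal_def)

lemma mult_left_measurable: "orthogonal_matrix R \<Longrightarrow> (\<lambda>Q. R ** Q) \<in> measurable H H"
  by (rule measurable_into_H) (auto simp: space_H orthogonal_matrix_mul)

lemma mult_right_measurable: "orthogonal_matrix R \<Longrightarrow> (\<lambda>Q. Q ** R) \<in> measurable H H"
  by (rule measurable_into_H) (auto simp: space_H orthogonal_matrix_mul)

lemma transpose_measurable_H [measurable]: "transpose \<in> measurable H H"
  by (rule measurable_into_H) (auto simp: space_H)

lemma nn_integral_left: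
  assumes "orthogonal_matrix R" "f \<in> borel_measurable H"
  shows "(\<integral>\<^sup>+ Q. f (R ** Q) \<partial>H) = (\<integral>\<^sup>+ Q. f Q \<partial>H)"
  by (subst (2) left_invariant[OF assms(1), symmetric])
     (use assms mult_left_measurable in \<open>auto simp: nn_integral_distr\<close>)

text \<open>Integrate \<open>f (Y\<^sup>T X)\<close> over both variables. For fixed \<open>Y\<close> left invariance removes \<open>Y\<^sup>T\<close>; for fixed \<open>X\<close> one
  has \<open>Y\<^sup>T X = (X\<^sup>T Y)\<^sup>T\<close>, and left invariance removes \<open>X\<^sup>T\<close>. So left invariance alone already gives
  invariance under inversion, and with it right invariance.\<close>

lemma nn_integral_transpose:
  assumes f [measurable]: "f \<in> borel_measurable H"
  shows "(\<integral>\<^sup>+ Q. f (transpose Q) \<partial>H) = (\<integral>\<^sup>+ Q. f Q \<partial>H)"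
proof -
  interpret P: pair_prob_space H H ..
  have hb: "(\<lambda>Q. Q) \<in> borel_measurable H" by (rule measurable_H) simp
  have "(\<lambda>p. fst p) \<in> borel_measurable (H \<Otimes>\<^sub>M H)"
    by (rule measurable_compose[OF measurable_fst hb])
  moreover have "(\<lambda>p. snd p) \<in> borel_measurable (H \<Otimes>\<^sub>M H)"
    by (rule measurable_compose[OF measurable_snd hb])
  ultimately have "(\<lambda>p. transpose (snd p) ** fst p) \<in> borel_measurable (H \<Otimes>\<^sub>M H)"
    by (intro matrix_mult_measurable' measurable_compose[OF _ transpose_measurable])
  then have [measurable]: "(\<lambda>p. transpose (snd p) ** fst p) \<in> measurable (H \<Otimes>\<^sub>M H) H"
    by (rule measurable_into_H) (auto simp: space_pair_measure space_H orthogonal_matrix_mul)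
  have [measurable]: "(\<lambda>p. f (transpose (snd p) ** fst p)) \<in> borel_measurable (H \<Otimes>\<^sub>M H)"
    by measurable
  have "(\<integral>\<^sup>+ Q. f (transpose Q) \<partial>H) = (\<integral>\<^sup>+ X. (\<integral>\<^sup>+ Y. f (transpose Y) \<partial>H) \<partial>H)"
    by (simp add: emeasure_space_1)
  also have "\<dots> = (\<integral>\<^sup>+ X. (\<integral>\<^sup>+ Y. f (transpose Y ** X) \<partial>H) \<partial>H)"
  proof (rule nn_integral_cong)
    fix X assume "X \<in> space H"
    then have X: "orthogonal_matrix (transpose X)" by (simp add: space_H)
    have "(\<integral>\<^sup>+ Y. f (transpose (transpose X ** Y)) \<partial>H) = (\<integral>\<^sup>+ Y. f (transpose Y) \<partial>H)"
      by (rule nn_integral_left[OF X]) measurable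
    then show "(\<integral>\<^sup>+ Y. f (transpose Y) \<partial>H) = (\<integral>\<^sup>+ Y. f (transpose Y ** X) \<partial>H)"
      by (simp add: matrix_transpose_mul)
  qed
  also have "\<dots> = (\<integral>\<^sup>+ Y. (\<integral>\<^sup>+ X. f (transpose Y ** X) \<partial>H) \<partial>H)"
    by (rule P.Fubini'[symmetric]) (simp add: split_beta')
  also have "\<dots> = (\<integral>\<^sup>+ Y. (\<integral>\<^sup>+ X. f X \<partial>H) \<partial>H)"
    by (rule nn_integral_cong) (simp add: nn_integral_left space_H)
  also have "\<dots> = (\<integral>\<^sup>+ Q. f Q \<partial>H)" by (simp add: emeasure_space_1)
  finally show ?thesis .
qed

lemma nn_integral_right:
  assumes R: "orthogonal_matrix R" and f [measurable]: "f \<in> borel_measurable H"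
  shows "(\<integral>\<^sup>+ Q. f (Q ** R) \<partial>H) = (\<integral>\<^sup>+ Q. f Q \<partial>H)"
proof -
  note [measurable] = mult_right_measurable[OF R]
  have "(\<integral>\<^sup>+ Q. f (Q ** R) \<partial>H) = (\<integral>\<^sup>+ Q. f (transpose Q ** R) \<partial>H)"
    by (rule nn_integral_transpose[symmetric]) measurable
  also have "\<dots> = (\<integral>\<^sup>+ Q. f (transpose (transpose R ** Q)) \<partial>H)"
    by (simp add: matrix_transpose_mul)
  also have "\<dots> = (\<integral>\<^sup>+ Q. f (transpose Q) \<partial>H)"
    by (rule nn_integral_left) (use R in auto)
  also have "\<dots> = (\<integral>\<^sup>+ Q. f Q \<partial>H)" by (rule nn_integral_transpose[OF f])
  finally show ?thesis .
qed

lemma right_invariant: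
  assumes R: "orthogonal_matrix R"
  shows "distr H H (\<lambda>Q. Q ** R) = H"
proof (rule measure_eqI)
  fix A assume "A \<in> sets (distr H H (\<lambda>Q. Q ** R))"
  then have [measurable]: "A \<in> sets H" by simp
  have "emeasure (distr H H (\<lambda>Q. Q ** R)) A = (\<integral>\<^sup>+ Q. indicator A Q \<partial>distr H H (\<lambda>Q. Q ** R))"
    by simp
  also have "\<dots> = (\<integral>\<^sup>+ Q. indicator A (Q ** R) \<partial>H)" by (rule nn_integral_distr) (simp_all add: mult_right_measurable[OF R])
  also have "\<dots> = emeasure H A" by (subst nn_integral_right[OF R]) auto
  finally show "emeasure (distr H H (\<lambda>Q. Q ** R)) A = emeasure H A" .
qed simp

lemma AE_right:
  assumes R: "orthogonal_matrix R" and P: "AE Q in H. P Q"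
  shows "AE Q in H. P (Q ** R)"
  using P by (subst (asm) right_invariant[OF R, symmetric]) (rule AE_distrD[OF mult_right_measurable[OF R]])

lemma prob_left:
  assumes R: "orthogonal_matrix R" and P: "{Q \<in> space H. P Q} \<in> sets H"
  shows "measure H {Q \<in> space H. P (R ** Q)} = measure H {Q \<in> space H. P Q}"
proof -
  have "measure H {Q \<in> space H. P Q} = measure (distr H H (\<lambda>Q. R ** Q)) {Q \<in> space H. P Q}"
    by (simp add: left_invariant[OF R])
  also have "\<dots> = measure H ((\<lambda>Q. R ** Q) -` {Q \<in> space H. P Q} \<inter> space H)"
    by (rule measure_distr[OF mult_left_measurable[OF R] P])
  also have "(\<lambda>Q. R ** Q) -` {Q \<in> space H. P Q} \<inter> space H = {Q \<in> space H. P (R ** Q)}"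
    using R by (auto simp: space_H orthogonal_matrix_mul)
  finally show ?thesis by simp
qed

end

section \<open>Exceptional planes form a null set\<close>

text \<open>Any injective choice of exponents serves: a nonzero linear functional restricted to the curve
  is a nonzero polynomial and has finitely many zeros.\<close>

definition moment_curve :: "nat \<Rightarrow> real ^ 'n" where
  "moment_curve m = (\<chi> k. real m ^ (SOME e. inj e) k)"

lemma moment_curve_finite_zeros:
  fixes y :: "real ^ 'n"
  assumes "y \<noteq> 0"
  shows "finite {m. moment_curve m \<bullet> y = 0}"
proof -
  define e where "e = (SOME e :: 'n \<Rightarrow> nat. inj e)"
  have inj: "inj e"
    unfolding e_def using finite_imp_inj_to_nat_seg[of "UNIV :: 'n set"] by (auto intro!: someI_ex[of inj])
  define p where "p = (\<Sum>k\<in>UNIV. monom (y $ k) (e k))"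
  obtain k0 where k0: "y $ k0 \<noteq> 0" using assms by (auto simp: vec_eq_iff)
  have "coeff p (e k0) = (\<Sum>k\<in>UNIV. if k = k0 then y $ k else 0)"
    unfolding p_def coeff_sum by (rule sum.cong) (use inj in \<open>auto simp: coeff_monom dest: injD\<close>)
  also have "\<dots> = y $ k0" by simp
  finally have "p \<noteq> 0" using k0 by auto
  then have "finite {x. poly p x = 0}" by (rule poly_roots_finite)
  then have "finite (real -` {x. poly p x = 0})"
    by (rule finite_vimageI) (simp add: inj_on_def)
  moreover have "poly p (real m) = moment_curve m \<bullet> y" for m
    by (simp add: p_def poly_sum poly_monom moment_curve_def e_def[symmetric] inner_vec_def mult.commute)
  ultimately show ?thesis by (simp add: vimage_def)
qed

lemma moment_curve_eventually_nonzero: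
  assumes "y \<noteq> 0"
  shows "eventually (\<lambda>m. moment_curve m \<bullet> y \<noteq> 0) sequentially"
  using moment_curve_finite_zeros[OF assms] by (simp add: cofinite_eq_sequentially[symmetric] eventually_cofinite)

context haar
begin

text \<open>A substitute for densities. Almost surely \<open>Y Q\<close> is orthogonal to only finitely many points of the
  moment curve, so the probability of orthogonality to the \<open>m\<close>-th point tends to \<open>0\<close>. If invariance makes
  that probability independent of the point, then it vanishes.\<close>

lemma orthogonality_null:
  fixes Y :: "real ^ 'n ^ 'n \<Rightarrow> real ^ 'n"
  assumes Y [measurable]: "Y \<in> borel_measurable borel" and nz: "AE Q in H. Y Q \<noteq> 0"
    and const: "eventually (\<lambda>m. measure H {Q \<in> space H. moment_curve m \<bullet> Y Q = 0} = c) sequentially"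
  shows "c = 0"
proof -
  have "(\<lambda>m. \<integral>Q. indicator {Q \<in> space H. moment_curve m \<bullet> Y Q = 0} Q \<partial>H) \<longlonglongrightarrow> (\<integral>Q. (0::real) \<partial>H)"
  proof (rule integral_dominated_convergence[where w = "\<lambda>_. 1"])
    show "AE Q in H. (\<lambda>m. indicator {Q \<in> space H. moment_curve m \<bullet> Y Q = 0} Q) \<longlonglongrightarrow> (0::real)"
      using nz
    proof eventually_elim
      case (elim Q)
      show ?case
        using moment_curve_eventually_nonzero[OF elim] by (intro tendsto_eventually, eventually_elim) auto
    qed
  qed (auto split: split_indicator)
  then have "(\<lambda>m. measure H {Q \<in> space H. moment_curve m \<bullet> Y Q = 0}) \<longlonglongrightarrow> 0"
    by (simp add: Int_absorb1 subset_eq)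
  moreover have "(\<lambda>m. measure H {Q \<in> space H. moment_curve m \<bullet> Y Q = 0}) \<longlonglongrightarrow> c"
    using const by (rule tendsto_eventually)
  ultimately show ?thesis by (blast intro: LIMSEQ_unique)
qed

lemma column_inner_nonzero:
  assumes x: "x \<noteq> 0"
  shows "AE Q in H. x \<bullet> column i Q \<noteq> 0"
proof -
  let ?p = "\<lambda>b. measure H {Q \<in> space H. b \<bullet> column i Q = 0}"
  have eq: "?p b = ?p x" if b: "b \<noteq> 0" for b
  proof -
    let ?b = "(norm x / norm b) *\<^sub>R b"
    have "norm ?b = norm x" using b by simp
    from reflection_matrix[OF this] obtain R where R: "orthogonal_matrix R" "R *v ?b = x" by metis
    have e: "x \<bullet> column i (R ** Q) = ?b \<bullet> column i Q" for Q
      using orthogonal_matrix_inner[OF R(1), of ?b "column i Q"] R(2) by (simp add: column_matrix_mult)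
    have "?p x = measure H {Q \<in> space H. x \<bullet> column i (R ** Q) = 0}"
      by (rule prob_left[OF R(1), symmetric]) measurable
    then show ?thesis using x b by (simp add: e)
  qed
  have "?p x = 0"
  proof (rule orthogonality_null[of "column i"])
    show "AE Q in H. column i Q \<noteq> 0"
      using orthonormal_columns[of _ i i] by (intro AE_I2) (force simp: space_H)
    have "eventually (\<lambda>m. moment_curve m \<bullet> x \<noteq> 0) sequentially"
      by (rule moment_curve_eventually_nonzero[OF x])
    then show "eventually (\<lambda>m. ?p (moment_curve m) = ?p x) sequentially"
      by eventually_elim (auto intro: eq)
  qed measurable
  then show ?thesis by (subst AE_iff_measurable[OF _ refl]) (auto simp: emeasure_eq_measure)
qed

text \<open>The determinant of the projections of \<open>a\<close> and \<open>b\<close> to the plane of the columns \<open>i\<close>, \<open>j\<close>: it vanishes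
  iff the projections are parallel.\<close>

definition plane_form :: "'n \<Rightarrow> 'n \<Rightarrow> real ^ 'n ^ 'n \<Rightarrow> real ^ 'n \<Rightarrow> real ^ 'n \<Rightarrow> real" where
  "plane_form i j Q a b = (a \<bullet> column i Q) * (b \<bullet> column j Q) - (a \<bullet> column j Q) * (b \<bullet> column i Q)"

text \<open>The form only depends on the component \<open>pr a\<close> of \<open>a\<close> orthogonal to \<open>x\<close>, and by invariance under the
  stabiliser of \<open>x\<close> the probability that it vanishes is the same for all nonzero vectors orthogonal to \<open>x\<close>.
  As a function of \<open>a\<close> it is the scalar product with a random vector that is almost surely nonzero.\<close>

lemma plane_form_nonzero:
  assumes ij: "i \<noteq> j" and x: "norm x = 1" and a: "norm a = 1" "a \<noteq> x" "a \<noteq> - x"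
  shows "AE Q in H. plane_form i j Q a x \<noteq> 0"
proof -
  let ?p = "\<lambda>b. measure H {Q \<in> space H. plane_form i j Q b x = 0}"
  have [measurable]: "(\<lambda>Q. plane_form i j Q b c) \<in> borel_measurable borel" for b c
    unfolding plane_form_def by measurable
  have xx: "x \<bullet> x = 1" using x by (simp add: norm_eq_1)
  define pr where "pr b = b - (b \<bullet> x) *\<^sub>R x" for b
  have prx: "pr b \<bullet> x = 0" for b by (simp add: pr_def inner_diff_left xx)
  have form_pr: "plane_form i j Q (pr b) x = plane_form i j Q b x" for Q b
    by (simp add: plane_form_def pr_def inner_diff_left algebra_simps)
  have eq: "?p b = ?p c" if b: "b \<noteq> 0" "b \<bullet> x = 0" and c: "c \<noteq> 0" "c \<bullet> x = 0" for b c
  proof -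
    let ?b = "(norm c / norm b) *\<^sub>R b"
    have "norm ?b = norm c" using b by simp
    from reflection_matrix[OF this] obtain R where R: "orthogonal_matrix R" "R *v ?b = c" "\<And>z. z \<bullet> ?b = z \<bullet> c \<Longrightarrow> R *v z = z"
      by metis
    have Rx: "R *v x = x" using b c by (intro R(3)) (simp add: inner_commute)
    have e: "plane_form i j (R ** Q) c x = (norm c / norm b) * plane_form i j Q b x" for Q
      using orthogonal_matrix_inner[OF R(1), of ?b "column _ Q"] orthogonal_matrix_inner[OF R(1), of x "column _ Q"] R(2) Rx
      by (simp add: plane_form_def column_matrix_mult right_diff_distrib)
    have "?p c = measure H {Q \<in> space H. plane_form i j (R ** Q) c x = 0}"
      by (rule prob_left[OF R(1), symmetric]) measurable
    then show ?thesis using b c by (simp add: e)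
  qed
  have pa: "pr a \<noteq> 0"
  proof
    assume "pr a = 0"
    then have e: "a = (a \<bullet> x) *\<^sub>R x" by (simp add: pr_def)
    then have "\<bar>a \<bullet> x\<bar> = 1" using a(1) x by (metis mult.right_neutral norm_scaleR)
    then show False using e a by (metis abs_eq_iff' abs_1 scaleR_one scaleR_minus1_left abs_if)
  qed
  have "?p (pr a) = 0"
  proof (rule orthogonality_null[of "\<lambda>Q. (x \<bullet> column j Q) *\<^sub>R column i Q - (x \<bullet> column i Q) *\<^sub>R column j Q"])
    have x0: "x \<noteq> 0" using x by auto
    show "AE Q in H. (x \<bullet> column j Q) *\<^sub>R column i Q - (x \<bullet> column i Q) *\<^sub>R column j Q \<noteq> 0"
      using column_inner_nonzero[OF x0, of i] AE_space
    proof eventually_elim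
      case (elim Q)
      have "((x \<bullet> column j Q) *\<^sub>R column i Q - (x \<bullet> column i Q) *\<^sub>R column j Q) \<bullet> column j Q = - (x \<bullet> column i Q)"
        using orthonormal_columns[of Q] elim(2) ij by (simp add: space_H inner_diff_left)
      then show ?case using elim(1) by auto
    qed
    have "eventually (\<lambda>m. moment_curve m \<bullet> pr a \<noteq> 0) sequentially"
      by (rule moment_curve_eventually_nonzero[OF pa])
    then show "eventually (\<lambda>m. measure H {Q \<in> space H. moment_curve m \<bullet> ((x \<bullet> column j Q) *\<^sub>R column i Q - (x \<bullet> column i Q) *\<^sub>R column j Q) = 0} = ?p (pr a)) sequentially"
    proof eventually_elim
      case (elim m)
      have "pr (moment_curve m) \<bullet> pr a = moment_curve m \<bullet> pr a"
        using prx[of a] by (simp add: pr_def[of "moment_curve m"] inner_diff_left inner_commute[of x])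
      then have "pr (moment_curve m) \<noteq> 0" using elim by auto
      then have "?p (pr (moment_curve m)) = ?p (pr a)" by (intro eq prx pa)
      then show ?case by (simp add: form_pr) (simp add: plane_form_def inner_diff_right mult.commute)
    qed
  qed measurable
  then have "?p a = 0" by (simp add: form_pr)
  then show ?thesis by (subst AE_iff_measurable[OF _ refl]) (auto simp: emeasure_eq_measure)
qed

end

section \<open>Frames, their rotations and their bivectors\<close>

lemma measurable_pair_coarser:
  assumes "(\<lambda>x. x) \<in> measurable A C" "(\<lambda>x. x) \<in> measurable B D" "f \<in> measurable (C \<Otimes>\<^sub>M D) N"
  shows "f \<in> measurable (A \<Otimes>\<^sub>M B) N"
proof -
  have "(\<lambda>p. (fst p, snd p)) \<in> measurable (A \<Otimes>\<^sub>M B) (C \<Otimes>\<^sub>M D)"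
    by (rule measurable_Pair[OF measurable_compose[OF measurable_fst assms(1)] measurable_compose[OF measurable_snd assms(2)]])
  from measurable_compose[OF this assms(3)] show ?thesis by simp
qed

lemma ident_unit_interval: "(\<lambda>x. x) \<in> borel_measurable unit_interval"
  by (rule measurable_unit_interval) simp

lemma (in haar) ident_H: "(\<lambda>x. x) \<in> borel_measurable H"
  by (rule measurable_H) simp

text \<open>The angle is \<open>\<pi> x\<close>: one period of \<open>x\<close> rotates the frame by half a turn, which changes both
  vectors by a sign and leaves all projective quantities unchanged.\<close>

definition rot_fst :: "real \<Rightarrow> real ^ 'n \<Rightarrow> real ^ 'n \<Rightarrow> real ^ 'n" where
  "rot_fst x u v = cos (pi * x) *\<^sub>R u + sin (pi * x) *\<^sub>R v"

definition rot_snd :: "real \<Rightarrow> real ^ 'n \<Rightarrow> real ^ 'n \<Rightarrow> real ^ 'n" where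
  "rot_snd x u v = cos (pi * x) *\<^sub>R v - sin (pi * x) *\<^sub>R u"

lemma rot_measurable [measurable (raw)]:
  assumes [measurable]: "f \<in> borel_measurable M" "g \<in> borel_measurable M" "h \<in> borel_measurable M"
  shows "(\<lambda>y. rot_fst (f y) (g y) (h y)) \<in> borel_measurable M"
    "(\<lambda>y. rot_snd (f y) (g y) (h y)) \<in> borel_measurable M"
  unfolding rot_fst_def rot_snd_def by measurable

lemma rot_rot:
  "rot_fst x (rot_fst t u v) (rot_snd t u v) = rot_fst (x + t) u v"
  "rot_snd x (rot_fst t u v) (rot_snd t u v) = rot_snd (x + t) u v"
  by (simp_all add: rot_fst_def rot_snd_def distrib_left cos_add sin_add algebra_simps)

lemma rot_period:
  "rot_fst (x + 1) u v = - rot_fst x u v" "rot_snd (x + 1) u v = - rot_snd x u v"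
  by (simp_all add: rot_fst_def rot_snd_def distrib_left)

lemma rot_inner:
  assumes "u \<bullet> u = 1" "v \<bullet> v = 1" "u \<bullet> v = 0"
  shows "rot_fst x u v \<bullet> rot_snd x u v = 0"
  using assms by (simp add: rot_fst_def rot_snd_def inner_add_left inner_diff_right inner_commute[of v u])

text \<open>The bivector of \<open>u\<close> and \<open>v\<close> as a skew symmetric matrix. It is a continuous function of the frame and
  the same for all positively oriented orthonormal frames of a plane, so it stands in for the oriented plane.\<close>

definition wedge :: "real ^ 'n \<Rightarrow> real ^ 'n \<Rightarrow> real ^ 'n ^ 'n" where
  "wedge u v = (\<chi> k l. u $ k * v $ l - v $ k * u $ l)"

lemma wedge_mult: "wedge u v *v y = (v \<bullet> y) *\<^sub>R u - (u \<bullet> y) *\<^sub>R v"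
  by (simp add: vec_eq_iff wedge_def matrix_vector_mult_def inner_vec_def left_diff_distrib
      right_diff_distrib sum_subtractf sum_distrib_left sum_distrib_right mult_ac)

lemma wedge_combination:
  "wedge (a *\<^sub>R u + b *\<^sub>R v) (c *\<^sub>R u + d *\<^sub>R v) = (a * d - b * c) *\<^sub>R wedge u v"
  by (simp add: vec_eq_iff wedge_def algebra_simps)

lemma wedge_rot: "wedge (rot_fst x u v) (rot_snd x u v) = wedge u v"
proof -
  have "cos (pi * x) * cos (pi * x) - sin (pi * x) * - sin (pi * x) = 1"
    using sin_cos_squared_add3[of "pi * x"] by simp
  moreover have "rot_snd x u v = (- sin (pi * x)) *\<^sub>R u + cos (pi * x) *\<^sub>R v"
    by (simp add: rot_snd_def)
  ultimately show ?thesis unfolding rot_fst_def by (simp only: wedge_combination scaleR_one)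
qed

lemma wedge_continuous: "continuous_on S (\<lambda>p. wedge (fst p) (snd p))"
  unfolding wedge_def by (intro continuous_intros)

lemma wedge_measurable [measurable (raw)]:
  assumes "f \<in> borel_measurable M" "g \<in> borel_measurable M"
  shows "(\<lambda>x. wedge (f x) (g x)) \<in> borel_measurable M"
proof -
  have "(\<lambda>p. wedge (fst p) (snd p)) \<in> borel_measurable (borel \<Otimes>\<^sub>M borel)"
    unfolding borel_prod by (rule borel_measurable_continuous_onI[OF wedge_continuous])
  from measurable_compose[OF measurable_Pair[OF assms] this] show ?thesis by simp
qed

text \<open>For an orthonormal frame the square of the bivector matrix is minus the orthogonal projection to
  the plane. So this is the projection of the \<open>k\<close>-th coordinate vector; normalised, it is the first
  vector of a frame that depends on the bivector alone.\<close>

definition proj_axis :: "'n \<Rightarrow> real ^ 'n ^ 'n \<Rightarrow> real ^ 'n" where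
  "proj_axis k W = - (W *v (W *v axis k 1))"

definition sec_fst :: "'n \<Rightarrow> real ^ 'n ^ 'n \<Rightarrow> real ^ 'n" where
  "sec_fst k W = (1 / norm (proj_axis k W)) *\<^sub>R proj_axis k W"

definition sec_snd :: "'n \<Rightarrow> real ^ 'n ^ 'n \<Rightarrow> real ^ 'n" where
  "sec_snd k W = - (W *v sec_fst k W)"

lemma mult_vec_measurable [measurable (raw)]:
  fixes f :: "'a \<Rightarrow> real ^ 'n ^ 'n"
  assumes "f \<in> borel_measurable M" "g \<in> borel_measurable M"
  shows "(\<lambda>x. f x *v g x) \<in> borel_measurable M"
proof -
  have "continuous_on UNIV (\<lambda>p. fst p *v snd p :: real ^ 'n)"
    unfolding matrix_vector_mult_def by (intro continuous_intros)
  then have "(\<lambda>p. fst p *v snd p :: real ^ 'n) \<in> borel_measurable (borel \<Otimes>\<^sub>M borel)"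
    unfolding borel_prod by (rule borel_measurable_continuous_onI)
  from measurable_compose[OF measurable_Pair[OF assms] this] show ?thesis by simp
qed

lemma sec_measurable [measurable]:
  "proj_axis k \<in> borel_measurable borel" "sec_fst k \<in> borel_measurable borel" "sec_snd k \<in> borel_measurable borel"
  unfolding sec_snd_def sec_fst_def proj_axis_def by measurable

lemma proj_axis_wedge:
  assumes "u \<bullet> u = 1" "v \<bullet> v = 1" "u \<bullet> v = 0"
  shows "proj_axis k (wedge u v) = (u $ k) *\<^sub>R u + (v $ k) *\<^sub>R v"
  using assms by (simp add: proj_axis_def wedge_mult inner_diff_right inner_commute[of v u] inner_axis)

text \<open>The frame recovered from the bivector differs from the original frame by a rotation only.\<close>

lemma sec_wedge:
  assumes uv: "u \<bullet> u = 1" "v \<bullet> v = 1" "u \<bullet> v = 0" and nz: "proj_axis k (wedge u v) \<noteq> 0"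
  obtains t where "sec_fst k (wedge u v) = rot_fst t u v" "sec_snd k (wedge u v) = rot_snd t u v"
proof -
  define n where "n = norm (proj_axis k (wedge u v))"
  have n0: "n \<noteq> 0" using nz by (simp add: n_def)
  have "n\<^sup>2 = (u $ k)\<^sup>2 + (v $ k)\<^sup>2"
    using uv unfolding n_def proj_axis_wedge[OF uv] power2_norm_eq_inner
    by (simp add: inner_add_left inner_add_right inner_commute[of v u] power2_eq_square)
  moreover have "(u $ k / n)\<^sup>2 + (v $ k / n)\<^sup>2 = ((u $ k)\<^sup>2 + (v $ k)\<^sup>2) / n\<^sup>2"
    by (simp add: power_divide add_divide_distrib)
  ultimately have "(u $ k / n)\<^sup>2 + (v $ k / n)\<^sup>2 = n\<^sup>2 / n\<^sup>2"
    by (simp only:)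
  then have "(u $ k / n)\<^sup>2 + (v $ k / n)\<^sup>2 = 1"
    using n0 by simp
  then obtain \<theta> where \<theta>: "u $ k / n = cos \<theta>" "v $ k / n = sin \<theta>"
    using sincos_total_2pi by metis
  have f: "sec_fst k (wedge u v) = cos \<theta> *\<^sub>R u + sin \<theta> *\<^sub>R v"
    unfolding sec_fst_def n_def[symmetric] unfolding proj_axis_wedge[OF uv] \<theta>[symmetric]
    by (simp add: scaleR_add_right)
  have g: "sec_snd k (wedge u v) = cos \<theta> *\<^sub>R v - sin \<theta> *\<^sub>R u"
    unfolding sec_snd_def f using uv
    by (simp add: wedge_mult inner_add_right inner_commute[of v u])
  show ?thesis
    by (rule that[of "\<theta> / pi"]) (simp_all add: f g rot_fst_def rot_snd_def)
qed

definition frame_rotation :: "'n \<Rightarrow> 'n \<Rightarrow> real \<Rightarrow> real ^ 'n ^ 'n" where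
  "frame_rotation i j x = (\<chi> k l. (if l = i then rot_fst x (axis i 1) (axis j 1)
      else if l = j then rot_snd x (axis i 1) (axis j 1) else axis l 1) $ k)"

lemma column_frame_rotation:
  "column l (frame_rotation i j x) = (if l = i then rot_fst x (axis i 1) (axis j 1)
      else if l = j then rot_snd x (axis i 1) (axis j 1) else axis l 1)"
  by (simp add: column_def frame_rotation_def)

lemma orthogonal_frame_rotation:
  assumes "i \<noteq> j"
  shows "orthogonal_matrix (frame_rotation i j x)"
  unfolding orthogonal_matrix_orthonormal_columns
proof (intro conjI allI impI)
  have sc: "cos (pi * x) * cos (pi * x) + sin (pi * x) * sin (pi * x) = 1"
    using sin_cos_squared_add3[of "pi * x"] by simp
  show "norm (column l (frame_rotation i j x)) = 1" for l
    unfolding column_frame_rotation norm_eq_1 using assms sc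
    by (auto simp: rot_fst_def rot_snd_def inner_add_left inner_add_right inner_diff_left inner_diff_right inner_axis_axis add.commute)
  show "orthogonal (column k (frame_rotation i j x)) (column l (frame_rotation i j x))" if "k \<noteq> l" for k l
    unfolding column_frame_rotation orthogonal_def using assms that
    by (auto simp: rot_fst_def rot_snd_def inner_add_left inner_add_right inner_diff_left inner_diff_right inner_axis_axis)
qed

lemma columns_mult_rotation:
  fixes Q :: "real ^ 'n ^ 'n"
  assumes "i \<noteq> j"
  shows "column i (Q ** frame_rotation i j x) = rot_fst x (column i Q) (column j Q)"
    "column j (Q ** frame_rotation i j x) = rot_snd x (column i Q) (column j Q)"
  using assms
  by (simp_all add: column_matrix_mult column_frame_rotation rot_fst_def rot_snd_def
      matrix_vector_right_distrib matrix_vector_mult_scaleR matrix_vector_mult_basis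
      matrix_vector_mult_diff_distrib)

section \<open>From the plane law to almost every plane\<close>

text \<open>The map \<open>T\<close> of the pair of measures, transported from projective space to unit vectors.\<close>

definition barycentre_map :: "(real ^ 'n) measure \<Rightarrow> (real ^ 'n) measure \<Rightarrow> real ^ 'n \<Rightarrow> real ^ 'n" where
  "barycentre_map \<mu> \<nu> u = (\<integral>a. (1 / (a \<bullet> u)) *\<^sub>R a \<partial>\<mu>) - (\<integral>a. (1 / (a \<bullet> u)) *\<^sub>R a \<partial>\<nu>) - u"

lemma barycentre_map_minus: "barycentre_map \<mu> \<nu> (- u) = - barycentre_map \<mu> \<nu> u"
  by (simp add: barycentre_map_def)

text \<open>The hypotheses after choosing representatives on the sphere: \<open>\<mu>\<close> and \<open>\<nu>\<close> are the positive and the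
  negative part, and the last assumption is the conditional Cauchy law, tested against functions of the
  bivector.\<close>

locale cauchy_model = haar H + P: finite_measure \<mu> + N: finite_measure \<nu>
  for H :: "(real ^ 'n ^ 'n) measure" and \<mu> \<nu> :: "(real ^ 'n) measure" +
  fixes i j :: 'n
  assumes ij: "i \<noteq> j"
    and sets_mu [measurable_cong, simp]: "sets \<mu> = sets borel"
    and sets_nu [measurable_cong, simp]: "sets \<nu> = sets borel"
    and sphere_mu: "AE a in \<mu>. norm a = 1"
    and sphere_nu: "AE a in \<nu>. norm a = 1"
    and mass: "measure \<mu> UNIV - measure \<nu> UNIV = 1"
    and int_mu: "AE Q in H. (\<integral>\<^sup>+ a. 1 / ennreal \<bar>a \<bullet> column i Q\<bar> \<partial>\<mu>) < \<infinity>"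
    and int_nu: "AE Q in H. (\<integral>\<^sup>+ a. 1 / ennreal \<bar>a \<bullet> column i Q\<bar> \<partial>\<nu>) < \<infinity>"
    and law: "\<And>s B. 0 \<le> s \<Longrightarrow> B \<in> sets borel \<Longrightarrow>
      (\<integral>Q. indicator B (wedge (column i Q) (column j Q)) *
          cos (s * (barycentre_map \<mu> \<nu> (column i Q) \<bullet> column j Q)) \<partial>H) =
      exp (- s) * measure H {Q \<in> space H. wedge (column i Q) (column j Q) \<in> B}"
begin

abbreviation (input) "T \<equiv> barycentre_map \<mu> \<nu>"

lemma T_measurable [measurable]: "T \<in> borel_measurable borel"
  unfolding barycentre_map_def by measurable

definition angular_mean :: "real \<Rightarrow> real ^ 'n \<Rightarrow> real ^ 'n \<Rightarrow> real" where
  "angular_mean s u v = (\<integral>x. cos (s * (T (rot_fst x u v) \<bullet> rot_snd x u v)) \<partial>unit_interval)"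

lemma angular_mean_measurable [measurable (raw)]:
  assumes [measurable]: "f \<in> borel_measurable M" "g \<in> borel_measurable M"
  shows "(\<lambda>y. angular_mean s (f y) (g y)) \<in> borel_measurable M"
proof -
  have "(\<lambda>p. cos (s * (T (rot_fst (snd p) (fst (fst p)) (snd (fst p))) \<bullet> rot_snd (snd p) (fst (fst p)) (snd (fst p)))))
      \<in> borel_measurable ((borel \<Otimes>\<^sub>M borel) \<Otimes>\<^sub>M borel)"
    by measurable
  from measurable_pair_coarser[OF measurable_ident_sets[OF refl] ident_unit_interval this]
  have "(\<lambda>q. angular_mean s (fst q) (snd q)) \<in> borel_measurable (borel \<Otimes>\<^sub>M borel)"
    unfolding angular_mean_def
    by (intro unit_interval.borel_measurable_lebesgue_integral) (simp add: split_beta')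
  from measurable_compose[OF measurable_Pair[OF assms] this] show ?thesis by simp
qed

lemma angular_mean_rot: "angular_mean s (rot_fst t u v) (rot_snd t u v) = angular_mean s u v"
  unfolding angular_mean_def rot_rot
  by (rule integral_periodic_shift[of "\<lambda>x. cos (s * (T (rot_fst x u v) \<bullet> rot_snd x u v))" 1])
     (auto simp: rot_period barycentre_map_minus)

lemma frame:
  assumes "Q \<in> space H"
  shows "column i Q \<bullet> column i Q = 1" "column j Q \<bullet> column j Q = 1" "column i Q \<bullet> column j Q = 0"
  using orthonormal_columns[of Q] assms ij by (auto simp: space_H)

lemma law_rotated:
  assumes s: "0 \<le> s" and B [measurable]: "B \<in> sets borel"
  shows "(\<integral>Q. indicator B (wedge (column i Q) (column j Q)) *
      cos (s * (T (rot_fst x (column i Q) (column j Q)) \<bullet> rot_snd x (column i Q) (column j Q))) \<partial>H) =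
    exp (- s) * measure H {Q \<in> space H. wedge (column i Q) (column j Q) \<in> B}"
proof -
  note R = orthogonal_frame_rotation[OF ij, of x]
  let ?f = "\<lambda>Q. indicator B (wedge (column i Q) (column j Q)) * cos (s * (T (column i Q) \<bullet> column j Q)) :: real"
  have "(\<integral>Q. ?f Q \<partial>H) = (\<integral>Q. ?f Q \<partial>distr H H (\<lambda>Q. Q ** frame_rotation i j x))"
    by (simp only: right_invariant[OF R])
  also have "\<dots> = (\<integral>Q. ?f (Q ** frame_rotation i j x) \<partial>H)"
    by (rule integral_distr[OF mult_right_measurable[OF R]]) measurable
  finally show ?thesis
    unfolding columns_mult_rotation[OF ij] wedge_rot by (simp only: law[OF s B])
qed

text \<open>By right invariance the law holds for each rotated frame, and the bivector is unaffected; it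
  remains to integrate over the angle.\<close>

lemma law_averaged:
  assumes s: "0 \<le> s" and B [measurable]: "B \<in> sets borel"
  shows "(\<integral>Q. indicator B (wedge (column i Q) (column j Q)) * angular_mean s (column i Q) (column j Q) \<partial>H) =
    exp (- s) * measure H {Q \<in> space H. wedge (column i Q) (column j Q) \<in> B}"
proof -
  interpret PP: pair_prob_space H unit_interval ..
  let ?F = "\<lambda>Q x. indicator B (wedge (column i Q) (column j Q)) *
      cos (s * (T (rot_fst x (column i Q) (column j Q)) \<bullet> rot_snd x (column i Q) (column j Q))) :: real"
  have int: "integrable (H \<Otimes>\<^sub>M unit_interval) (\<lambda>(Q, x). ?F Q x)"
  proof (rule PP.P.integrable_const_bound[where B = 1])
    show "AE p in H \<Otimes>\<^sub>M unit_interval. norm (case p of (Q, x) \<Rightarrow> ?F Q x) \<le> 1"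
      by (auto split: split_indicator)
    show "(\<lambda>(Q, x). ?F Q x) \<in> borel_measurable (H \<Otimes>\<^sub>M unit_interval)"
      by (rule measurable_pair_coarser[OF ident_H ident_unit_interval]) measurable
  qed
  have "(\<integral>Q. indicator B (wedge (column i Q) (column j Q)) * angular_mean s (column i Q) (column j Q) \<partial>H) =
      (\<integral>Q. (\<integral>x. ?F Q x \<partial>unit_interval) \<partial>H)"
    by (simp add: angular_mean_def)
  also have "\<dots> = (\<integral>x. (\<integral>Q. ?F Q x \<partial>H) \<partial>unit_interval)"
    using PP.Fubini_integral[OF int] by simp
  also have "\<dots> = exp (- s) * measure H {Q \<in> space H. wedge (column i Q) (column j Q) \<in> B}"
    by (simp add: law_rotated[OF s B])
  finally show ?thesis .
qed

text \<open>The angular mean is unchanged when the frame is rotated, so it may be computed from the frame recovered from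
  the bivector. Hence the event that it exceeds (\<open>\<sigma> = 1\<close>) or undercuts (\<open>\<sigma> = - 1\<close>)
  \<open>exp (- s)\<close> is an event about the bivector, and the averaged law shows that it is null.\<close>

lemma angular_mean_AE:
  assumes s: "0 \<le> s"
  shows "AE Q in H. angular_mean s (column i Q) (column j Q) = exp (- s)"
proof -
  let ?W = "\<lambda>Q. wedge (column i Q) (column j Q)"
  have bnd: "\<bar>angular_mean s u v\<bar> \<le> 1" for u v
  proof -
    have "\<bar>angular_mean s u v\<bar> \<le> (\<integral>x. \<bar>cos (s * (T (rot_fst x u v) \<bullet> rot_snd x u v))\<bar> \<partial>unit_interval)"
      unfolding angular_mean_def by (rule integral_abs_bound)
    also have "\<dots> \<le> 1"
      by (rule unit_interval.integral_le_const) (auto intro!: unit_interval.integrable_const_bound[where B = 1])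
    finally show ?thesis .
  qed
  \<comment> \<open>The recovered frame exists when the plane is not orthogonal to the \<open>k\<close>-th axis; every plane admits
    such a \<open>k\<close>.\<close>
  have main: "AE Q in H. proj_axis k (?W Q) \<noteq> 0 \<longrightarrow> \<not> 0 < \<sigma> * (angular_mean s (column i Q) (column j Q) - exp (- s))" for k \<sigma>
  proof -
    define B where "B = {W. proj_axis k W \<noteq> 0 \<and> 0 < \<sigma> * (angular_mean s (sec_fst k W) (sec_snd k W) - exp (- s))}"
    have B [measurable]: "B \<in> sets borel" unfolding B_def by measurable
    have inB: "?W Q \<in> B \<longleftrightarrow> proj_axis k (?W Q) \<noteq> 0 \<and> 0 < \<sigma> * (angular_mean s (column i Q) (column j Q) - exp (- s))"
      if "Q \<in> space H" for Q
    proof (cases "proj_axis k (?W Q) = 0")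
      case False
      from sec_wedge[OF frame[OF that] False] obtain t where
        "sec_fst k (?W Q) = rot_fst t (column i Q) (column j Q)" "sec_snd k (?W Q) = rot_snd t (column i Q) (column j Q)" .
      then show ?thesis by (simp add: B_def angular_mean_rot)
    qed (simp add: B_def)
    let ?g = "\<lambda>Q. indicator B (?W Q) * (\<sigma> * (angular_mean s (column i Q) (column j Q) - exp (- s))) :: real"
    have i1: "integrable H (\<lambda>Q. indicator B (?W Q) * angular_mean s (column i Q) (column j Q) :: real)"
      by (rule integrable_const_bound[where B = 1]) (use bnd in \<open>auto split: split_indicator\<close>)
    have i2: "integrable H (\<lambda>Q. indicator B (?W Q) :: real)"
      by (rule integrable_const_bound[where B = 1]) (auto split: split_indicator)
    have geq: "?g = (\<lambda>Q. \<sigma> * (indicator B (?W Q) * angular_mean s (column i Q) (column j Q)) - \<sigma> * exp (- s) * indicator B (?W Q))"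
      by (auto simp: fun_eq_iff algebra_simps)
    have ig: "integrable H ?g" unfolding geq using i1 i2 by simp
    have "(\<integral>Q. indicator B (?W Q) \<partial>H) = measure H {Q \<in> space H. ?W Q \<in> B}"
    proof -
      have "(\<integral>Q. indicator B (?W Q) \<partial>H) = (\<integral>Q. indicator {Q \<in> space H. ?W Q \<in> B} Q \<partial>H :: real)"
        by (rule Bochner_Integration.integral_cong) (auto split: split_indicator)
      then show ?thesis by (simp add: Int_absorb1 subset_eq)
    qed
    then have "(\<integral>Q. ?g Q \<partial>H) = 0"
      unfolding geq using i1 i2 law_averaged[OF s B] by simp
    moreover have "AE Q in H. 0 \<le> ?g Q"
      using AE_space by eventually_elim (auto simp: inB split: split_indicator)
    ultimately have "AE Q in H. ?g Q = 0"
      using integral_nonneg_eq_0_iff_AE[OF ig] by simp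
    then show ?thesis
      using AE_space by eventually_elim (auto simp: inB split: split_indicator_asm)
  qed
  have "AE Q in H. \<forall>k. proj_axis k (?W Q) \<noteq> 0 \<longrightarrow> angular_mean s (column i Q) (column j Q) = exp (- s)"
  proof (subst AE_all_countable, intro allI)
    fix k
    show "AE Q in H. proj_axis k (?W Q) \<noteq> 0 \<longrightarrow> angular_mean s (column i Q) (column j Q) = exp (- s)"
      using main[of k 1] main[of k "- 1"] by eventually_elim auto
  qed
  then show ?thesis
    using AE_space
  proof eventually_elim
    case (elim Q)
    note f = frame[OF elim(2)]
    have "column i Q \<noteq> 0" using f(1) by auto
    then obtain k where k: "column i Q $ k \<noteq> 0" by (auto simp: vec_eq_iff)
    have "proj_axis k (?W Q) \<bullet> column i Q = column i Q $ k"
      unfolding proj_axis_wedge[OF f] using f by (simp add: inner_add_left inner_commute[of "column j Q" "column i Q"])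
    then have "proj_axis k (?W Q) \<noteq> 0" using k by auto
    then show ?case using elim(1) by blast
  qed
qed

lemma integrable_rotated:
  fixes \<tau> :: "(real ^ 'n) measure"
  assumes fin: "finite_measure \<tau>" and [measurable_cong]: "sets \<tau> = sets borel"
    and int: "AE Q in H. (\<integral>\<^sup>+ a. 1 / ennreal \<bar>a \<bullet> column i Q\<bar> \<partial>\<tau>) < \<infinity>"
  shows "AE Q in H. AE x in unit_interval. (\<integral>\<^sup>+ a. 1 / ennreal \<bar>a \<bullet> rot_fst x (column i Q) (column j Q)\<bar> \<partial>\<tau>) < \<infinity>"
proof -
  interpret \<tau>: finite_measure \<tau> by fact
  interpret PP: pair_prob_space unit_interval H ..
  let ?J = "\<lambda>x Q. \<integral>\<^sup>+ a. 1 / ennreal \<bar>a \<bullet> rot_fst x (column i Q) (column j Q)\<bar> \<partial>\<tau>"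
  have "(\<lambda>p. ?J (fst p) (snd p)) \<in> borel_measurable (borel \<Otimes>\<^sub>M borel)"
    by measurable
  from measurable_pair_coarser[OF ident_unit_interval ident_H this]
  have [measurable]: "(\<lambda>p. ?J (fst p) (snd p)) \<in> borel_measurable (unit_interval \<Otimes>\<^sub>M H)" .
  have "AE x in unit_interval. AE Q in H. (\<integral>\<^sup>+ a. 1 / ennreal \<bar>a \<bullet> rot_fst x (column i Q) (column j Q)\<bar> \<partial>\<tau>) < \<infinity>"
    using AE_right[OF orthogonal_frame_rotation[OF ij] int] unfolding columns_mult_rotation[OF ij] by simp
  then show ?thesis
    by (subst PP.AE_commute[symmetric]) (rule borel_measurable_less, measurable)
qed

end

section \<open>Projection to a plane and the point mass argument\<close>

definition plane_coord :: "real ^ 'n \<Rightarrow> real ^ 'n \<Rightarrow> real ^ 'n \<Rightarrow> complex" where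
  "plane_coord u v a = Complex (a \<bullet> u) (a \<bullet> v)"

text \<open>The doubled argument of the projection of \<open>a\<close>, as a point of the unit circle; it is \<open>0\<close> when \<open>a\<close> is
  orthogonal to the plane.\<close>

definition plane_dir :: "real ^ 'n \<Rightarrow> real ^ 'n \<Rightarrow> real ^ 'n \<Rightarrow> complex" where
  "plane_dir u v a = plane_coord u v a / cnj (plane_coord u v a)"

lemma plane_coord_measurable [measurable]: "plane_coord u v \<in> borel_measurable borel"
proof -
  have "plane_coord u v = (\<lambda>a. of_real (a \<bullet> u) + \<i> * of_real (a \<bullet> v))"
    by (simp add: fun_eq_iff plane_coord_def complex_eq_iff)
  then show ?thesis by simp
qed

lemma plane_dir_measurable [measurable]: "plane_dir u v \<in> borel_measurable borel"
proof -
  have [measurable]: "cnj \<in> borel_measurable borel"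
    by (rule borel_measurable_continuous_onI) (intro continuous_intros)
  show ?thesis unfolding plane_dir_def by measurable
qed

lemma plane_coord_rot:
  "Re (plane_coord u v a * cis (- (pi * x))) = a \<bullet> rot_fst x u v"
  "Im (plane_coord u v a * cis (- (pi * x))) = a \<bullet> rot_snd x u v"
  by (simp_all add: plane_coord_def rot_fst_def rot_snd_def inner_add_right inner_diff_right mult.commute)

lemma norm_plane_coord_le:
  assumes uv: "u \<bullet> u = 1" "v \<bullet> v = 1" "u \<bullet> v = 0" and a: "norm a = 1"
  shows "norm (plane_coord u v a) \<le> 1"
proof -
  let ?r = "a - (a \<bullet> u) *\<^sub>R u - (a \<bullet> v) *\<^sub>R v"
  have "0 \<le> ?r \<bullet> ?r" by simp
  also have "?r \<bullet> ?r = a \<bullet> a - (a \<bullet> u)\<^sup>2 - (a \<bullet> v)\<^sup>2"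
    using uv by (simp add: inner_diff_left inner_diff_right inner_commute[of u a] inner_commute[of v a] inner_commute[of v u] power2_eq_square)
  also have "a \<bullet> a = 1" using a by (simp add: norm_eq_1)
  finally have "(norm (plane_coord u v a))\<^sup>2 \<le> 1"
    by (simp add: plane_coord_def cmod_power2)
  then show ?thesis by (simp add: power_le_one_iff abs_square_le_1)
qed

lemma plane_dir_eqD:
  assumes "plane_coord u v a \<noteq> 0" "plane_coord u v b \<noteq> 0" "plane_dir u v a = plane_dir u v b"
  shows "(a \<bullet> u) * (b \<bullet> v) - (a \<bullet> v) * (b \<bullet> u) = 0"
proof -
  have "plane_coord u v a * cnj (plane_coord u v b) = plane_coord u v b * cnj (plane_coord u v a)"
    using assms by (simp add: plane_dir_def frac_eq_eq)
  then have "Im (plane_coord u v a * cnj (plane_coord u v b)) = Im (plane_coord u v b * cnj (plane_coord u v a))"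
    by simp
  then show ?thesis by (simp add: plane_coord_def algebra_simps)
qed

text \<open>A vector orthogonal to the plane has an infinite integrand for every angle.\<close>

lemma plane_coord_nonzero:
  assumes uv: "u \<bullet> u = 1" "v \<bullet> v = 1" "u \<bullet> v = 0"
    and [measurable_cong]: "sets \<tau> = sets borel"
    and int: "AE x in unit_interval. (\<integral>\<^sup>+ a. 1 / ennreal \<bar>a \<bullet> rot_fst x u v\<bar> \<partial>\<tau>) < \<infinity>"
  shows "AE a in \<tau>. plane_coord u v a \<noteq> 0"
proof -
  have "\<exists>x. (\<integral>\<^sup>+ a. 1 / ennreal \<bar>a \<bullet> rot_fst x u v\<bar> \<partial>\<tau>) < \<infinity>"
  proof (rule ccontr)
    assume "\<nexists>x. (\<integral>\<^sup>+ a. 1 / ennreal \<bar>a \<bullet> rot_fst x u v\<bar> \<partial>\<tau>) < \<infinity>"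
    with int have "AE x in unit_interval. False" by simp
    then show False by simp
  qed
  then obtain x where x: "(\<integral>\<^sup>+ a. 1 / ennreal \<bar>a \<bullet> rot_fst x u v\<bar> \<partial>\<tau>) < \<infinity>" by blast
  have "AE a in \<tau>. 1 / ennreal \<bar>a \<bullet> rot_fst x u v\<bar> \<noteq> \<infinity>"
    by (rule nn_integral_PInf_AE) (use x in auto)
  then show ?thesis
  proof eventually_elim
    case (elim a)
    then have "a \<bullet> rot_fst x u v \<noteq> 0" by auto
    then show ?case using plane_coord_rot(1)[of u v a x] by auto
  qed
qed

text \<open>The hypotheses of the circle theorem for the image measure. Integrability is inherited because the
  projection of a unit vector has length at most \<open>1\<close>, which makes
  \<open>\<bar>w + \<zeta>\<bar> = 2 \<bar>a \<bullet> u\<bar> / \<bar>z\<bar>\<close> at least \<open>\<bar>a \<bullet> u\<bar>\<close>, where \<open>u\<close> is the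
  first vector of the rotated frame and \<open>z\<close> the projection of \<open>a\<close>.\<close>

lemma planar_pushforward:
  assumes uv: "u \<bullet> u = 1" "v \<bullet> v = 1" "u \<bullet> v = 0"
    and fin: "finite_measure \<tau>" and st [measurable_cong, simp]: "sets \<tau> = sets borel"
    and sph: "AE a in \<tau>. norm a = 1"
    and int: "AE x in unit_interval. (\<integral>\<^sup>+ a. 1 / ennreal \<bar>a \<bullet> rot_fst x u v\<bar> \<partial>\<tau>) < \<infinity>"
  shows "AE w in distr \<tau> borel (plane_dir u v). norm w = 1"
    and "AE x in unit_interval. (\<integral>\<^sup>+ w. 1 / ennreal (norm (w + circ x)) \<partial>distr \<tau> borel (plane_dir u v)) < \<infinity>"
    and "AE x in unit_interval. (\<integral>w. Im (herglotz w (circ x)) \<partial>distr \<tau> borel (plane_dir u v)) =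
        (\<integral>a. (1 / (a \<bullet> rot_fst x u v)) *\<^sub>R a \<partial>\<tau>) \<bullet> rot_snd x u v"
proof -
  note nz = plane_coord_nonzero[OF uv st int]
  have [measurable]: "plane_dir u v \<in> borel_measurable \<tau>" by simp
  show "AE w in distr \<tau> borel (plane_dir u v). norm w = 1"
    by (subst AE_distr_iff) (use nz in \<open>auto simp: plane_dir_def norm_divide\<close>)
  show "AE x in unit_interval. (\<integral>\<^sup>+ w. 1 / ennreal (norm (w + circ x)) \<partial>distr \<tau> borel (plane_dir u v)) < \<infinity>"
    using int
  proof eventually_elim
    case (elim x)
    have "(\<integral>\<^sup>+ w. 1 / ennreal (norm (w + circ x)) \<partial>distr \<tau> borel (plane_dir u v)) =
        (\<integral>\<^sup>+ a. 1 / ennreal (norm (plane_dir u v a + circ x)) \<partial>\<tau>)"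
      by (rule nn_integral_distr) measurable
    also have "\<dots> \<le> (\<integral>\<^sup>+ a. 1 / ennreal \<bar>a \<bullet> rot_fst x u v\<bar> \<partial>\<tau>)"
    proof (rule nn_integral_mono_AE)
      show "AE a in \<tau>. 1 / ennreal (norm (plane_dir u v a + circ x)) \<le> 1 / ennreal \<bar>a \<bullet> rot_fst x u v\<bar>"
        using nz sph
      proof eventually_elim
        case (elim a)
        have n: "norm (plane_dir u v a + circ x) = 2 * \<bar>a \<bullet> rot_fst x u v\<bar> / norm (plane_coord u v a)"
          unfolding plane_dir_def rotated_unit_square(2)[OF elim(1)] plane_coord_rot ..
        have "\<bar>a \<bullet> rot_fst x u v\<bar> * norm (plane_coord u v a) \<le> \<bar>a \<bullet> rot_fst x u v\<bar> * 2"
          using norm_plane_coord_le[OF uv elim(2)] by (intro mult_left_mono) auto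
        then have le: "\<bar>a \<bullet> rot_fst x u v\<bar> \<le> norm (plane_dir u v a + circ x)"
          unfolding n using elim(1) by (simp add: pos_le_divide_eq mult.commute)
        show ?case
        proof (cases "a \<bullet> rot_fst x u v = 0")
          case False
          then have "ennreal 1 / ennreal (norm (plane_dir u v a + circ x)) \<le> ennreal 1 / ennreal \<bar>a \<bullet> rot_fst x u v\<bar>"
            using le by (subst (1 2) divide_ennreal) (auto intro!: ennreal_leI divide_left_mono mult_pos_pos
              simp del: ennreal_1 zero_less_norm_iff)
          then show ?thesis by simp
        qed simp
      qed
    qed
    also have "\<dots> < \<infinity>" by fact
    finally show ?case .
  qed
  show "AE x in unit_interval. (\<integral>w. Im (herglotz w (circ x)) \<partial>distr \<tau> borel (plane_dir u v)) =
        (\<integral>a. (1 / (a \<bullet> rot_fst x u v)) *\<^sub>R a \<partial>\<tau>) \<bullet> rot_snd x u v"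
    using int
  proof eventually_elim
    case (elim x)
    have "integrable \<tau> (\<lambda>a. (1 / (a \<bullet> rot_fst x u v)) *\<^sub>R a)"
    proof (rule integrableI_bounded)
      have "(\<integral>\<^sup>+ a. ennreal (norm ((1 / (a \<bullet> rot_fst x u v)) *\<^sub>R a)) \<partial>\<tau>) \<le> (\<integral>\<^sup>+ a. 1 / ennreal \<bar>a \<bullet> rot_fst x u v\<bar> \<partial>\<tau>)"
      proof (rule nn_integral_mono_AE)
        show "AE a in \<tau>. ennreal (norm ((1 / (a \<bullet> rot_fst x u v)) *\<^sub>R a)) \<le> 1 / ennreal \<bar>a \<bullet> rot_fst x u v\<bar>"
          using sph
        proof eventually_elim
          case (elim a)
          show ?case
            by (cases "a \<bullet> rot_fst x u v = 0") (use elim in \<open>auto simp: divide_ennreal ennreal_1[symmetric] simp del: ennreal_1\<close>)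
        qed
      qed
      then show "(\<integral>\<^sup>+ a. ennreal (norm ((1 / (a \<bullet> rot_fst x u v)) *\<^sub>R a)) \<partial>\<tau>) < \<infinity>"
        using elim by (rule le_less_trans)
    qed measurable
    then have "(\<integral>a. (1 / (a \<bullet> rot_fst x u v)) *\<^sub>R a \<partial>\<tau>) \<bullet> rot_snd x u v =
        (\<integral>a. ((1 / (a \<bullet> rot_fst x u v)) *\<^sub>R a) \<bullet> rot_snd x u v \<partial>\<tau>)"
      by (simp only: integral_inner_left)
    also have "\<dots> = (\<integral>a. Im (herglotz (plane_dir u v a) (circ x)) \<partial>\<tau>)"
    proof (rule integral_cong_AE)
      show "AE a in \<tau>. ((1 / (a \<bullet> rot_fst x u v)) *\<^sub>R a) \<bullet> rot_snd x u v = Im (herglotz (plane_dir u v a) (circ x))"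
        using nz
      proof eventually_elim
        case (elim a)
        show ?case unfolding plane_dir_def rotated_unit_square(1)[OF elim] plane_coord_rot by simp
      qed
    qed measurable
    also have "\<dots> = (\<integral>w. Im (herglotz w (circ x)) \<partial>distr \<tau> borel (plane_dir u v))"
      by (rule integral_distr[symmetric]) measurable
    finally show ?case by simp
  qed
qed

context cauchy_model
begin

text \<open>Fix a matrix outside the null sets. In its plane the image of \<open>\<nu>\<close> is dominated by the image of \<open>\<mu>\<close>.
  The latter does not charge the direction of \<open>x\<close>, since \<open>\<mu>\<close>-almost no vector projects to the line of the
  projection of \<open>x\<close>; the former charges it at least by \<open>\<nu> {x}\<close>.\<close>

theorem no_negative_point_mass:
  assumes x: "norm x = 1" "emeasure \<mu> {x} = 0" "emeasure \<mu> {- x} = 0"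
  shows "emeasure \<nu> {x} = 0"
proof (rule ccontr)
  assume pos: "emeasure \<nu> {x} \<noteq> 0"
  have 1: "AE Q in H. \<forall>n. angular_mean (1 / real (Suc n)) (column i Q) (column j Q) = exp (- (1 / real (Suc n)))"
    by (subst AE_all_countable, intro allI angular_mean_AE) simp
  have 2: "AE Q in H. AE a in \<mu>. plane_form i j Q a x \<noteq> 0"
  proof -
    interpret PP: pair_sigma_finite \<mu> H ..
    have "AE a in \<mu>. a \<noteq> x" by (rule AE_I[of _ _ "{x}"]) (use x(2) in auto)
    moreover have "AE a in \<mu>. a \<noteq> - x" by (rule AE_I[of _ _ "{- x}"]) (use x(3) in auto)
    ultimately have "AE a in \<mu>. AE Q in H. plane_form i j Q a x \<noteq> 0"
      using sphere_mu by eventually_elim (intro plane_form_nonzero ij x(1))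
    moreover have "(\<lambda>p. plane_form i j (snd p) (fst p) x) \<in> borel_measurable (borel \<Otimes>\<^sub>M borel)"
      unfolding plane_form_def by measurable
    from measurable_pair_coarser[OF measurable_ident_sets[OF sets_mu] ident_H this]
    have [measurable]: "(\<lambda>p. plane_form i j (snd p) (fst p) x) \<in> borel_measurable (\<mu> \<Otimes>\<^sub>M H)" .
    ultimately show ?thesis
      by (subst PP.AE_commute[symmetric]) measurable
  qed
  have "AE Q in H. False"
    using AE_space 1 2 integrable_rotated[OF P.finite_measure_axioms sets_mu int_mu]
      integrable_rotated[OF N.finite_measure_axioms sets_nu int_nu]
  proof eventually_elim
    case (elim Q)
    define u where "u = column i Q"
    define v where "v = column j Q"
    note uv = frame[OF elim(1), folded u_def v_def]
    note mean = elim(2)[folded u_def v_def] and form = elim(3)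
      and im = elim(4)[folded u_def v_def] and iN = elim(5)[folded u_def v_def]
    note pm = planar_pushforward[OF uv P.finite_measure_axioms sets_mu sphere_mu im]
    note pn = planar_pushforward[OF uv N.finite_measure_axioms sets_nu sphere_nu iN]
    let ?M = "distr \<mu> borel (plane_dir u v)" and ?N = "distr \<nu> borel (plane_dir u v)"
    have md: "plane_dir u v \<in> measurable \<mu> borel" "plane_dir u v \<in> measurable \<nu> borel"
      by simp_all
    have sp: "space \<mu> = UNIV" "space \<nu> = UNIV"
      using sets_eq_imp_space_eq[OF sets_mu] sets_eq_imp_space_eq[OF sets_nu] by simp_all
    have dom: "emeasure ?N {plane_dir u v x} \<le> emeasure ?M {plane_dir u v x}"
    proof (rule cauchy_law_dominated)
      show "finite_measure ?M" "finite_measure ?N"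
        using md by (auto intro: P.finite_measure_distr N.finite_measure_distr)
      show "AE w in ?M. norm w = 1" "AE w in ?N. norm w = 1" using pm(1) pn(1) .
      show "AE x in unit_interval. (\<integral>\<^sup>+ w. 1 / ennreal (norm (w + circ x)) \<partial>?M) < \<infinity>"
        "AE x in unit_interval. (\<integral>\<^sup>+ w. 1 / ennreal (norm (w + circ x)) \<partial>?N) < \<infinity>"
        using pm(2) pn(2) .
      fix n
      let ?s = "1 / real (Suc n)"
      have [measurable]: "(\<lambda>x. T (rot_fst x u v) \<bullet> rot_snd x u v) \<in> borel_measurable borel" by measurable
      have "(\<integral>x. cos (?s * ((\<integral>w. Im (herglotz w (circ x)) \<partial>?M) - (\<integral>w. Im (herglotz w (circ x)) \<partial>?N))) \<partial>unit_interval) =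
          angular_mean ?s u v"
        unfolding angular_mean_def
      proof (rule integral_cong_AE)
        interpret dM: finite_measure ?M using md by (auto intro: P.finite_measure_distr)
        interpret dN: finite_measure ?N using md by (auto intro: N.finite_measure_distr)
        show "(\<lambda>x. cos (?s * ((\<integral>w. Im (herglotz w (circ x)) \<partial>?M) - (\<integral>w. Im (herglotz w (circ x)) \<partial>?N)))) \<in> borel_measurable unit_interval"
          by measurable
        show "AE x in unit_interval. cos (?s * ((\<integral>w. Im (herglotz w (circ x)) \<partial>?M) - (\<integral>w. Im (herglotz w (circ x)) \<partial>?N))) =
           cos (?s * (T (rot_fst x u v) \<bullet> rot_snd x u v))"
          using pm(3) pn(3)
          by eventually_elim (simp add: barycentre_map_def inner_diff_left rot_inner[OF uv])
      qed measurable
      also have "\<dots> = exp (- ?s * (measure ?M UNIV - measure ?N UNIV))"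
        using mean mass md by (simp add: measure_distr sp)
      finally show "(\<integral>x. cos (?s * ((\<integral>w. Im (herglotz w (circ x)) \<partial>?M) - (\<integral>w. Im (herglotz w (circ x)) \<partial>?N))) \<partial>unit_interval) =
          exp (- ?s * (measure ?M UNIV - measure ?N UNIV))" .
    qed simp_all
    have x0: "plane_coord u v x \<noteq> 0"
    proof
      assume z: "plane_coord u v x = 0"
      have "AE a in \<nu>. a \<noteq> x"
        using plane_coord_nonzero[OF uv sets_nu iN] by eventually_elim (use z in auto)
      then have "emeasure \<nu> {a \<in> space \<nu>. \<not> a \<noteq> x} = 0"
        by (subst AE_iff_measurable[OF _ refl, symmetric]) (auto simp: sp)
      then show False using pos by (simp add: sp)
    qed
    have "AE a in \<mu>. plane_dir u v a \<noteq> plane_dir u v x"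
      using plane_coord_nonzero[OF uv sets_mu im] form
      by eventually_elim (use plane_dir_eqD[OF _ x0] in \<open>auto simp: plane_form_def u_def v_def\<close>)
    then have "emeasure ?M {plane_dir u v x} = 0"
      using md by (simp add: emeasure_distr sp vimage_def AE_iff_measurable[OF _ refl, of \<mu>] )
    moreover have "emeasure \<nu> {x} \<le> emeasure ?N {plane_dir u v x}"
      by (subst emeasure_distr[OF md(2)]) (auto intro!: emeasure_mono measurable_sets_borel[OF plane_dir_measurable] simp: sp)
    ultimately show False using dom pos by auto
  qed
  then show False by simp
qed

end

text \<open>Remove all basic open sets of measure zero and pick a remaining point \<open>x\<close>. Each basic neighbourhood of
  \<open>x\<close> has a null complement, and countably many of these complements cover everything except \<open>x\<close>.\<close>

lemma zero_one_measure_point: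
  fixes \<tau> :: "'a :: {second_countable_topology, t1_space} measure"
  assumes st [simp]: "sets \<tau> = sets borel" and pos: "emeasure \<tau> UNIV \<noteq> 0"
    and zo: "\<And>B. B \<in> sets borel \<Longrightarrow> emeasure \<tau> B = 0 \<or> emeasure \<tau> (- B) = 0"
  shows "\<exists>x. emeasure \<tau> {x} \<noteq> 0"
proof -
  obtain \<B> :: "'a set set" where B: "countable \<B>" "topological_basis \<B>"
    using ex_countable_basis by blast
  have open_B: "b \<in> sets borel" if "b \<in> \<B>" for b
    using topological_basis_open[OF B(2) that] by simp
  define Z where "Z = {b \<in> \<B>. emeasure \<tau> b = 0}"
  have "(\<Union>b\<in>Z. b) \<in> null_sets \<tau>"
    by (rule null_sets_UN') (use B(1) open_B in \<open>auto simp: Z_def null_sets_def\<close>)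
  then have "emeasure \<tau> (\<Union>b\<in>Z. b) = 0" by auto
  then have "(\<Union>b\<in>Z. b) \<noteq> UNIV" using pos by auto
  then obtain x where x: "x \<notin> (\<Union>b\<in>Z. b)" by blast
  define Y where "Y = {b \<in> \<B>. x \<in> b}"
  have "(\<Union>b\<in>Y. - b) \<in> null_sets \<tau>"
  proof (rule null_sets_UN')
    show "countable Y" using B(1) by (simp add: Y_def)
    show "- b \<in> null_sets \<tau>" if "b \<in> Y" for b
      using zo[of b] open_B x that by (auto simp: Y_def Z_def null_sets_def)
  qed
  then have "emeasure \<tau> (\<Union>b\<in>Y. - b) = 0" by auto
  moreover have "(\<Union>b\<in>Y. - b) = - {x}"
  proof (intro equalityI subsetI)
    fix y assume "y \<in> - {x}"
    then obtain U where "open U" "x \<in> U" "y \<notin> U" using t1_space[of x y] by auto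
    then obtain b where "b \<in> \<B>" "x \<in> b" "b \<subseteq> U" using topological_basisE[OF B(2)] by metis
    then show "y \<in> (\<Union>b\<in>Y. - b)" using \<open>y \<notin> U\<close> by (auto simp: Y_def)
  qed (auto simp: Y_def)
  ultimately have "emeasure \<tau> (- {x}) = 0" by simp
  moreover have "emeasure \<tau> UNIV \<le> emeasure \<tau> {x} + emeasure \<tau> (- {x})"
    using emeasure_subadditive[of "{x}" \<tau> "- {x}"] by simp
  ultimately have "emeasure \<tau> {x} \<noteq> 0" using pos by auto
  then show ?thesis by blast
qed

section \<open>Borel structure of the projective space and the Grassmannian\<close>

lemma space_borel_of [simp]: "space (borel_of X) = topspace X"
  unfolding borel_of_def by (rule space_measure_of) (auto dest: openin_subset)

lemma openin_borel_of: "openin X U \<Longrightarrow> U \<in> sets (borel_of X)"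
  unfolding borel_of_def by (subst sets_measure_of) (auto dest: openin_subset)

lemma continuous_map_borel_of:
  assumes "continuous_map X euclidean f"
  shows "f \<in> borel_measurable (borel_of X)"
proof (rule borel_measurableI)
  fix S :: "'b set" assume "open S"
  then have "openin X {x \<in> topspace X. f x \<in> S}"
    using assms by (auto simp: continuous_map_def)
  also have "{x \<in> topspace X. f x \<in> S} = f -` S \<inter> space (borel_of X)" by auto
  finally show "f -` S \<inter> space (borel_of X) \<in> sets (borel_of X)" by (rule openin_borel_of)
qed

lemma continuous_map_quotient_topology:
  assumes "continuous_map X Y (g \<circ> q)"
  shows "continuous_map (quotient_topology X q) Y g"
  by (rule continuous_compose_quotient_map[OF quotient_map_quotient_topology assms])

lemma topspace_projective_space: "topspace projective_space = proj_class ` sphere 0 1"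
  by (simp add: projective_space_def topspace_quotient_topology)

lemma unit_rep_proj_class: "unit_rep (proj_class a) = a \<or> unit_rep (proj_class a) = - a"
proof -
  have "unit_rep (proj_class a) \<in> proj_class a"
    unfolding unit_rep_def by (rule someI[of _ a]) (simp add: proj_class_def)
  then show ?thesis by (simp add: proj_class_def)
qed

lemma in_projective_space:
  assumes "l \<in> topspace projective_space" "a \<in> l"
  shows "norm a = 1" "l = {a, - a}"
  using assms by (auto simp: topspace_projective_space proj_class_def)

text \<open>The matrix of the orthogonal projection to the line. It does not depend on the sign of the
  representative and hence is continuous on the quotient.\<close>

definition proj_outer :: "(real ^ 'n) set \<Rightarrow> real ^ 'n ^ 'n" where
  "proj_outer l = (\<chi> k m. unit_rep l $ k * unit_rep l $ m)"

lemma proj_outer_measurable [measurable]: "proj_outer \<in> borel_measurable (borel_of projective_space)"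
proof (rule continuous_map_borel_of)
  have eq: "(\<chi> k m. a $ k * a $ m) = (proj_outer \<circ> proj_class) a" for a :: "real ^ 'n"
    using unit_rep_proj_class[of a] by (auto simp: proj_outer_def vec_eq_iff)
  have "continuous_on (sphere 0 1) (\<lambda>a :: real ^ 'n. \<chi> k m. a $ k * a $ m)"
    by (intro continuous_intros)
  then show "continuous_map projective_space euclidean (proj_outer :: (real ^ 'n) set \<Rightarrow> _)"
    unfolding projective_space_def
    by (intro continuous_map_quotient_topology) (simp add: eq o_def)
qed

text \<open>The representative chosen by \<open>unit_rep\<close> need not depend measurably on the line. If the \<open>k\<close>-th
  coordinate of the representative \<open>a\<close> is nonzero, the normalised \<open>k\<close>-th column of the projection matrix
  is \<open>\<plusminus> a\<close> and depends measurably on the line; induction over the coordinates patches these choices.\<close>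

lemma projective_section_exists:
  obtains r :: "(real ^ 'n) set \<Rightarrow> real ^ 'n" where "r \<in> borel_measurable (borel_of projective_space)"
    "\<And>l. l \<in> topspace projective_space \<Longrightarrow> r l \<in> l"
proof -
  have "\<exists>r :: (real ^ 'n) set \<Rightarrow> real ^ 'n. r \<in> borel_measurable (borel_of projective_space) \<and>
      (\<forall>l\<in>topspace projective_space. (\<exists>k\<in>K. unit_rep l $ k \<noteq> 0) \<longrightarrow> r l \<in> l)" if "finite K" for K
    using that
  proof induction
    case empty
    show ?case by (rule exI[of _ "\<lambda>_. 0"]) auto
  next
    case (insert k K)
    then obtain r where r [measurable]: "r \<in> borel_measurable (borel_of projective_space)"
      and rl: "\<And>l. l \<in> topspace projective_space \<Longrightarrow> (\<exists>k\<in>K. unit_rep l $ k \<noteq> 0) \<Longrightarrow> r l \<in> (l :: (real ^ 'n) set)"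
      by blast
    define r' where "r' l = (if proj_outer l $ k $ k = 0 then r l
      else (1 / sqrt (proj_outer l $ k $ k)) *\<^sub>R column k (proj_outer l))" for l
    have [measurable]: "(\<lambda>A :: real ^ 'n ^ 'n. A $ k $ k) \<in> borel_measurable borel"
      by (rule borel_measurable_continuous_onI) (intro continuous_intros)
    have r'm: "r' \<in> borel_measurable (borel_of projective_space)"
      unfolding r'_def by measurable
    have r'l: "r' l \<in> l" if l: "l \<in> topspace projective_space" and "\<exists>k\<in>insert k K. unit_rep l $ k \<noteq> 0" for l
    proof (cases "unit_rep l $ k = 0")
      case True
      then show ?thesis using that rl[OF l] by (simp add: r'_def proj_outer_def)
    next
      case False
      define a where "a = unit_rep l"
      have "a \<in> l"
      proof -
        obtain b where "b \<in> l" using l by (auto simp: topspace_projective_space proj_class_def)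
        then show ?thesis unfolding a_def unit_rep_def by (rule someI)
      qed
      then have la: "l = {a, - a}" by (rule in_projective_space(2)[OF l])
      have "r' l = (a $ k / \<bar>a $ k\<bar>) *\<^sub>R a"
        using False by (simp add: r'_def proj_outer_def a_def[symmetric] column_def vec_eq_iff real_sqrt_mult_self)
      moreover have "a $ k / \<bar>a $ k\<bar> = 1 \<or> a $ k / \<bar>a $ k\<bar> = - 1"
        using False by (auto simp: a_def[symmetric] abs_if)
      ultimately have "r' l = a \<or> r' l = - a" by auto
      moreover have "a \<in> l" "- a \<in> l" by (subst la, simp)+
      ultimately show ?thesis by metis
    qed
    show ?case
      by (intro exI[of _ r'] conjI ballI impI) (rule r'm, rule r'l)
  qed
  from this[OF finite[of UNIV]] obtain r :: "(real ^ 'n) set \<Rightarrow> real ^ 'n" where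
    r: "r \<in> borel_measurable (borel_of projective_space)"
    "\<forall>l\<in>topspace projective_space. (\<exists>k\<in>UNIV. unit_rep l $ k \<noteq> 0) \<longrightarrow> r l \<in> l"
    by (elim exE conjE) (rule that)
  have nz: "\<exists>k\<in>UNIV. unit_rep l $ k \<noteq> 0" if l: "l \<in> topspace projective_space" for l :: "(real ^ 'n) set"
  proof -
    obtain b :: "real ^ 'n" where b: "norm b = 1" "l = proj_class b" using l by (auto simp: topspace_projective_space)
    then have "unit_rep l \<noteq> 0" using unit_rep_proj_class[of b] by auto
    then show ?thesis by (auto simp: vec_eq_iff)
  qed
  show ?thesis
  proof (rule that[of r])
    show "r \<in> borel_measurable (borel_of projective_space)" by (rule r(1))
    show "r l \<in> l" if l: "l \<in> topspace projective_space" for l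
      by (rule mp[OF bspec[OF r(2) l] nz[OF l]])
  qed
qed

lemma oriented_plane_self:
  assumes "(u, v) \<in> orthonormal_frames"
  shows "(u, v) \<in> oriented_plane (u, v)"
  using assms by (auto simp: oriented_plane_def orthonormal_frames_def norm_eq_1 inner_commute)

text \<open>The change of basis between orthonormal frames is orthogonal, so its determinant has square \<open>1\<close>; the orientation
  makes it \<open>1\<close>.\<close>

lemma wedge_oriented_plane:
  assumes uv: "(u, v) \<in> orthonormal_frames" and xy: "(x, y) \<in> oriented_plane (u, v)"
  shows "wedge x y = wedge u v"
proof -
  have o: "u \<bullet> u = 1" "v \<bullet> v = 1" "u \<bullet> v = 0" "x \<bullet> x = 1" "y \<bullet> y = 1" "x \<bullet> y = 0"
    and sp: "span {x, y} = span {u, v}" and pos: "(x \<bullet> u) * (y \<bullet> v) - (x \<bullet> v) * (y \<bullet> u) > 0"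
    using uv xy by (auto simp: oriented_plane_def orthonormal_frames_def norm_eq_1)
  have comb: "\<exists>a b. z = a *\<^sub>R u + b *\<^sub>R v" if "z \<in> {x, y}" for z
  proof -
    have "z \<in> span {u, v}" using that span_base[of z "{x, y}"] sp by auto
    then obtain a where "z - a *\<^sub>R u \<in> span {v}" using span_breakdown_eq[of z u "{v}"] by auto
    then obtain b where "z - a *\<^sub>R u = b *\<^sub>R v" by (auto simp: span_singleton)
    then show ?thesis by (intro exI[of _ a] exI[of _ b]) (simp add: algebra_simps)
  qed
  obtain a b where x: "x = a *\<^sub>R u + b *\<^sub>R v" using comb[of x] by blast
  obtain c d where y: "y = c *\<^sub>R u + d *\<^sub>R v" using comb[of y] by blast
  note ip = inner_add_left inner_add_right inner_commute[of v u] o(1-3)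
  have "a * a + b * b = 1" "c * c + d * d = 1" "a * c + b * d = 0"
    using o(4-6) unfolding x y by (simp_all add: ip mult.commute)
  moreover have "(a * a + b * b) * (c * c + d * d) = (a * d - b * c)\<^sup>2 + (a * c + b * d)\<^sup>2"
    by (simp add: power2_eq_square algebra_simps)
  ultimately have "(a * d - b * c)\<^sup>2 = 1" by simp
  moreover have "0 < a * d - b * c" using pos unfolding x y by (simp add: ip)
  ultimately have "a * d - b * c = 1" by (simp add: power2_eq_1_iff)
  then show ?thesis unfolding x y wedge_combination by simp
qed

definition plane_wedge :: "((real ^ 'n) \<times> (real ^ 'n)) set \<Rightarrow> real ^ 'n ^ 'n" where
  "plane_wedge P = (case SOME p. p \<in> P of (u, v) \<Rightarrow> wedge u v)"

lemma plane_wedge_oriented_plane: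
  assumes "(u, v) \<in> orthonormal_frames"
  shows "plane_wedge (oriented_plane (u, v)) = wedge u v"
proof -
  have "(SOME p. p \<in> oriented_plane (u, v)) \<in> oriented_plane (u, v)"
    by (rule someI[of _ "(u, v)"]) (rule oriented_plane_self[OF assms])
  moreover obtain x y where xy: "(SOME p. p \<in> oriented_plane (u, v)) = (x, y)" by fastforce
  ultimately have "wedge x y = wedge u v" by (intro wedge_oriented_plane[OF assms]) simp
  then show ?thesis by (simp add: plane_wedge_def xy)
qed

lemma plane_wedge_measurable [measurable]:
  "plane_wedge \<in> borel_measurable (borel_of oriented_grassmannian)"
proof (rule continuous_map_borel_of)
  have "continuous_on orthonormal_frames (\<lambda>p :: (real ^ 'n) \<times> (real ^ 'n). plane_wedge (oriented_plane p))"
    by (rule continuous_on_eq[OF wedge_continuous]) (auto simp: plane_wedge_oriented_plane)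
  then show "continuous_map oriented_grassmannian euclidean (plane_wedge :: ((real ^ 'n) \<times> (real ^ 'n)) set \<Rightarrow> _)"
    unfolding oriented_grassmannian_def
    by (intro continuous_map_quotient_topology) (simp add: o_def)
qed

text \<open>The law of \<open>X\<close> restricted to the event \<open>Y \<in> A\<close> is the Cauchy law scaled by the probability of that
  event.\<close>

lemma conditional_cauchy_integral:
  assumes H: "prob_space H" and cl: "conditional_law H X N Y \<kappa>"
    and cauchy: "AE P in distr H N Y. \<kappa> P = std_cauchy"
    and A: "A \<in> sets N" and s: "0 \<le> s"
  shows "(\<integral>\<omega>. indicator A (Y \<omega>) * cos (s * X \<omega>) \<partial>H) = exp (- s) * measure H {\<omega> \<in> space H. Y \<omega> \<in> A}"
proof -
  interpret H: prob_space H by fact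
  have X [measurable]: "X \<in> borel_measurable H" and Y [measurable]: "Y \<in> measurable H N"
    using cl by (auto simp: conditional_law_def)
  note [measurable] = A
  define E where "E = {\<omega> \<in> space H. Y \<omega> \<in> A}"
  have E [measurable]: "E \<in> sets H" unfolding E_def by measurable
  have eq: "emeasure H {\<omega> \<in> space H. Y \<omega> \<in> A \<and> X \<omega> \<in> C} = emeasure std_cauchy C * emeasure H E"
    if "C \<in> sets borel" for C
  proof -
    have "emeasure H {\<omega> \<in> space H. Y \<omega> \<in> A \<and> X \<omega> \<in> C} = (\<integral>\<^sup>+ y \<in> A. emeasure (\<kappa> y) C \<partial>distr H N Y)"
      using cl A that by (auto simp: conditional_law_def)
    also have "\<dots> = (\<integral>\<^sup>+ y. emeasure std_cauchy C * indicator A y \<partial>distr H N Y)"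
      by (rule nn_integral_cong_AE) (use cauchy in \<open>eventually_elim, auto\<close>)
    also have "\<dots> = emeasure std_cauchy C * emeasure (distr H N Y) A"
      by (rule nn_integral_cmult_indicator) simp
    also have "emeasure (distr H N Y) A = emeasure H E"
      by (subst emeasure_distr) (auto simp: E_def intro!: arg_cong[where f = "emeasure H"])
    finally show ?thesis .
  qed
  have "distr (density H (indicator E)) borel X = density std_cauchy (\<lambda>_. emeasure H E)"
  proof (rule measure_eqI)
    fix C assume "C \<in> sets (distr (density H (indicator E)) borel X)"
    then have C [measurable]: "C \<in> sets borel" by simp
    have "emeasure (distr (density H (indicator E)) borel X) C = emeasure (density H (indicator E)) (X -` C \<inter> space H)"
      by (subst emeasure_distr) auto
    also have "\<dots> = emeasure H (E \<inter> (X -` C \<inter> space H))"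
      by (subst emeasure_density) (auto simp: indicator_inter_arith[symmetric])
    also have "E \<inter> (X -` C \<inter> space H) = {\<omega> \<in> space H. Y \<omega> \<in> A \<and> X \<omega> \<in> C}"
      by (auto simp: E_def)
    also have "emeasure H \<dots> = emeasure std_cauchy C * emeasure H E" by (rule eq[OF C])
    also have "\<dots> = emeasure (density std_cauchy (\<lambda>_. emeasure H E)) C"
      by (subst emeasure_density_const) (auto simp: std_cauchy_def mult.commute)
    finally show "emeasure (distr (density H (indicator E)) borel X) C = emeasure (density std_cauchy (\<lambda>_. emeasure H E)) C" .
  qed (simp add: std_cauchy_def)
  then have "(\<integral>x. cos (s * x) \<partial>distr (density H (indicator E)) borel X) = (\<integral>x. cos (s * x) \<partial>density std_cauchy (\<lambda>_. ennreal (measure H E)))"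
    by (simp add: H.emeasure_eq_measure)
  also have "\<dots> = measure H E * (\<integral>x. cos (s * x) \<partial>std_cauchy)"
    by (subst integral_density) (auto simp: std_cauchy_def)
  also have "\<dots> = exp (- s) * measure H E" by (simp add: cauchy_characteristic[OF s])
  also have "(\<integral>x. cos (s * x) \<partial>distr (density H (indicator E)) borel X) = (\<integral>\<omega>. cos (s * X \<omega>) \<partial>density H (\<lambda>\<omega>. ennreal (indicator E \<omega>)))"
    by (subst integral_distr) (auto simp: ennreal_indicator)
  also have "\<dots> = (\<integral>\<omega>. indicator E \<omega> * cos (s * X \<omega>) \<partial>H)"
    by (subst integral_density) auto
  also have "\<dots> = (\<integral>\<omega>. indicator A (Y \<omega>) * cos (s * X \<omega>) \<partial>H)"
    by (rule Bochner_Integration.integral_cong) (auto simp: E_def split: split_indicator)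
  finally show ?thesis by (simp add: E_def)
qed

section \<open>The negative part is atomless\<close>

theorem corollary7p6:
  fixes \<eta> :: "(real ^ 'n) set set \<Rightarrow> real"
    and \<eta>p \<eta>n :: "(real ^ 'n) set measure"
    and H :: "(real ^ 'n ^ 'n) measure"
    and i j :: 'n
    and \<kappa> :: "((real ^ 'n) \<times> (real ^ 'n)) set \<Rightarrow> real measure"
  assumes dim: "CARD('n) \<ge> 2"
    and signed: "signed_measure (borel_of projective_space) \<eta>"
    and mass_one: "\<eta> (topspace projective_space) = 1"
    and jordan: "jordan_decomposition (borel_of projective_space) \<eta> \<eta>p \<eta>n"
    and haar: "haar_orthogonal H"
    and two_columns: "i \<noteq> j"
    and integrability:
      "AE u in distr H (restrict_space borel (sphere 0 1)) (column i).
         (\<integral>\<^sup>+ l. 1 / ennreal \<bar>unit_rep l \<bullet> u\<bar> \<partial>total_variation \<eta>p \<eta>n) < \<infinity>"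
    and cond_law:
      "conditional_law H (\<lambda>Q. T_map \<eta>p \<eta>n (column i Q) \<bullet> column j Q)
         (borel_of oriented_grassmannian) (\<lambda>Q. oriented_plane (column i Q, column j Q)) \<kappa>"
    and cauchy:
      "AE P in distr H (borel_of oriented_grassmannian) (\<lambda>Q. oriented_plane (column i Q, column j Q)).
         \<kappa> P = std_cauchy"
  shows "atomless \<eta>n \<and>
    (purely_atomic \<eta>n \<longrightarrow>
      (\<exists>\<mu>. prob_space \<mu> \<and> sets \<mu> = sets (borel_of projective_space) \<and>
         (\<forall>A \<in> sets (borel_of projective_space). \<eta> A = measure \<mu> A)))"
proof -
  let ?RP = "borel_of projective_space :: (real ^ 'n) set measure"
  interpret haar H by standard (rule haar)
  have finp: "finite_measure \<eta>p" and finn: "finite_measure \<eta>n"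
    and sp [measurable_cong, simp]: "sets \<eta>p = sets ?RP" and sn [measurable_cong, simp]: "sets \<eta>n = sets ?RP"
    and diff: "\<And>A. A \<in> sets ?RP \<Longrightarrow> \<eta> A = measure \<eta>p A - measure \<eta>n A"
    using jordan by (auto simp: jordan_decomposition_def)
  obtain D where D: "D \<in> sets ?RP" "emeasure \<eta>p (space ?RP - D) = 0" "emeasure \<eta>n D = 0"
    using jordan by (auto simp: jordan_decomposition_def)
  interpret p: finite_measure \<eta>p by (rule finp)
  interpret n: finite_measure \<eta>n by (rule finn)
  have spp: "space \<eta>p = topspace projective_space" and spn: "space \<eta>n = topspace projective_space"
    using sets_eq_imp_space_eq[OF sp] sets_eq_imp_space_eq[OF sn] by simp_all
  obtain r :: "(real ^ 'n) set \<Rightarrow> real ^ 'n" where r [measurable]: "r \<in> borel_measurable ?RP"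
    and rl: "\<And>l. l \<in> topspace projective_space \<Longrightarrow> r l \<in> l"
    using projective_section_exists[where 'n = 'n] by metis
  have rp: "r \<in> measurable \<eta>p borel" and rn: "r \<in> measurable \<eta>n borel"
    by measurable
  have norm_r: "norm (r l) = 1" if "l \<in> topspace projective_space" for l
    using in_projective_space(1)[OF that rl[OF that]] .
  let ?m = "distr \<eta>p borel r" and ?n = "distr \<eta>n borel r"
  have push_int: "AE Q in H. (\<integral>\<^sup>+ a. 1 / ennreal \<bar>a \<bullet> column i Q\<bar> \<partial>distr \<tau> borel r) < \<infinity>"
    if \<tau>: "sets \<tau> = sets ?RP" and le: "\<And>f. (\<integral>\<^sup>+ l. f l \<partial>\<tau>) \<le> (\<integral>\<^sup>+ l. f l \<partial>total_variation \<eta>p \<eta>n)" for \<tau>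
  proof -
    note [measurable_cong] = \<tau>
    have "column i \<in> measurable H (restrict_space borel (sphere 0 1))"
    proof (rule measurable_restrict_space2)
      show "column i \<in> space H \<rightarrow> sphere 0 1"
        using orthonormal_columns[of _ i i] by (auto simp: space_H norm_eq_1)
    qed measurable
    from AE_distrD[OF this integrability] show ?thesis
    proof eventually_elim
      case (elim Q)
      have "(\<integral>\<^sup>+ a. 1 / ennreal \<bar>a \<bullet> column i Q\<bar> \<partial>distr \<tau> borel r) = (\<integral>\<^sup>+ l. 1 / ennreal \<bar>r l \<bullet> column i Q\<bar> \<partial>\<tau>)"
        by (rule nn_integral_distr) measurable
      also have "\<dots> = (\<integral>\<^sup>+ l. 1 / ennreal \<bar>unit_rep l \<bullet> column i Q\<bar> \<partial>\<tau>)"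
        by (rule nn_integral_cong) (use unit_rep_indep(2)[OF rl] sets_eq_imp_space_eq[OF \<tau>] in simp)
      also have "\<dots> < \<infinity>" using le elim by (rule le_less_trans)
      finally show ?case .
    qed
  qed
  have T_eq: "T_map \<eta>p \<eta>n u = barycentre_map ?m ?n u" for u
  proof -
    have "(\<integral>a. (1 / (a \<bullet> u)) *\<^sub>R a \<partial>distr \<tau> borel r) = (\<integral>l. (1 / (unit_rep l \<bullet> u)) *\<^sub>R unit_rep l \<partial>\<tau>)"
      if \<tau>: "sets \<tau> = sets ?RP" for \<tau>
    proof -
      note [measurable_cong] = \<tau>
      have "(\<integral>a. (1 / (a \<bullet> u)) *\<^sub>R a \<partial>distr \<tau> borel r) = (\<integral>l. (1 / (r l \<bullet> u)) *\<^sub>R r l \<partial>\<tau>)"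
        by (rule integral_distr) measurable
      also have "\<dots> = (\<integral>l. (1 / (unit_rep l \<bullet> u)) *\<^sub>R unit_rep l \<partial>\<tau>)"
        by (rule Bochner_Integration.integral_cong) (use unit_rep_indep(1)[OF rl] sets_eq_imp_space_eq[OF \<tau>] in simp_all)
      finally show ?thesis .
    qed
    then show ?thesis by (simp add: T_map_def signed_integral_def barycentre_map_def)
  qed
  have frames: "(column i Q, column j Q) \<in> orthonormal_frames" if "Q \<in> space H" for Q
    using orthonormal_columns[of Q] that two_columns by (auto simp: orthonormal_frames_def space_H norm_eq_1)
  interpret cauchy_model H ?m ?n i j
  proof (intro cauchy_model.intro cauchy_model_axioms.intro)
    show "haar H" by (rule haar_axioms)
    show "finite_measure ?m" "finite_measure ?n"
      using rp rn by (auto intro: p.finite_measure_distr n.finite_measure_distr)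
    show "AE a in ?m. norm a = 1" "AE a in ?n. norm a = 1"
      using rp rn norm_r by (auto simp: AE_distr_iff spp spn)
    show "measure ?m UNIV - measure ?n UNIV = 1"
      using diff[of "topspace projective_space"] mass_one sets.top[of ?RP] rp rn
      by (simp add: measure_distr spp spn)
    show "AE Q in H. (\<integral>\<^sup>+ a. 1 / ennreal \<bar>a \<bullet> column i Q\<bar> \<partial>?m) < \<infinity>"
      "AE Q in H. (\<integral>\<^sup>+ a. 1 / ennreal \<bar>a \<bullet> column i Q\<bar> \<partial>?n) < \<infinity>"
      by (intro push_int sp sn nn_integral_total_variation_ge; simp)+
    fix s :: real and B :: "(real ^ 'n ^ 'n) set"
    assume s: "0 \<le> s" and B [measurable]: "B \<in> sets borel"
    define A where "A = plane_wedge -` B \<inter> space (borel_of oriented_grassmannian)"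
    have A: "A \<in> sets (borel_of oriented_grassmannian)"
      unfolding A_def by (rule measurable_sets[OF plane_wedge_measurable B])
    have iff: "oriented_plane (column i Q, column j Q) \<in> A \<longleftrightarrow> wedge (column i Q) (column j Q) \<in> B" if "Q \<in> space H" for Q
      using frames[OF that] by (auto simp: A_def plane_wedge_oriented_plane oriented_grassmannian_def topspace_quotient_topology)
    have "(\<integral>Q. indicator B (wedge (column i Q) (column j Q)) * cos (s * (barycentre_map ?m ?n (column i Q) \<bullet> column j Q)) \<partial>H) =
      (\<integral>Q. indicator A (oriented_plane (column i Q, column j Q)) * cos (s * (T_map \<eta>p \<eta>n (column i Q) \<bullet> column j Q)) \<partial>H)"
      by (rule Bochner_Integration.integral_cong) (auto simp: T_eq iff split: split_indicator)
    also have "\<dots> = exp (- s) * measure H {Q \<in> space H. oriented_plane (column i Q, column j Q) \<in> A}"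
      by (rule conditional_cauchy_integral[OF prob_space_axioms cond_law cauchy A s])
    also have "{Q \<in> space H. oriented_plane (column i Q, column j Q) \<in> A} = {Q \<in> space H. wedge (column i Q) (column j Q) \<in> B}"
      using iff by auto
    finally show "(\<integral>Q. indicator B (wedge (column i Q) (column j Q)) * cos (s * (barycentre_map ?m ?n (column i Q) \<bullet> column j Q)) \<partial>H) =
      exp (- s) * measure H {Q \<in> space H. wedge (column i Q) (column j Q) \<in> B}" .
  qed (use two_columns in simp_all)
  \<comment> \<open>Transported to the sphere, the restriction of \<open>\<eta>n\<close> to an atom takes only two values, so it charges
    a point \<open>x\<close>. That \<open>\<mu>\<close> charges neither \<open>x\<close> nor \<open>- x\<close> follows from the Hahn set \<open>D\<close> and from the section
    picking one of the two representatives only.\<close>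
  have no_atom: "\<not> measure_atom \<eta>n A" for A
  proof
    assume "measure_atom \<eta>n A"
    then have A [measurable]: "A \<in> sets ?RP" and Apos: "emeasure \<eta>n A > 0"
      and atom: "\<And>B. B \<in> sets ?RP \<Longrightarrow> B \<subseteq> A \<Longrightarrow> emeasure \<eta>n B = 0 \<or> emeasure \<eta>n (A - B) = 0"
      by (auto simp: measure_atom_def)
    have AS: "A \<subseteq> topspace projective_space" using sets.sets_into_space[OF A] by simp
    define \<tau> where "\<tau> = distr (density \<eta>n (indicator A)) borel r"
    have tau: "emeasure \<tau> B = emeasure \<eta>n (A \<inter> r -` B)" if B: "B \<in> sets borel" for B
    proof -
      have Bm: "r -` B \<inter> space \<eta>n \<in> sets \<eta>n" by (rule measurable_sets[OF rn B])
      have An: "A \<in> sets \<eta>n" using A by simp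
      have "emeasure \<tau> B = emeasure (density \<eta>n (indicator A)) (r -` B \<inter> space \<eta>n)"
        unfolding \<tau>_def using B by (subst emeasure_distr) auto
      also have "\<dots> = emeasure \<eta>n (A \<inter> (r -` B \<inter> space \<eta>n))"
        by (rule emeasure_restricted[OF An Bm])
      also have "A \<inter> (r -` B \<inter> space \<eta>n) = A \<inter> r -` B" using AS by (auto simp: spn)
      finally show ?thesis .
    qed
    have "\<exists>x. emeasure \<tau> {x} \<noteq> 0"
    proof (rule zero_one_measure_point)
      show "emeasure \<tau> UNIV \<noteq> 0" using Apos by (simp add: tau)
      fix B :: "(real ^ 'n) set" assume B: "B \<in> sets borel"
      have "A \<inter> r -` B = A \<inter> (r -` B \<inter> space ?RP)" using AS by auto
      then have "A \<inter> r -` B \<in> sets ?RP" using measurable_sets[OF r B] by simp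
      from atom[OF this] have "emeasure \<eta>n (A \<inter> r -` B) = 0 \<or> emeasure \<eta>n (A - A \<inter> r -` B) = 0" by simp
      moreover have "A - A \<inter> r -` B = A \<inter> r -` (- B)" by auto
      ultimately show "emeasure \<tau> B = 0 \<or> emeasure \<tau> (- B) = 0" using B by (simp add: tau)
    qed (simp add: \<tau>_def)
    then obtain x where x: "emeasure \<eta>n (A \<inter> r -` {x}) \<noteq> 0" by (auto simp: tau)
    then have "A \<inter> r -` {x} \<noteq> {}" by force
    then obtain l where l: "l \<in> A" "r l = x" by auto
    have lS: "l \<in> topspace projective_space" using l AS by blast
    have x1: "norm x = 1" using norm_r[OF lS] l by simp
    have lx: "l = {x, - x}" using in_projective_space(2)[OF lS rl[OF lS]] l by simp
    have fib: "r -` {x} \<inter> topspace projective_space = {l}"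
    proof -
      have "m = l" if "m \<in> topspace projective_space" "r m = x" for m
        by (rule trans[OF in_projective_space(2)[OF that(1) rl[OF that(1)]]]) (unfold that(2) lx, rule refl)
      then show ?thesis using l(2) lS by blast
    qed
    have fib': "r -` {- x} \<inter> topspace projective_space = {}"
    proof -
      have False if "m \<in> topspace projective_space" "r m = - x" for m
      proof -
        have "m = l"
          by (rule trans[OF in_projective_space(2)[OF that(1) rl[OF that(1)]]]) (unfold that(2) lx, auto)
        then have "x = - x" using that(2) l(2) by simp
        then have "x = 0" by (simp add: eq_neg_iff_add_eq_0 vec_eq_iff)
        then show False using x1 by simp
      qed
      then show ?thesis by auto
    qed
    have ls: "{l} \<in> sets ?RP" using measurable_sets[OF r, of "{x}"] fib by simp
    have "A \<inter> r -` {x} = {l}" using fib l AS by auto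
    then have npos: "emeasure \<eta>n {l} \<noteq> 0" using x by simp
    have "l \<notin> D"
      using npos emeasure_mono[of "{l}" D \<eta>n] D by auto
    moreover have "space ?RP - D \<in> sets \<eta>p" using D(1) sp by blast
    ultimately have "emeasure \<eta>p {l} = 0"
      using emeasure_mono[of "{l}" "space ?RP - D" \<eta>p] D(2) lS by auto
    then have "emeasure ?m {x} = 0" using rp fib by (simp add: emeasure_distr spp)
    moreover have "emeasure ?m {- x} = 0" using rp fib' by (simp add: emeasure_distr spp)
    ultimately have "emeasure ?n {x} = 0" using x1 by (intro no_negative_point_mass)
    moreover have "emeasure ?n {x} = emeasure \<eta>n {l}" using rn fib by (simp add: emeasure_distr spn)
    ultimately show False using npos by simp
  qed
  have "\<exists>\<mu>. prob_space \<mu> \<and> sets \<mu> = sets ?RP \<and> (\<forall>A \<in> sets ?RP. \<eta> A = measure \<mu> A)" if pa: "purely_atomic \<eta>n"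
  proof -
    have zero: "emeasure \<eta>n A = 0" if "A \<in> sets ?RP" for A
      using pa no_atom that by (auto simp: purely_atomic_def zero_less_iff_neq_zero)
    then have eq: "\<eta> A = measure \<eta>p A" if "A \<in> sets ?RP" for A
      using diff[OF that] that by (simp add: measure_def)
    have "measure \<eta>p (space \<eta>p) = 1"
      using eq[of "topspace projective_space"] mass_one sets.top[of ?RP] by (simp add: spp)
    then have "prob_space \<eta>p" by (intro prob_spaceI) (simp add: p.emeasure_eq_measure)
    then show ?thesis using eq sp by blast
  qed
  then show ?thesis using no_atom by (auto simp: atomless_def)
qed

end
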